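(* Let $(M,\pi)$ be a Poisson manifold and consider the Lie bialgebroid $(TM,T^*M)$, where $TM$ carries its tangent Lie algebroid structure (Lie bracket of vector fields, identity anchor) and $T^*M$ the cotangent Lie algebroid structure $([\cdot,\cdot]_\pi,\pi^\sharp)$. A generalized derivation $\mathcal{D}\in\mathrm{GDer}^1(TM)$ with symbol $(l,r)$ defines a Lie-Nijenhuis bialgebroid structure on $(TM,T^*M)$ if and only if $(\pi,r)$ is a Poisson-Nijenhuis structure and $\mathcal{D}=\mathcal{D}^{r,T}$.
   Context: **Generalized derivations of degree 1.** For a vector bundle $E\to M$, a generalized derivation of degree 1 is a triple $\mathcal{D}=(D,l,r)$ with $D:\Gamma(E)\to\Omega^1(M,E)$ $\mathbb{R}$-linear and $l:E\to E$, $r:TM\to TM$ vector bundle endomorphisms over the identity, such that $D_X(fu)=fD_X(u)+(\mathcal{L}_Xf)\,l(u)-(\mathcal{L}_{r(X)}f)\,u$ for $u\in\Gamma(E)$, $f\in C^\infty(M)$, $X\in\mathfrak{X}(M)$. $(l,r)$ is the symbol. The space of these is $\mathrm{GDer}^1(E)$. The dual $\mathcal{D}^\top=(D^\top,l^*,r)\in\mathrm{GDer}^1(E^* )$ is defined by $\langle D^\top_X(\mu),u\rangle=\mathcal{L}_X\langle\mu,l(u)\rangle-\mathcal{L}_{r(X)}\langle\mu,u\rangle-\langle\mu,D_X(u)\rangle$. The condition $[\mathcal{D},\mathcal{D}]=0$ (graded Lie bracket of generalized derivations) amounts to: the Nijenhuis torsion of $r$ vanishes; $D_X\circ l=l\circ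 D_X$ for all $X$; and $D_XD_Y(u)-D_YD_X(u)-D_{[r(Y),X]+[Y,r(X)]-r([Y,X])}(u)+l(D_{[Y,X]}(u))=0$ for all $X,Y,u$. **IM (1,1)-tensors.** If $(A,[\cdot,\cdot],\rho)$ is a Lie algebroid over $M$, $\mathcal{D}=(D,l,r)\in \mathrm{GDer}^1(A)$ is an IM (1,1)-tensor if for all $a,b\in\Gamma(A)$, $X\in\mathfrak{X}(M)$: (IM1) $D_X([a,b])=[a,D_X(b)]-[b,D_X(a)]+D_{[\rho(b),X]}(a)-D_{[\rho(a),X]}(b)$; (IM2) $l([a,b])=[a,l(b)]-D_{\rho(b)}(a)$; (IM3) $r([\rho(a),X])=[\rho(a),r(X)]-\rho(D_X(a))$; (IM4) $r\circ\rho=\rho\circ l$. **Lie-Nijenhuis bialgebroid structure** on a Lie bialgebroid $(A,A^* )$: an element $\mathcal{D}\in\mathrm{GDer}^1(A)$ such that $\mathcal{D}$ is an IM (1,1)-tensor on $A$, $\mathcal{D}^\top$ is an IM (1,1)-tensor on $A^*$, and $[\mathcal{D},\mathcal{D}]=0$. **$\mathcal{D}^{r,T}$.** For $r:TM\to TM$, $\mathcal{D}^{r,T}=(D^{r,T},r,r)\in\mathrm{GDer}^1(TM)$ with $D^{r,T}_X(Y)=[Y,r(X)]-r([Y,X])$. **Poisson-Nijenhuis structures.** Write $\pi^\sharp(\alpha)=\pi(\alpha,\cdot)$ and $[\alpha,\beta]_B=\mathcal{L}_{B^\sharp(\alpha)}\beta-i_{B^\sharp(\beta)}d\alpha$ for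 a bivector field $B$. A Poisson bivector $\pi$ and $r:TM\to TM$ are compatible if $r\circ\pi^\sharp=\pi^\sharp\circ r^*$ and $[\alpha,\beta]_{\pi_r}=[r^*\alpha,\beta]_\pi+[\alpha,r^*\beta]_\pi-r^*([\alpha,\beta]_\pi)$ for all 1-forms $\alpha,\beta$, where $\pi_r^\sharp=r\circ\pi^\sharp$. $(\pi,r)$ is Poisson-Nijenhuis if moreover the Nijenhuis torsion of $r$ vanishes. *)

theory Defs
  imports "HOL-Analysis.Analysis" "HOL-Library.Function_Algebras"
begin

text \<open>
  The pointwise real vector space structure on functions complements the pointwise
  operations of \<^theory>\<open>HOL-Library.Function_Algebras\<close>. It makes smooth functions, tangent
  vectors, covectors and sections of vector bundles elements of real vector spaces.
\<close>

instantiation "fun" :: (type, real_vector) real_vector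
begin

definition scaleR_fun :: "real \<Rightarrow> ('a \<Rightarrow> 'b) \<Rightarrow> 'a \<Rightarrow> 'b" where
  "scaleR_fun c f = (\<lambda>x. c *\<^sub>R f x)"

instance
  by standard (auto simp: scaleR_fun_def fun_eq_iff scaleR_add_right scaleR_add_left)

end

lemma scaleR_fun_apply [simp]: "(c *\<^sub>R f) x = c *\<^sub>R f x"
  by (simp add: scaleR_fun_def)


section \<open>Smooth manifolds\<close>

text \<open>Only used for open \<open>S\<close> in a finite-dimensional space, where it means being of class \<open>C\<^sup>n\<close>.\<close>

primrec Ck_on :: "nat \<Rightarrow> 'a::real_normed_vector set \<Rightarrow> ('a \<Rightarrow> 'b::real_normed_vector) \<Rightarrow> bool" where
  "Ck_on 0 S f \<longleftrightarrow> continuous_on S f"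
| "Ck_on (Suc n) S f \<longleftrightarrow>
     (\<forall>x\<in>S. f differentiable (at x)) \<and> (\<forall>v. Ck_on n S (\<lambda>x. frechet_derivative f (at x) v))"

definition smooth_on :: "'a::real_normed_vector set \<Rightarrow> ('a \<Rightarrow> 'b::real_normed_vector) \<Rightarrow> bool" where
  "smooth_on S f \<longleftrightarrow> (\<forall>n. Ck_on n S f)"

type_synonym ('m, 'e) atlas = "('m set \<times> ('m \<Rightarrow> 'e)) set"

text \<open>
  The manifold is the whole type \<open>'m\<close>, with its topology (Hausdorff and second countable by the
  type class constraints). Charts \<open>(U, \<phi>)\<close> take values in a finite-dimensional inner product
  space \<open>'e\<close>; in contrast to the class \<^class>\<open>euclidean_space\<close>, this includes
  dimension \<open>0\<close>. Only the values of \<open>\<phi>\<close> on \<open>U\<close> matter. The atlas need not be maximal.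
\<close>

definition smooth_manifold ::
  "('m::{t2_space, second_countable_topology}, 'e::real_inner) atlas \<Rightarrow> bool" where
  "smooth_manifold \<A> \<longleftrightarrow>
     (\<exists>B::'e set. finite B \<and> span B = UNIV) \<and>
     (\<Union>(U, \<phi>)\<in>\<A>. U) = UNIV \<and>
     (\<forall>(U, \<phi>)\<in>\<A>. open U \<and> open (\<phi> ` U) \<and> homeomorphism U (\<phi> ` U) \<phi> (inv_into U \<phi>)) \<and>
     (\<forall>(U, \<phi>)\<in>\<A>. \<forall>(V, \<psi>)\<in>\<A>. smooth_on (\<phi> ` (U \<inter> V)) (\<psi> \<circ> inv_into U \<phi>))"

definition C_inf :: "('m, 'e::real_inner) atlas \<Rightarrow> ('m \<Rightarrow> real) set" where
  "C_inf \<A> = {f. \<forall>(U, \<phi>)\<in>\<A>. smooth_on (\<phi> ` U) (f \<circ> inv_into U \<phi>)}"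


section \<open>Vector bundles, sections and bundle maps\<close>

text \<open>
  A vector bundle over \<open>'m\<close> is represented by its fibres, linear subspaces of a common type
  \<open>'v\<close>, together with the set of its smooth sections.
\<close>

record ('m, 'v) vbundle =
  fibre :: "'m \<Rightarrow> 'v set"
  sections :: "('m \<Rightarrow> 'v) set"

definition fmult :: "('m \<Rightarrow> real) \<Rightarrow> ('m \<Rightarrow> 'v::real_vector) \<Rightarrow> 'm \<Rightarrow> 'v"  (infixr \<open>\<odot>\<close> 75) where
  "f \<odot> u = (\<lambda>p. f p *\<^sub>R u p)"

text \<open>
  \<open>l \<star> u\<close> applies a fibrewise map to a section. In particular \<open>\<mu> \<star> u\<close> is the pairing
  \<open>\<langle>\<mu>, u\<rangle>\<close> of a section of the dual bundle with a section.
\<close>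

definition app :: "('m \<Rightarrow> 'v \<Rightarrow> 'w) \<Rightarrow> ('m \<Rightarrow> 'v) \<Rightarrow> 'm \<Rightarrow> 'w"  (infixr \<open>\<star>\<close> 80) where
  "l \<star> u = (\<lambda>p. l p (u p))"

definition linear_on_space :: "'v::real_vector set \<Rightarrow> ('v \<Rightarrow> 'w::real_vector) \<Rightarrow> bool" where
  "linear_on_space V h \<longleftrightarrow>
     (\<forall>x\<in>V. \<forall>y\<in>V. h (x + y) = h x + h y) \<and> (\<forall>c. \<forall>x\<in>V. h (c *\<^sub>R x) = c *\<^sub>R h x)"

text \<open>
  Maps that are only meaningful on a subset (fibrewise maps on the fibres, tangent vectors on
  smooth functions, operators on smooth sections) are set to zero outside of it, so that equality
  of such maps is equality in HOL.
\<close>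

definition dual_space :: "'v::real_vector set \<Rightarrow> ('v \<Rightarrow> real) set" where
  "dual_space V = {\<mu>. linear_on_space V \<mu> \<and> (\<forall>x. x \<notin> V \<longrightarrow> \<mu> x = 0)}"

definition dual_bundle ::
  "('m, 'e::real_inner) atlas \<Rightarrow> ('m, 'v::real_vector, 'z) vbundle_scheme
     \<Rightarrow> ('m, 'v \<Rightarrow> real) vbundle" where
  "dual_bundle \<A> E =
     \<lparr> fibre = (\<lambda>p. dual_space (fibre E p)),
       sections = {\<mu>. (\<forall>p. \<mu> p \<in> dual_space (fibre E p)) \<and> (\<forall>u\<in>sections E. \<mu> \<star> u \<in> C_inf \<A>)} \<rparr>"

text \<open>Smooth vector bundle maps over the identity.\<close>

definition bundle_maps ::
  "('m, 'v::real_vector, 'y) vbundle_scheme \<Rightarrow> ('m, 'w::real_vector, 'z) vbundle_scheme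
     \<Rightarrow> ('m \<Rightarrow> 'v \<Rightarrow> 'w) set" where
  "bundle_maps E F =
     {l. (\<forall>p. (\<forall>x\<in>fibre E p. l p x \<in> fibre F p) \<and> linear_on_space (fibre E p) (l p) \<and>
              (\<forall>x. x \<notin> fibre E p \<longrightarrow> l p x = 0)) \<and>
         (\<forall>u\<in>sections E. l \<star> u \<in> sections F)}"

text \<open>The dual \<open>l\<^sup>*\<close> of an endomorphism \<open>l\<close> of \<open>E\<close>.\<close>

definition dual_map ::
  "('m, 'v::real_vector, 'z) vbundle_scheme \<Rightarrow> ('m \<Rightarrow> 'v \<Rightarrow> 'v) \<Rightarrow> 'm \<Rightarrow> ('v \<Rightarrow> real) \<Rightarrow> 'v \<Rightarrow> real" where
  "dual_map E l p \<mu> = (if \<mu> \<in> dual_space (fibre E p) then \<mu> \<circ> l p else 0)"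


section \<open>Tangent and cotangent bundle\<close>

text \<open>Tangent vectors at \<open>p\<close> are the derivations of \<open>C\<^sup>\<infinity>(M)\<close> at \<open>p\<close>.\<close>

type_synonym 'm tvec = "('m \<Rightarrow> real) \<Rightarrow> real"
type_synonym 'm covec = "'m tvec \<Rightarrow> real"

definition tangent_space :: "('m, 'e::real_inner) atlas \<Rightarrow> 'm \<Rightarrow> 'm tvec set" where
  "tangent_space \<A> p =
     {v. linear_on_space (C_inf \<A>) v \<and>
         (\<forall>f\<in>C_inf \<A>. \<forall>g\<in>C_inf \<A>. v (f * g) = f p * v g + g p * v f) \<and>
         (\<forall>f. f \<notin> C_inf \<A> \<longrightarrow> v f = 0)}"

text \<open>The function \<open>\<L>\<^sub>X f\<close>.\<close>

definition lie_fun :: "('m \<Rightarrow> 'm tvec) \<Rightarrow> ('m \<Rightarrow> real) \<Rightarrow> 'm \<Rightarrow> real" where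
  "lie_fun X f = (\<lambda>p. X p f)"

definition tangent_bundle :: "('m, 'e::real_inner) atlas \<Rightarrow> ('m, 'm tvec) vbundle" where
  "tangent_bundle \<A> =
     \<lparr> fibre = tangent_space \<A>,
       sections = {X. (\<forall>p. X p \<in> tangent_space \<A> p) \<and> (\<forall>f\<in>C_inf \<A>. lie_fun X f \<in> C_inf \<A>)} \<rparr>"

abbreviation vector_fields :: "('m, 'e::real_inner) atlas \<Rightarrow> ('m \<Rightarrow> 'm tvec) set" where
  "vector_fields \<A> \<equiv> sections (tangent_bundle \<A>)"

abbreviation cotangent_bundle :: "('m, 'e::real_inner) atlas \<Rightarrow> ('m, 'm covec) vbundle" where
  "cotangent_bundle \<A> \<equiv> dual_bundle \<A> (tangent_bundle \<A>)"

abbreviation one_forms :: "('m, 'e::real_inner) atlas \<Rightarrow> ('m \<Rightarrow> 'm covec) set" where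
  "one_forms \<A> \<equiv> sections (cotangent_bundle \<A>)"

definition vf_bracket :: "('m \<Rightarrow> 'm tvec) \<Rightarrow> ('m \<Rightarrow> 'm tvec) \<Rightarrow> 'm \<Rightarrow> 'm tvec" where
  "vf_bracket X Y = (\<lambda>p f. X p (lie_fun Y f) - Y p (lie_fun X f))"

definition differential :: "('m, 'e::real_inner) atlas \<Rightarrow> ('m \<Rightarrow> real) \<Rightarrow> 'm \<Rightarrow> 'm covec" where
  "differential \<A> f = (\<lambda>p v. if v \<in> tangent_space \<A> p then v f else 0)"

text \<open>The 1-form with prescribed values on vector fields.\<close>

definition one_form_of ::
  "('m, 'e::real_inner) atlas \<Rightarrow> (('m \<Rightarrow> 'm tvec) \<Rightarrow> 'm \<Rightarrow> real) \<Rightarrow> 'm \<Rightarrow> 'm covec" where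
  "one_form_of \<A> \<omega> = (THE \<gamma>. \<gamma> \<in> one_forms \<A> \<and> (\<forall>Y\<in>vector_fields \<A>. \<gamma> \<star> Y = \<omega> Y))"

definition lie_form ::
  "('m, 'e::real_inner) atlas \<Rightarrow> ('m \<Rightarrow> 'm tvec) \<Rightarrow> ('m \<Rightarrow> 'm covec) \<Rightarrow> 'm \<Rightarrow> 'm covec" where
  "lie_form \<A> X \<beta> = one_form_of \<A> (\<lambda>Y. lie_fun X (\<beta> \<star> Y) - \<beta> \<star> vf_bracket X Y)"

text \<open>\<open>d\<alpha>(X, Y)\<close> and \<open>i\<^sub>X d\<alpha>\<close>.\<close>

definition ext_deriv ::
  "('m \<Rightarrow> 'm covec) \<Rightarrow> ('m \<Rightarrow> 'm tvec) \<Rightarrow> ('m \<Rightarrow> 'm tvec) \<Rightarrow> 'm \<Rightarrow> real" where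
  "ext_deriv \<alpha> X Y = lie_fun X (\<alpha> \<star> Y) - lie_fun Y (\<alpha> \<star> X) - \<alpha> \<star> vf_bracket X Y"

definition contract_ext_deriv ::
  "('m, 'e::real_inner) atlas \<Rightarrow> ('m \<Rightarrow> 'm tvec) \<Rightarrow> ('m \<Rightarrow> 'm covec) \<Rightarrow> 'm \<Rightarrow> 'm covec" where
  "contract_ext_deriv \<A> X \<alpha> = one_form_of \<A> (\<lambda>Y. ext_deriv \<alpha> X Y)"


section \<open>Generalized derivations of degree 1\<close>

text \<open>
  An element of \<open>\<Omega>\<^sup>1(M, E)\<close> is a bundle map \<open>TM \<rightarrow> E\<close>. For \<open>\<D> = (D, l, r)\<close> and a vector field
  \<open>X\<close>, the section \<open>D\<^sub>X(u)\<close> is \<open>D u \<star> X\<close>.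
\<close>

type_synonym ('m, 'v) gder =
  "(('m \<Rightarrow> 'v) \<Rightarrow> 'm \<Rightarrow> 'm tvec \<Rightarrow> 'v) \<times> ('m \<Rightarrow> 'v \<Rightarrow> 'v) \<times> ('m \<Rightarrow> 'm tvec \<Rightarrow> 'm tvec)"

definition GDer1 ::
  "('m, 'e::real_inner) atlas \<Rightarrow> ('m, 'v::real_vector, 'z) vbundle_scheme \<Rightarrow> ('m, 'v) gder set" where
  "GDer1 \<A> E =
     {(D, l, r).
        l \<in> bundle_maps E E \<and>
        r \<in> bundle_maps (tangent_bundle \<A>) (tangent_bundle \<A>) \<and>
        (\<forall>u\<in>sections E. D u \<in> bundle_maps (tangent_bundle \<A>) E) \<and>
        linear_on_space (sections E) D \<and>
        (\<forall>u. u \<notin> sections E \<longrightarrow> D u = 0) \<and>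
        (\<forall>u\<in>sections E. \<forall>f\<in>C_inf \<A>. \<forall>X\<in>vector_fields \<A>.
           D (f \<odot> u) \<star> X = f \<odot> (D u \<star> X) + lie_fun X f \<odot> (l \<star> u) - lie_fun (r \<star> X) f \<odot> u)}"

text \<open>The dual \<open>\<D>\<^sup>\<top> = (D\<^sup>\<top>, l\<^sup>*, r)\<close>.\<close>

definition gder_dual ::
  "('m, 'e::real_inner) atlas \<Rightarrow> ('m, 'v::real_vector, 'z) vbundle_scheme
     \<Rightarrow> ('m, 'v) gder \<Rightarrow> ('m, 'v \<Rightarrow> real) gder" where
  "gder_dual \<A> E = (\<lambda>(D, l, r).
     ((\<lambda>\<mu>. if \<mu> \<in> sections (dual_bundle \<A> E)
           then (THE \<eta>. \<eta> \<in> bundle_maps (tangent_bundle \<A>) (dual_bundle \<A> E) \<and>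
                   (\<forall>X\<in>vector_fields \<A>. \<forall>u\<in>sections E.
                      (\<eta> \<star> X) \<star> u =
                        lie_fun X (\<mu> \<star> (l \<star> u)) - lie_fun (r \<star> X) (\<mu> \<star> u) - \<mu> \<star> (D u \<star> X)))
           else 0),
      dual_map E l,
      r))"

definition nijenhuis_torsion_zero ::
  "('m, 'e::real_inner) atlas \<Rightarrow> ('m \<Rightarrow> 'm tvec \<Rightarrow> 'm tvec) \<Rightarrow> bool" where
  "nijenhuis_torsion_zero \<A> r \<longleftrightarrow>
     (\<forall>X\<in>vector_fields \<A>. \<forall>Y\<in>vector_fields \<A>.
        vf_bracket (r \<star> X) (r \<star> Y)
          - r \<star> (vf_bracket (r \<star> X) Y + vf_bracket X (r \<star> Y) - r \<star> vf_bracket X Y) = 0)"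

text \<open>The condition \<open>[\<D>, \<D>] = 0\<close>.\<close>

definition gder_square_zero ::
  "('m, 'e::real_inner) atlas \<Rightarrow> ('m, 'v::real_vector, 'z) vbundle_scheme \<Rightarrow> ('m, 'v) gder \<Rightarrow> bool" where
  "gder_square_zero \<A> E = (\<lambda>(D, l, r).
     nijenhuis_torsion_zero \<A> r \<and>
     (\<forall>X\<in>vector_fields \<A>. \<forall>u\<in>sections E. D (l \<star> u) \<star> X = l \<star> (D u \<star> X)) \<and>
     (\<forall>X\<in>vector_fields \<A>. \<forall>Y\<in>vector_fields \<A>. \<forall>u\<in>sections E.
        D (D u \<star> Y) \<star> X - D (D u \<star> X) \<star> Y
          - D u \<star> (vf_bracket (r \<star> Y) X + vf_bracket Y (r \<star> X) - r \<star> vf_bracket Y X)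
          + l \<star> (D u \<star> vf_bracket Y X) = 0))"

text \<open>The generalized derivation \<open>\<D>\<^bsup>r,T\<^esup> = (D\<^bsup>r,T\<^esup>, r, r)\<close> of \<open>TM\<close>.\<close>

definition gder_T ::
  "('m, 'e::real_inner) atlas \<Rightarrow> ('m \<Rightarrow> 'm tvec \<Rightarrow> 'm tvec) \<Rightarrow> ('m, 'm tvec) gder" where
  "gder_T \<A> r =
     ((\<lambda>Y. if Y \<in> vector_fields \<A>
           then (THE \<eta>. \<eta> \<in> bundle_maps (tangent_bundle \<A>) (tangent_bundle \<A>) \<and>
                   (\<forall>X\<in>vector_fields \<A>. \<eta> \<star> X = vf_bracket Y (r \<star> X) - r \<star> vf_bracket Y X))
           else 0),
      r, r)"


section \<open>IM (1,1)-tensors and Lie-Nijenhuis bialgebroids\<close>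

text \<open>The data of a Lie algebroid: a vector bundle with a bracket on its sections and an anchor.\<close>

record ('m, 'v) algebroid = "('m, 'v) vbundle" +
  bracket :: "('m \<Rightarrow> 'v) \<Rightarrow> ('m \<Rightarrow> 'v) \<Rightarrow> 'm \<Rightarrow> 'v"
  anchor :: "'m \<Rightarrow> 'v \<Rightarrow> 'm tvec"

definition IM_tensor ::
  "('m, 'e::real_inner) atlas \<Rightarrow> ('m, 'v::real_vector) algebroid \<Rightarrow> ('m, 'v) gder \<Rightarrow> bool" where
  "IM_tensor \<A> A = (\<lambda>(D, l, r).
     (D, l, r) \<in> GDer1 \<A> A \<and>
     (\<forall>a\<in>sections A. \<forall>b\<in>sections A. \<forall>X\<in>vector_fields \<A>.
        D (bracket A a b) \<star> X =
          bracket A a (D b \<star> X) - bracket A b (D a \<star> X)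
          + D a \<star> vf_bracket (anchor A \<star> b) X - D b \<star> vf_bracket (anchor A \<star> a) X) \<and>
     (\<forall>a\<in>sections A. \<forall>b\<in>sections A.
        l \<star> bracket A a b = bracket A a (l \<star> b) - D a \<star> (anchor A \<star> b)) \<and>
     (\<forall>a\<in>sections A. \<forall>X\<in>vector_fields \<A>.
        r \<star> vf_bracket (anchor A \<star> a) X =
          vf_bracket (anchor A \<star> a) (r \<star> X) - anchor A \<star> (D a \<star> X)) \<and>
     (\<forall>p. \<forall>x\<in>fibre A p. r p (anchor A p x) = anchor A p (l p x)))"

text \<open>
  To be applied to a Lie bialgebroid \<open>(A, B)\<close>, where the bundle of \<open>B\<close> is the dual of that of \<open>A\<close>.
\<close>

definition lie_nijenhuis_bialgebroid ::
  "('m, 'e::real_inner) atlas \<Rightarrow> ('m, 'v::real_vector) algebroid \<Rightarrow> ('m, 'v \<Rightarrow> real) algebroid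
     \<Rightarrow> ('m, 'v) gder \<Rightarrow> bool" where
  "lie_nijenhuis_bialgebroid \<A> A B \<D> \<longleftrightarrow>
     \<D> \<in> GDer1 \<A> A \<and> IM_tensor \<A> A \<D> \<and> IM_tensor \<A> B (gder_dual \<A> A \<D>) \<and>
     gder_square_zero \<A> A \<D>"

definition tangent_algebroid :: "('m, 'e::real_inner) atlas \<Rightarrow> ('m, 'm tvec) algebroid" where
  "tangent_algebroid \<A> =
     \<lparr> fibre = fibre (tangent_bundle \<A>), sections = sections (tangent_bundle \<A>),
       bracket = vf_bracket,
       anchor = (\<lambda>p v. v) \<rparr>"


section \<open>Poisson and Poisson-Nijenhuis structures\<close>

type_synonym 'm bivector = "'m \<Rightarrow> 'm covec \<Rightarrow> 'm covec \<Rightarrow> real"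

definition bivector_fields :: "('m, 'e::real_inner) atlas \<Rightarrow> 'm bivector set" where
  "bivector_fields \<A> =
     {\<pi>. (\<forall>p. \<forall>\<alpha>\<in>fibre (cotangent_bundle \<A>) p.
              linear_on_space (fibre (cotangent_bundle \<A>) p) (\<pi> p \<alpha>) \<and>
              (\<forall>\<beta>\<in>fibre (cotangent_bundle \<A>) p. \<pi> p \<alpha> \<beta> = - \<pi> p \<beta> \<alpha>)) \<and>
         (\<forall>\<alpha>\<in>one_forms \<A>. \<forall>\<beta>\<in>one_forms \<A>. (\<lambda>p. \<pi> p (\<alpha> p) (\<beta> p)) \<in> C_inf \<A>)}"

definition poisson_bracket ::
  "('m, 'e::real_inner) atlas \<Rightarrow> 'm bivector \<Rightarrow> ('m \<Rightarrow> real) \<Rightarrow> ('m \<Rightarrow> real) \<Rightarrow> 'm \<Rightarrow> real" where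
  "poisson_bracket \<A> \<pi> f g = (\<lambda>p. \<pi> p (differential \<A> f p) (differential \<A> g p))"

definition poisson_structure :: "('m, 'e::real_inner) atlas \<Rightarrow> 'm bivector \<Rightarrow> bool" where
  "poisson_structure \<A> \<pi> \<longleftrightarrow>
     \<pi> \<in> bivector_fields \<A> \<and>
     (\<forall>f\<in>C_inf \<A>. \<forall>g\<in>C_inf \<A>. \<forall>h\<in>C_inf \<A>.
        poisson_bracket \<A> \<pi> f (poisson_bracket \<A> \<pi> g h) +
        poisson_bracket \<A> \<pi> g (poisson_bracket \<A> \<pi> h f) +
        poisson_bracket \<A> \<pi> h (poisson_bracket \<A> \<pi> f g) = 0)"

text \<open>
  \<open>\<pi>\<^sup>\<sharp>(\<alpha>) = \<pi>(\<alpha>, \<cdot>)\<close>, a linear form on the cotangent space, is regarded as the tangent vector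
  whose value on a function \<open>f\<close> is \<open>\<pi>(\<alpha>, df)\<close>.
\<close>

definition sharp :: "('m, 'e::real_inner) atlas \<Rightarrow> 'm bivector \<Rightarrow> 'm \<Rightarrow> 'm covec \<Rightarrow> 'm tvec" where
  "sharp \<A> \<pi> p \<alpha> =
     (if \<alpha> \<in> fibre (cotangent_bundle \<A>) p then (\<lambda>f. \<pi> p \<alpha> (differential \<A> f p)) else 0)"

text \<open>The bracket \<open>[\<alpha>, \<beta>]\<^sub>B\<close>, as a function of \<open>B\<^sup>\<sharp>\<close>.\<close>

definition form_bracket ::
  "('m, 'e::real_inner) atlas \<Rightarrow> ('m \<Rightarrow> 'm covec \<Rightarrow> 'm tvec)
     \<Rightarrow> ('m \<Rightarrow> 'm covec) \<Rightarrow> ('m \<Rightarrow> 'm covec) \<Rightarrow> 'm \<Rightarrow> 'm covec" where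
  "form_bracket \<A> B \<alpha> \<beta> = lie_form \<A> (B \<star> \<alpha>) \<beta> - contract_ext_deriv \<A> (B \<star> \<beta>) \<alpha>"

definition cotangent_algebroid ::
  "('m, 'e::real_inner) atlas \<Rightarrow> 'm bivector \<Rightarrow> ('m, 'm covec) algebroid" where
  "cotangent_algebroid \<A> \<pi> =
     \<lparr> fibre = fibre (cotangent_bundle \<A>), sections = sections (cotangent_bundle \<A>),
       bracket = form_bracket \<A> (sharp \<A> \<pi>),
       anchor = sharp \<A> \<pi> \<rparr>"

definition poisson_compatible ::
  "('m, 'e::real_inner) atlas \<Rightarrow> 'm bivector \<Rightarrow> ('m \<Rightarrow> 'm tvec \<Rightarrow> 'm tvec) \<Rightarrow> bool" where
  "poisson_compatible \<A> \<pi> r \<longleftrightarrow>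
     (let rd = dual_map (tangent_bundle \<A>) r in
        (\<forall>p. \<forall>\<alpha>\<in>fibre (cotangent_bundle \<A>) p. r p (sharp \<A> \<pi> p \<alpha>) = sharp \<A> \<pi> p (rd p \<alpha>)) \<and>
        (\<forall>\<alpha>\<in>one_forms \<A>. \<forall>\<beta>\<in>one_forms \<A>.
           form_bracket \<A> (\<lambda>p. r p \<circ> sharp \<A> \<pi> p) \<alpha> \<beta> =
             form_bracket \<A> (sharp \<A> \<pi>) (rd \<star> \<alpha>) \<beta> + form_bracket \<A> (sharp \<A> \<pi>) \<alpha> (rd \<star> \<beta>)
             - rd \<star> form_bracket \<A> (sharp \<A> \<pi>) \<alpha> \<beta>))"

definition poisson_nijenhuis ::
  "('m, 'e::real_inner) atlas \<Rightarrow> 'm bivector \<Rightarrow> ('m \<Rightarrow> 'm tvec \<Rightarrow> 'm tvec) \<Rightarrow> bool" where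
  "poisson_nijenhuis \<A> \<pi> r \<longleftrightarrow>
     poisson_structure \<A> \<pi> \<and> r \<in> bundle_maps (tangent_bundle \<A>) (tangent_bundle \<A>) \<and>
     poisson_compatible \<A> \<pi> r \<and> nijenhuis_torsion_zero \<A> r"

end

theory Submission
  imports Defs "HOL-Real_Asymp.Real_Asymp"
begin

text \<open>
  On the tangent algebroid the anchor is the identity. Condition
  (IM4) therefore forces \<open>l = r\<close>, and (IM3) reads \<open>D\<^sub>X(u) = [u, r(X)] - r([u, X])\<close>, that is,
  \<open>\<D> = \<D>\<^bsup>r,T\<^esup>\<close>. So everything reduces to this canonical generalized derivation. It always satisfies
  the IM conditions on \<open>TM\<close>, by the Jacobi identity, and \<open>[\<D>, \<D>] = 0\<close> says for it precisely that \<open>r\<close>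
  has no Nijenhuis torsion, since the other two components of \<open>[\<D>, \<D>]\<close> are combinations of values of
  the torsion (\<open>square_zero\<close>).

  It remains to identify the IM conditions for \<open>\<D>\<^sup>\<top>\<close> on the cotangent algebroid with the
  compatibility of \<open>\<pi>\<close> and \<open>r\<close> (\<open>compatible_iff_IM_dual\<close>). (IM4) is \<open>r \<circ> \<pi>\<^sup>\<sharp> = \<pi>\<^sup>\<sharp> \<circ> r\<^sup>*\<close>. Given this,
  \<open>[\<alpha>, \<beta>]\<^bsub>\<pi>\<^sub>r\<^esub> - [r\<^sup>*\<alpha>, \<beta>]\<^sub>\<pi>\<close> is \<open>D\<^sup>\<top>\<close> of \<open>\<alpha>\<close> along \<open>\<pi>\<^sup>\<sharp>(\<beta>)\<close> (\<open>form_bracket_difference\<close>), so that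
  (IM2) is the bracket condition of compatibility. The last two conditions follow:
  pairing (IM3) with \<open>\<beta>\<close> gives the same expression as evaluating (IM2) on \<open>X\<close> (\<open>IM3_dual\<close>). By (IM2) and
  (IM3) the defect of (IM1) is bilinear over the smooth functions (\<open>IM1_defect_fmult\<close>), so it is
  enough to test it on exact forms. There \<open>D\<^sup>\<top>\<^sub>X(df) = i\<^sub>X d(r\<^sup>*df)\<close>, and (IM1) is the exterior derivative of
  (IM2), because Lie derivatives commute with \<open>d\<close> (\<open>IM1_defect_exact\<close>).

  Lie derivatives of forms, the contraction of \<open>d\<alpha>\<close>, \<open>D\<^sup>\<top>\<close> and \<open>\<D>\<^bsup>r,T\<^esup>\<close> are given by
  formulas on global vector fields. That these formulas come from bundle maps, that identities
  between bundle maps can be tested on sections, and that a tensor on one-forms can be tested on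
  exact ones, all rest on one fact (\<open>local_frame\<close>): around every point there are global functions
  \<open>x\<^sub>i\<close> and vector fields \<open>E\<^sub>i\<close>, and a function \<open>\<kappa>\<close> equal to 1 at that point, with
  \<open>\<kappa> v = \<Sum>\<^sub>i v(x\<^sub>i) E\<^sub>i\<close> for all tangent vectors \<open>v\<close>. As tangent vectors are derivations, this needs
  Hadamard's lemma to see that they are directional derivatives in a chart, and bump functions to
  pass between a chart and the manifold.
\<close>

section \<open>Calculus of smooth functions on open sets\<close>

lemma Ck_on_cong:
  assumes "open S" "\<And>x. x \<in> S \<Longrightarrow> f x = g x" "Ck_on n S f"
  shows "Ck_on n S g"
  using assms(2,3)
proof (induction n arbitrary: f g)
  case 0
  then show ?case by (auto cong: continuous_on_cong)
next
  case (Suc n)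
  have der: "(g has_derivative frechet_derivative f (at x)) (at x)" if "x \<in> S" for x
  proof -
    have "(f has_derivative frechet_derivative f (at x)) (at x)"
      using Suc.prems(2) that by (simp add: frechet_derivative_works[symmetric])
    then show ?thesis
      using has_derivative_transform_within_open[OF _ assms(1) that] Suc.prems(1) by blast
  qed
  have "frechet_derivative f (at x) = frechet_derivative g (at x)" if "x \<in> S" for x
    using der[OF that] by (rule frechet_derivative_at)
  then have "Ck_on n S (\<lambda>x. frechet_derivative g (at x) v)" for v
    using Suc.IH[of "\<lambda>x. frechet_derivative f (at x) v" "\<lambda>x. frechet_derivative g (at x) v"]
      Suc.prems(2) by simp
  then show ?case using der by (auto simp: differentiable_def)
qed

lemma Ck_on_subset: "Ck_on n S f \<Longrightarrow> T \<subseteq> S \<Longrightarrow> Ck_on n T f"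
  by (induction n arbitrary: f) (auto intro: continuous_on_subset)

lemma Ck_on_local:
  assumes "\<And>x. x \<in> S \<Longrightarrow> \<exists>T. open T \<and> x \<in> T \<and> Ck_on n T f"
  shows "Ck_on n S f"
  using assms
proof (induction n arbitrary: f)
  case 0
  then have "continuous (at x) f" if "x \<in> S" for x
    using that by (fastforce simp: continuous_on_eq_continuous_at)
  then show ?case by (simp add: continuous_at_imp_continuous_on)
next
  case (Suc n)
  have "f differentiable (at x)" if "x \<in> S" for x
    using Suc.prems[OF that] by auto
  moreover have "Ck_on n S (\<lambda>x. frechet_derivative f (at x) v)" for v
  proof (rule Suc.IH)
    fix x assume "x \<in> S"
    from Suc.prems[OF this]
    show "\<exists>T. open T \<and> x \<in> T \<and> Ck_on n T (\<lambda>x. frechet_derivative f (at x) v)" by auto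
  qed
  ultimately show ?case by simp
qed

text \<open>
  Being of class \<open>C\<^sup>n\<close> is defined through \<^const>\<open>frechet_derivative\<close>, a choice. On an open set the
  derivative is unique, so any derivative that one has computed can be used instead.
\<close>

lemma Ck_on_SucI:
  assumes "open S" "\<And>x. x \<in> S \<Longrightarrow> (f has_derivative f' x) (at x)"
    and "\<And>v. Ck_on n S (\<lambda>x. f' x v)"
  shows "Ck_on (Suc n) S f"
proof -
  have "f' x = frechet_derivative f (at x)" if "x \<in> S" for x
    using assms(2)[OF that] by (rule frechet_derivative_at)
  then have "Ck_on n S (\<lambda>x. frechet_derivative f (at x) v)" for v
    using Ck_on_cong[OF assms(1) _ assms(3)[of v]] by simp
  then show ?thesis using assms(2) by (auto simp: differentiable_def)
qed

lemma Ck_on_Suc_has_derivative: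
  "Ck_on (Suc n) S f \<Longrightarrow> x \<in> S \<Longrightarrow> (f has_derivative frechet_derivative f (at x)) (at x)"
  by (simp add: frechet_derivative_works[symmetric])

lemma Ck_on_Suc_imp: "Ck_on (Suc n) S f \<Longrightarrow> Ck_on n S f"
proof (induction n arbitrary: f)
  case 0
  then show ?case
    by (auto intro!: continuous_at_imp_continuous_on differentiable_imp_continuous_within)
next
  case (Suc n)
  then show ?case by auto
qed

lemma Ck_on_const: "Ck_on n S (\<lambda>x. c)"
  by (induction n arbitrary: c) (auto intro: continuous_intros)

lemma Ck_on_linear:
  assumes "bounded_linear h" "open S"
  shows "Ck_on n S h"
proof (cases n)
  case 0
  then show ?thesis
    using assms(1) by (simp add: linear_continuous_on)
next
  case (Suc m)
  have "Ck_on (Suc m) S h"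
    by (rule Ck_on_SucI[OF assms(2), where f' = "\<lambda>x. h"])
      (use assms(1) in \<open>auto intro: bounded_linear_imp_has_derivative Ck_on_const\<close>)
  then show ?thesis using Suc by simp
qed

lemma Ck_on_bounded_linear:
  assumes "bounded_linear h" "open S"
  shows "Ck_on n S f \<Longrightarrow> Ck_on n S (\<lambda>x. h (f x))"
proof (induction n arbitrary: f)
  case 0
  then show ?case by (simp add: bounded_linear.continuous_on[OF assms(1)])
next
  case (Suc n)
  show ?case
    by (rule Ck_on_SucI[OF assms(2) bounded_linear.has_derivative[OF assms(1)
            Ck_on_Suc_has_derivative[OF Suc.prems]]])
      (use Suc in auto)
qed

lemma Ck_on_add:
  assumes "open S"
  shows "Ck_on n S f \<Longrightarrow> Ck_on n S g \<Longrightarrow> Ck_on n S (\<lambda>x. f x + g x)"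
proof (induction n arbitrary: f g)
  case 0
  then show ?case by (auto intro: continuous_intros)
next
  case (Suc n)
  show ?case
    by (rule Ck_on_SucI[OF assms has_derivative_add[OF
            Ck_on_Suc_has_derivative[OF Suc.prems(1)] Ck_on_Suc_has_derivative[OF Suc.prems(2)]]])
      (use Suc in auto)
qed

lemma Ck_on_mult:
  fixes f g :: "'a::real_normed_vector \<Rightarrow> real"
  assumes "open S"
  shows "Ck_on n S f \<Longrightarrow> Ck_on n S g \<Longrightarrow> Ck_on n S (\<lambda>x. f x * g x)"
proof (induction n arbitrary: f g)
  case 0
  then show ?case by (auto intro: continuous_intros)
next
  case (Suc n)
  have "Ck_on n S f" "Ck_on n S g"
    using Suc.prems by (auto intro: Ck_on_Suc_imp simp del: Ck_on.simps)
  show ?case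
    by (rule Ck_on_SucI[OF assms has_derivative_mult[OF
            Ck_on_Suc_has_derivative[OF Suc.prems(1)] Ck_on_Suc_has_derivative[OF Suc.prems(2)]]])
      (use Suc \<open>Ck_on n S f\<close> \<open>Ck_on n S g\<close> in \<open>auto intro!: Ck_on_add assms\<close>)
qed

lemma Ck_on_sum:
  assumes "open S" "\<And>i. i \<in> I \<Longrightarrow> Ck_on n S (f i)"
  shows "Ck_on n S (\<lambda>x. \<Sum>i\<in>I. f i x)"
  using assms(2)
  by (induction I rule: infinite_finite_induct) (auto intro: Ck_on_const Ck_on_add assms(1))

text \<open>
  The expansion in an orthonormal basis is all that is used of a basis of the model space. It
  holds for a suitable finite \<open>B\<close> as soon as the space is spanned by a finite set, including in
  dimension 0.
\<close>

definition parseval :: "'e::real_inner set \<Rightarrow> bool" where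
  "parseval B \<longleftrightarrow> finite B \<and> (\<forall>x. (\<Sum>b\<in>B. (x \<bullet> b) *\<^sub>R b) = x)"

lemma parseval_exists:
  fixes B :: "'e::real_inner set"
  assumes "finite B" "span B = UNIV"
  obtains C :: "'e set" where "parseval C"
proof -
  obtain C where C: "finite C" "span C = (UNIV :: 'e set)" "pairwise orthogonal C"
    using basis_orthogonal[OF assms(1)] assms(2) by auto
  define N where "N = (\<lambda>x::'e. x /\<^sub>R norm x) ` (C - {0})"
  have "span N = span (C - {0})"
    unfolding N_def by (rule span_image_scale) (use C in auto)
  then have sp: "span N = UNIV" using C(2) by simp
  have fin: "finite N" unfolding N_def using C(1) by simp
  have norm1: "x \<bullet> x = 1" if "x \<in> N" for x
  proof -
    from that obtain c where "x = c /\<^sub>R norm c" "c \<noteq> 0" unfolding N_def by blast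
    then have "norm x = 1" by simp
    then show ?thesis by (simp add: dot_square_norm)
  qed
  have orth: "x \<bullet> y = 0" if "x \<in> N" "y \<in> N" "x \<noteq> y" for x y
  proof -
    from that obtain c d where "x = c /\<^sub>R norm c" "y = d /\<^sub>R norm d" "c \<in> C" "d \<in> C"
      unfolding N_def by blast
    moreover from this have "c \<bullet> d = 0"
      using C(3) that(3) unfolding pairwise_def orthogonal_def by metis
    ultimately show ?thesis by simp
  qed
  have "(\<Sum>b\<in>N. (x \<bullet> b) *\<^sub>R b) = x" for x
  proof -
    have "x \<in> span N" using sp by simp
    then show ?thesis
    proof (induction rule: span_induct)
      case base
      show ?case
        by (auto simp: subspace_def inner_add_left scaleR_add_left sum.distrib
            scaleR_scaleR[symmetric] scaleR_sum_right[symmetric] simp del: scaleR_scaleR)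
    next
      case (step x)
      have "(\<Sum>b\<in>N. (x \<bullet> b) *\<^sub>R b) = (\<Sum>b\<in>N. if b = x then x else 0)"
        by (rule sum.cong) (use step orth norm1 in auto)
      then show ?case using step fin by simp
    qed
  qed
  then show thesis using that fin unfolding parseval_def by blast
qed

lemma linear_parseval:
  assumes "parseval B" "linear h"
  shows "h v = (\<Sum>b\<in>B. (v \<bullet> b) *\<^sub>R h b)"
proof -
  have "h v = h (\<Sum>b\<in>B. (v \<bullet> b) *\<^sub>R b)" using assms(1) by (simp add: parseval_def)
  also have "\<dots> = (\<Sum>b\<in>B. (v \<bullet> b) *\<^sub>R h b)"
    using assms(2) by (simp add: linear_sum linear_scale)
  finally show ?thesis .
qed

text \<open>
  The chain rule writes the derivative of \<open>f \<circ> g\<close> as a finite sum of products of a component of the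
  derivative of \<open>g\<close> with a partial derivative of \<open>f\<close> at \<open>g x\<close>. The latter is again a composition
  with \<open>g\<close>, to which the induction hypothesis applies.
\<close>

lemma Ck_on_compose:
  fixes f :: "'e::real_inner \<Rightarrow> real" and B :: "'e set"
  assumes "parseval B" "open S" "open T" "g ` S \<subseteq> T"
  shows "Ck_on n T f \<Longrightarrow> Ck_on n S g \<Longrightarrow> Ck_on n S (\<lambda>x. f (g x))"
proof (induction n arbitrary: f)
  case 0
  then show ?case using assms(4) by (auto intro: continuous_on_compose2)
next
  case (Suc n)
  have f': "(f has_derivative frechet_derivative f (at (g x))) (at (g x))" if "x \<in> S" for x
    using Ck_on_Suc_has_derivative[OF Suc.prems(1)] assms(4) that by blast
  have g': "(g has_derivative frechet_derivative g (at x)) (at x)" if "x \<in> S" for x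
    using Ck_on_Suc_has_derivative[OF Suc.prems(2) that] .
  have der: "((\<lambda>x. f (g x)) has_derivative (\<lambda>v. \<Sum>b\<in>B. (frechet_derivative g (at x) v \<bullet> b) *
      frechet_derivative f (at (g x)) b)) (at x)" (is "(_ has_derivative ?d) _") if "x \<in> S" for x
  proof -
    have "?d = (\<lambda>v. frechet_derivative f (at (g x)) (frechet_derivative g (at x) v))"
    proof
      fix v
      show "?d v = frechet_derivative f (at (g x)) (frechet_derivative g (at x) v)"
        unfolding linear_parseval[OF assms(1) has_derivative_linear[OF f'[OF that]],
            of "frechet_derivative g (at x) v"] real_scaleR_def ..
    qed
    then show ?thesis
      using diff_chain_at[OF g'[OF that] f'[OF that]] by (simp add: o_def)
  qed
  have "Ck_on n S g" using Suc.prems(2) by (rule Ck_on_Suc_imp)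
  show ?case
    by (rule Ck_on_SucI[OF assms(2) der])
      (use Suc \<open>Ck_on n S g\<close> in
        \<open>auto intro!: Ck_on_sum Ck_on_mult assms(2) Ck_on_bounded_linear[OF bounded_linear_inner_left]\<close>)
qed

lemma smooth_on_cong: "open S \<Longrightarrow> (\<And>x. x \<in> S \<Longrightarrow> f x = g x) \<Longrightarrow> smooth_on S f \<Longrightarrow> smooth_on S g"
  unfolding smooth_on_def using Ck_on_cong by blast

lemma smooth_on_subset: "smooth_on S f \<Longrightarrow> T \<subseteq> S \<Longrightarrow> smooth_on T f"
  unfolding smooth_on_def using Ck_on_subset by blast

lemma smooth_on_local:
  "(\<And>x. x \<in> S \<Longrightarrow> \<exists>T. open T \<and> x \<in> T \<and> smooth_on T f) \<Longrightarrow> smooth_on S f"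
  unfolding smooth_on_def by (intro allI Ck_on_local) blast

lemma smooth_on_const: "smooth_on S (\<lambda>x. c)"
  by (simp add: smooth_on_def Ck_on_const)

lemma smooth_on_linear: "bounded_linear h \<Longrightarrow> open S \<Longrightarrow> smooth_on S h"
  by (simp add: smooth_on_def Ck_on_linear)

lemma smooth_on_add: "open S \<Longrightarrow> smooth_on S f \<Longrightarrow> smooth_on S g \<Longrightarrow> smooth_on S (\<lambda>x. f x + g x)"
  by (simp add: smooth_on_def Ck_on_add)

lemma smooth_on_mult:
  fixes f g :: "'a::real_normed_vector \<Rightarrow> real"
  shows "open S \<Longrightarrow> smooth_on S f \<Longrightarrow> smooth_on S g \<Longrightarrow> smooth_on S (\<lambda>x. f x * g x)"
  by (simp add: smooth_on_def Ck_on_mult)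

lemma smooth_on_compose:
  fixes f :: "'e::real_inner \<Rightarrow> real" and B :: "'e set"
  assumes "parseval B" "open S" "open T" "g ` S \<subseteq> T" "smooth_on T f" "smooth_on S g"
  shows "smooth_on S (\<lambda>x. f (g x))"
  using assms(5,6) by (simp add: smooth_on_def Ck_on_compose[OF assms(1-4)])

lemma smooth_on_has_derivative:
  "smooth_on S f \<Longrightarrow> x \<in> S \<Longrightarrow> (f has_derivative frechet_derivative f (at x)) (at x)"
  unfolding smooth_on_def using Ck_on_Suc_has_derivative by blast

lemma smooth_on_frechet_derivative:
  "smooth_on S f \<Longrightarrow> smooth_on S (\<lambda>x. frechet_derivative f (at x) v)"
  unfolding smooth_on_def by (metis Ck_on.simps(2))

lemma smooth_on_continuous_on: "smooth_on S f \<Longrightarrow> continuous_on S f"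
  unfolding smooth_on_def by (metis Ck_on.simps(1))

section \<open>Bump functions\<close>

text \<open>
  The functions \<open>exp (-1/t) / t\<^sup>k\<close>, continued by 0 to \<open>t \<le> 0\<close>, are considered for all \<open>k\<close> at once because the
  derivative of one is a linear combination of others. This makes smoothness an immediate induction.
\<close>

definition exp_bump :: "nat \<Rightarrow> real \<Rightarrow> real" where
  "exp_bump k t = (if t \<le> 0 then 0 else exp (- 1 / t) / t ^ k)"

lemma exp_bump_deriv:
  "(exp_bump k has_real_derivative exp_bump (k + 2) t - k * exp_bump (k + 1) t) (at t)"
proof -
  consider "t < 0" | "t = 0" | "t > 0" by linarith
  then show ?thesis
  proof cases
    case 1
    have "(exp_bump k has_real_derivative 0) (at t)"
      by (rule has_field_derivative_transform_within_open[of "\<lambda>_. 0" _ _ "{..<0}"])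
        (use 1 in \<open>auto simp: exp_bump_def\<close>)
    then show ?thesis using 1 by (simp add: exp_bump_def)
  next
    case 2
    have "((\<lambda>t. exp_bump k t / t) \<longlongrightarrow> 0) (at_left 0)"
      by (rule tendsto_eventually) (auto simp: exp_bump_def eventually_at_filter)
    moreover have "((\<lambda>t. exp_bump k t / t) \<longlongrightarrow> 0) (at_right 0)"
    proof -
      have "((\<lambda>t::real. exp (- 1 / t) / t ^ k / t) \<longlongrightarrow> 0) (at_right 0)"
        by real_asymp
      then show ?thesis
        by (rule Lim_transform_eventually) (auto simp: exp_bump_def eventually_at_filter)
    qed
    ultimately have "((\<lambda>t. exp_bump k t / t) \<longlongrightarrow> 0) (at 0)"
      by (rule filterlim_split_at)
    then show ?thesis using 2 by (simp add: DERIV_def exp_bump_def)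
  next
    case 3
    have "((\<lambda>t. exp (- 1 / t)) has_real_derivative exp (- 1 / t) / t ^ 2) (at t)"
      using 3 by (auto intro!: derivative_eq_intros simp: power2_eq_square)
    moreover have "((\<lambda>t. inverse (t ^ k)) has_real_derivative - k / t ^ (k + 1)) (at t)"
    proof (cases k)
      case (Suc m)
      have "((\<lambda>t. inverse (t ^ Suc m)) has_real_derivative
          - (inverse (t ^ Suc m) * (real (Suc m) * t ^ m) * inverse (t ^ Suc m))) (at t)"
        using 3 DERIV_pow[of "Suc m" t]
        by (intro DERIV_inverse') (auto simp: algebra_simps)
      moreover have "- (inverse (t ^ Suc m) * (real (Suc m) * t ^ m) * inverse (t ^ Suc m)) =
          - real k / t ^ (k + 1)"
        using 3 Suc by (simp add: divide_simps)
      ultimately show ?thesis using Suc by simp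
    qed simp
    ultimately have "((\<lambda>t. exp (- 1 / t) * inverse (t ^ k)) has_real_derivative
        exp (- 1 / t) * (- k / t ^ (k + 1)) + exp (- 1 / t) / t ^ 2 * inverse (t ^ k)) (at t)"
      by (rule DERIV_mult')
    moreover have "exp (- 1 / t) * (- k / t ^ (k + 1)) + exp (- 1 / t) / t ^ 2 * inverse (t ^ k) =
        exp_bump (k + 2) t - k * exp_bump (k + 1) t"
      using 3 by (simp add: exp_bump_def divide_inverse power_add power2_eq_square)
    ultimately have "((\<lambda>t. exp (- 1 / t) / t ^ k) has_real_derivative
        exp_bump (k + 2) t - k * exp_bump (k + 1) t) (at t)"
      by (simp add: divide_inverse)
    then show ?thesis
      by (rule has_field_derivative_transform_within_open[of _ _ _ "{0<..}"])
        (use 3 in \<open>auto simp: exp_bump_def\<close>)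
  qed
qed

lemma smooth_exp_bump: "smooth_on UNIV (exp_bump k)"
proof -
  have "Ck_on n UNIV (exp_bump k)" for n
  proof (induction n arbitrary: k)
    case 0
    show ?case
      using exp_bump_deriv by (auto intro!: DERIV_continuous_on simp del: One_nat_def)
  next
    case (Suc n)
    show ?case
    proof (rule Ck_on_SucI)
      show "(exp_bump k has_derivative (\<lambda>v. (exp_bump (k + 2) t + (- k) * exp_bump (k + 1) t) * v)) (at t)" for t
        using exp_bump_deriv[of k t] by (simp add: has_field_derivative_def)
      show "Ck_on n UNIV (\<lambda>t. (exp_bump (k + 2) t + (- k) * exp_bump (k + 1) t) * v)" for v
        by (intro Ck_on_mult Ck_on_add Ck_on_const Suc.IH open_UNIV)
    qed simp
  qed
  then show ?thesis by (simp add: smooth_on_def)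
qed

lemma parseval_real: "parseval {1::real}"
  by (simp add: parseval_def)

text \<open>
  The argument of the numerator is positive exactly on the open ball of radius \<open>d\<close> about \<open>c\<close>, and the
  denominator normalizes the value at \<open>c\<close> to 1.
\<close>

definition bump :: "'e::real_inner \<Rightarrow> real \<Rightarrow> 'e \<Rightarrow> real" where
  "bump c d y = exp_bump 0 (d\<^sup>2 - (y - c) \<bullet> (y - c)) / exp_bump 0 (d\<^sup>2)"

lemma bump_center: "d > 0 \<Longrightarrow> bump c d c = 1"
  by (simp add: bump_def exp_bump_def)

lemma bump_eq_0: "d > 0 \<Longrightarrow> dist y c \<ge> d \<Longrightarrow> bump c d y = 0"
proof -
  assume "d > 0" "dist y c \<ge> d"
  then have "d\<^sup>2 \<le> (dist y c)\<^sup>2" by (intro power_mono) auto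
  then show ?thesis by (simp add: bump_def exp_bump_def dist_norm dot_square_norm)
qed

lemma smooth_bump:
  fixes c :: "'e::real_inner" and B :: "'e set"
  assumes "parseval B"
  shows "smooth_on UNIV (bump c d)"
proof -
  have quad: "(y - c) \<bullet> (y - c) = (\<Sum>b\<in>B. ((y - c) \<bullet> b) * ((y - c) \<bullet> b))" for y
    using linear_parseval[OF assms, of "\<lambda>v. (y - c) \<bullet> v" "y - c"]
    by (simp add: linear_iff inner_add_right)
  have lin: "Ck_on n UNIV (\<lambda>y. (y - c) \<bullet> b)" for n b
    using Ck_on_add[OF open_UNIV Ck_on_linear[OF bounded_linear_inner_left open_UNIV]
        Ck_on_const[of n UNIV "- (c \<bullet> b)"], of b]
    by (simp add: inner_diff_left)
  have "Ck_on n UNIV (\<lambda>y. d\<^sup>2 + (-1) * (\<Sum>b\<in>B. ((y - c) \<bullet> b) * ((y - c) \<bullet> b)))" for n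
    by (intro Ck_on_add Ck_on_const Ck_on_mult Ck_on_sum lin open_UNIV)
  then have "smooth_on UNIV (\<lambda>y. d\<^sup>2 - (y - c) \<bullet> (y - c))"
    by (simp add: quad smooth_on_def)
  then have "smooth_on UNIV (\<lambda>y. exp_bump 0 (d\<^sup>2 - (y - c) \<bullet> (y - c)))"
    by (rule smooth_on_compose[OF parseval_real open_UNIV open_UNIV subset_UNIV smooth_exp_bump])
  then have "smooth_on UNIV (\<lambda>y. exp_bump 0 (d\<^sup>2 - (y - c) \<bullet> (y - c)) * (1 / exp_bump 0 (d\<^sup>2)))"
    by (rule smooth_on_mult[OF open_UNIV]) (rule smooth_on_const)
  moreover have "bump c d = (\<lambda>y. exp_bump 0 (d\<^sup>2 - (y - c) \<bullet> (y - c)) * (1 / exp_bump 0 (d\<^sup>2)))"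
    by (simp add: bump_def fun_eq_iff)
  ultimately show ?thesis by simp
qed

text \<open>
  A closed ball is a closed subset of a linear image of a cube, and cubes are compact by induction
  on the number of basis vectors.
\<close>

lemma compact_cball_parseval:
  fixes c :: "'e::real_inner" and B :: "'e set"
  assumes "parseval B"
  shows "compact (cball c d)"
proof -
  have "compact {\<Sum>b\<in>F. u b *\<^sub>R b | u. \<forall>b\<in>F. \<bar>u b\<bar> \<le> R}" if "finite F" for F :: "'e set" and R :: real
    using that
  proof (induction F)
    case (insert a F)
    let ?K = "{\<Sum>b\<in>F. u b *\<^sub>R b | u. \<forall>b\<in>F. \<bar>u b\<bar> \<le> R}"
    have "compact ((\<lambda>(t, x). t *\<^sub>R a + x) ` ({-R..R} \<times> ?K))"
      by (intro compact_continuous_image compact_Times insert.IH compact_Icc)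
        (auto simp: split_beta intro!: continuous_intros)
    also have "(\<lambda>(t, x). t *\<^sub>R a + x) ` ({-R..R} \<times> ?K) =
        {\<Sum>b\<in>insert a F. u b *\<^sub>R b | u. \<forall>b\<in>insert a F. \<bar>u b\<bar> \<le> R}"
    proof (intro equalityI subsetI)
      fix y assume "y \<in> (\<lambda>(t, x). t *\<^sub>R a + x) ` ({-R..R} \<times> ?K)"
      then obtain t u where *: "t \<in> {-R..R}" "\<forall>b\<in>F. \<bar>u b\<bar> \<le> R"
        "y = t *\<^sub>R a + (\<Sum>b\<in>F. u b *\<^sub>R b)" by auto
      have "(\<Sum>b\<in>F. (u(a := t)) b *\<^sub>R b) = (\<Sum>b\<in>F. u b *\<^sub>R b)"
        by (rule sum.cong) (use insert in auto)
      then have "y = (\<Sum>b\<in>insert a F. (u(a := t)) b *\<^sub>R b)" using * insert by simp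
      moreover have "\<forall>b\<in>insert a F. \<bar>(u(a := t)) b\<bar> \<le> R" using * by auto
      ultimately show "y \<in> {\<Sum>b\<in>insert a F. u b *\<^sub>R b | u. \<forall>b\<in>insert a F. \<bar>u b\<bar> \<le> R}"
        by blast
    next
      fix y assume "y \<in> {\<Sum>b\<in>insert a F. u b *\<^sub>R b | u. \<forall>b\<in>insert a F. \<bar>u b\<bar> \<le> R}"
      then obtain u where "\<forall>b\<in>insert a F. \<bar>u b\<bar> \<le> R" "y = (\<Sum>b\<in>insert a F. u b *\<^sub>R b)" by blast
      then show "y \<in> (\<lambda>(t, x). t *\<^sub>R a + x) ` ({-R..R} \<times> ?K)"
        using insert by (auto simp: image_iff intro!: bexI[of _ "u a"])
    qed
    finally show ?case .
  qed simp
  \<comment> \<open>By the Cauchy-Schwarz inequality, this bounds the coordinates of the points of the ball.\<close>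
  moreover define R where "R = (norm c + d) * (\<Sum>b\<in>B. norm b)"
  ultimately have "compact {\<Sum>b\<in>B. u b *\<^sub>R b | u. \<forall>b\<in>B. \<bar>u b\<bar> \<le> R}" (is "compact ?K")
    using assms by (simp add: parseval_def)
  moreover have "cball c d \<subseteq> ?K"
  proof
    fix x assume x: "x \<in> cball c d"
    then have nx: "norm x \<le> norm c + d"
      using norm_triangle_sub[of x c] by (simp add: dist_norm norm_minus_commute)
    have "\<bar>x \<bullet> b\<bar> \<le> R" if "b \<in> B" for b
    proof -
      have "norm b \<le> (\<Sum>b\<in>B. norm b)"
        using assms that by (intro member_le_sum) (auto simp: parseval_def)
      have "\<bar>x \<bullet> b\<bar> \<le> norm x * norm b" by (rule Cauchy_Schwarz_ineq2)
      also have "\<dots> \<le> R" unfolding R_def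
        using nx \<open>norm b \<le> _\<close> by (intro mult_mono) (auto intro: order_trans[OF norm_ge_zero])
      finally show ?thesis .
    qed
    moreover have "x = (\<Sum>b\<in>B. (x \<bullet> b) *\<^sub>R b)" using assms by (simp add: parseval_def)
    ultimately show "x \<in> ?K" by blast
  qed
  ultimately show ?thesis
    using compact_Int_closed[of ?K "cball c d"] by (simp add: Int_absorb1)
qed

section \<open>Hadamard's lemma\<close>

text \<open>
  The factors of Hadamard's lemma are integrals of partial derivatives along rays from \<open>q\<close>. The
  weight \<open>t\<^sup>k\<close> is there because differentiating in \<open>y\<close> under the integral sign produces one more
  factor \<open>t\<close>.
\<close>

definition radial_mean :: "nat \<Rightarrow> ('e::real_normed_vector \<Rightarrow> real) \<Rightarrow> 'e \<Rightarrow> 'e \<Rightarrow> real" where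
  "radial_mean k F q y = integral {0..1} (\<lambda>t. t ^ k * F (q + t *\<^sub>R (y - q)))"

lemma ball_radial: "y \<in> ball q d \<Longrightarrow> t \<in> {0..1} \<Longrightarrow> q + t *\<^sub>R (y - q) \<in> ball q d"
  for q :: "'e::real_normed_vector"
proof -
  assume "y \<in> ball q d" "t \<in> {0..1}"
  moreover from this have "\<bar>t\<bar> * norm (y - q) \<le> 1 * norm (y - q)"
    by (intro mult_right_mono) auto
  ultimately show ?thesis by (simp add: dist_norm norm_minus_commute)
qed

lemma continuous_on_radial:
  fixes F :: "'e::real_normed_vector \<Rightarrow> real"
  assumes "continuous_on (ball q d) F"
  shows "continuous_on (ball q d \<times> {0..1::real}) (\<lambda>(y, t). t ^ k * F (q + t *\<^sub>R (y - q)))"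
  unfolding split_beta
  by (intro continuous_intros continuous_on_compose2[OF assms]) (auto simp del: mem_ball intro!: ball_radial)

lemma radial_mean_has_integral:
  fixes F :: "'e::real_normed_vector \<Rightarrow> real"
  assumes "continuous_on (ball q d) F" "y \<in> ball q d"
  shows "((\<lambda>t. t ^ k * F (q + t *\<^sub>R (y - q))) has_integral radial_mean k F q y) {0..1}"
proof -
  have "continuous_on {0..1} (\<lambda>t. t ^ k * F (q + t *\<^sub>R (y - q)))"
    by (intro continuous_intros continuous_on_compose2[OF assms(1)]) (use assms(2) in \<open>auto simp del: mem_ball intro!: ball_radial\<close>)
  then show ?thesis
    unfolding radial_mean_def by (intro integrable_integral integrable_continuous_interval)
qed

lemma continuous_on_radial_mean:
  fixes F :: "'e::real_normed_vector \<Rightarrow> real"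
  assumes "continuous_on (ball q d) F"
  shows "continuous_on (ball q d) (radial_mean k F q)"
  using integral_continuous_on_param[of "ball q d" 0 1 "\<lambda>y t. t ^ k * F (q + t *\<^sub>R (y - q))"]
    continuous_on_radial[OF assms]
  by (simp add: radial_mean_def[abs_def])

text \<open>
  Differentiation under the integral sign. Since \<open>{0..1}\<close> is compact, the derivative of \<open>F\<close> at
  the points \<open>q + t (z - q)\<close> is close to that at \<open>q + t (y - q)\<close>, uniformly in \<open>t\<close>, when \<open>z\<close> is
  close to \<open>y\<close>. By the mean value inequality, the linearization error of the integrand is then at most \<open>e \<bar>z - y\<bar>\<close> for
  all \<open>t\<close>, and this bound survives integration.
\<close>

lemma radial_mean_has_derivative:
  fixes F :: "'e::real_inner \<Rightarrow> real" and B :: "'e set"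
  assumes B: "parseval B"
    and F': "\<And>x. x \<in> ball q d \<Longrightarrow> (F has_derivative F' x) (at x)"
    and cont: "\<And>v. continuous_on (ball q d) (\<lambda>x. F' x v)"
    and y: "y \<in> ball q d"
  shows "(radial_mean k F q has_derivative (\<lambda>v. radial_mean (Suc k) (\<lambda>x. F' x v) q y)) (at y)"
proof -
  have contF: "continuous_on (ball q d) F"
    using F' by (auto intro!: continuous_at_imp_continuous_on has_derivative_continuous)
  have lin: "linear (F' x)" if "x \<in> ball q d" for x
    using F'[OF that] by (rule has_derivative_linear)
  have "radial_mean (Suc k) (\<lambda>x. F' x v) q y =
      (\<Sum>b\<in>B. (v \<bullet> b) * radial_mean (Suc k) (\<lambda>x. F' x b) q y)" for v
  proof -
    have "((\<lambda>t. \<Sum>b\<in>B. (v \<bullet> b) * (t ^ Suc k * F' (q + t *\<^sub>R (y - q)) b)) has_integral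
        (\<Sum>b\<in>B. (v \<bullet> b) * radial_mean (Suc k) (\<lambda>x. F' x b) q y)) {0..1}"
      using B by (intro has_integral_sum has_integral_mult_right radial_mean_has_integral[OF cont y])
        (simp add: parseval_def)
    moreover have "(\<Sum>b\<in>B. (v \<bullet> b) * (t ^ Suc k * F' (q + t *\<^sub>R (y - q)) b)) =
        t ^ Suc k * F' (q + t *\<^sub>R (y - q)) v" if "t \<in> {0..1}" for t
      unfolding linear_parseval[OF B lin[OF ball_radial[OF y that]], of v]
      by (simp add: sum_distrib_left algebra_simps)
    ultimately have "((\<lambda>t. t ^ Suc k * F' (q + t *\<^sub>R (y - q)) v) has_integral
        (\<Sum>b\<in>B. (v \<bullet> b) * radial_mean (Suc k) (\<lambda>x. F' x b) q y)) {0..1}"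
      by (rule has_integral_eq[rotated])
    then show ?thesis
      using has_integral_unique radial_mean_has_integral[OF cont y] by blast
  qed
  then have "(\<lambda>v. radial_mean (Suc k) (\<lambda>x. F' x v) q y) =
      (\<lambda>v. \<Sum>b\<in>B. (v \<bullet> b) * radial_mean (Suc k) (\<lambda>x. F' x b) q y)" by blast
  moreover have "bounded_linear \<dots>"
    by (intro bounded_linear_sum bounded_linear_mult_const bounded_linear_inner_left)
  ultimately have bl: "bounded_linear (\<lambda>v. radial_mean (Suc k) (\<lambda>x. F' x v) q y)" by metis
  \<comment> \<open>A bound for the operator norm of the difference of the derivatives at the two points, which is continuous.\<close>
  define psi where "psi = (\<lambda>(z, t). \<Sum>b\<in>B. norm b *
      \<bar>F' (q + t *\<^sub>R (z - q)) b - F' (q + t *\<^sub>R (y - q)) b\<bar>)"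
  have "continuous_on (ball q d \<times> {0..1::real}) psi"
    unfolding psi_def split_beta
    by (intro continuous_intros continuous_on_compose2[OF cont]) (use y in \<open>auto simp del: mem_ball intro!: ball_radial\<close>)
  then have "\<exists>s>0. ball y s \<subseteq> ball q d \<and> (\<forall>z\<in>ball y s. \<forall>t\<in>{0..1}. psi (z, t) \<le> e)" if "e > 0" for e
  proof -
    obtain X where X: "y \<in> X" "open X"
      "\<forall>z\<in>X \<inter> ball q d. \<forall>t\<in>{0..1}. dist (psi (z, t)) (psi (y, t)) \<le> e"
      using continuous_on_prod_compactE[OF \<open>continuous_on _ psi\<close> compact_Icc y \<open>e > 0\<close>] by metis
    have "psi (y, t) = 0" for t by (simp add: psi_def)
    then have "\<forall>z\<in>X \<inter> ball q d. \<forall>t\<in>{0..1}. psi (z, t) \<le> e"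
      using X(3) by (simp add: dist_real_def abs_le_iff)
    moreover obtain s where "s > 0" "ball y s \<subseteq> X \<inter> ball q d"
      using X y open_contains_ball[of "X \<inter> ball q d"] by blast
    ultimately show ?thesis by blast
  qed note small = this
  show ?thesis
    unfolding has_derivative_within_alt
  proof (intro conjI bl allI impI)
    fix e :: real assume "e > 0"
    then obtain s where s: "s > 0" "ball y s \<subseteq> ball q d"
      "\<forall>z\<in>ball y s. \<forall>t\<in>{0..1}. psi (z, t) \<le> e"
      using small by blast
    have "norm (radial_mean k F q z - radial_mean k F q y -
        radial_mean (Suc k) (\<lambda>x. F' x (z - y)) q y) \<le> e * norm (z - y)" if z: "norm (z - y) < s" for z
    proof -
      have zs: "z \<in> ball y s" using z by (simp add: dist_norm norm_minus_commute)
      then have zq: "z \<in> ball q d" using s by blast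
      let ?I = "\<lambda>t. t ^ k * F (q + t *\<^sub>R (z - q)) - t ^ k * F (q + t *\<^sub>R (y - q)) -
          t ^ Suc k * F' (q + t *\<^sub>R (y - q)) (z - y)"
      have int: "(?I has_integral (radial_mean k F q z - radial_mean k F q y -
          radial_mean (Suc k) (\<lambda>x. F' x (z - y)) q y)) {0..1}"
        by (intro has_integral_diff radial_mean_has_integral[OF contF] radial_mean_has_integral[OF cont] y zq)
      have "norm (?I t) \<le> e * norm (z - y)" if t: "t \<in> {0..1}" for t
      proof -
        let ?c = "\<lambda>w. q + t *\<^sub>R (w - q)"
        let ?T = "?c ` ball y s"
        have seg: "?c y + u *\<^sub>R (?c z - ?c y) \<in> ?T" if "u \<in> {0..1}" for u
        proof
          show "?c y + u *\<^sub>R (?c z - ?c y) = ?c (y + u *\<^sub>R (z - y))"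
            by (simp add: algebra_simps)
          show "y + u *\<^sub>R (z - y) \<in> ball y s" using ball_radial[OF zs that] .
        qed
        have F'T: "(F has_derivative F' x) (at x within ?T)" if "x \<in> ?T" for x
        proof -
          have "x \<in> ball q d" using that s(2) ball_radial[OF _ t] by blast
          then show ?thesis using F' has_derivative_at_withinI by blast
        qed
        have on: "onorm (F' x - F' (?c y)) \<le> e" if x: "x \<in> ?T" for x
        proof (rule onorm_bound)
          show "0 \<le> e" using \<open>e > 0\<close> by simp
          fix v
          obtain w where w: "w \<in> ball y s" "x = ?c w" using x by blast
          have "?c w \<in> ball q d" "?c y \<in> ball q d" using w(1) s(2) y ball_radial[OF _ t] by blast+
          then have "linear (F' (?c w))" "linear (F' (?c y))" using lin by blast+
          then have diff: "F' (?c w) v - F' (?c y) v =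
              (\<Sum>b\<in>B. (v \<bullet> b) * (F' (?c w) b - F' (?c y) b))"
            using linear_parseval[OF B, of "F' (?c w)" v] linear_parseval[OF B, of "F' (?c y)" v]
            by (simp add: sum_subtractf right_diff_distrib)
          have "norm (F' (?c w) v - F' (?c y) v) \<le> (\<Sum>b\<in>B. norm v * (norm b * \<bar>F' (?c w) b - F' (?c y) b\<bar>))"
            unfolding diff
          proof (rule sum_norm_le)
            fix b
            have "\<bar>v \<bullet> b\<bar> * \<bar>F' (?c w) b - F' (?c y) b\<bar> \<le> (norm v * norm b) * \<bar>F' (?c w) b - F' (?c y) b\<bar>"
              by (intro mult_right_mono Cauchy_Schwarz_ineq2) simp
            then show "norm ((v \<bullet> b) * (F' (?c w) b - F' (?c y) b)) \<le>
                norm v * (norm b * \<bar>F' (?c w) b - F' (?c y) b\<bar>)"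
              by (simp add: abs_mult mult.assoc)
          qed
          also have "\<dots> = norm v * psi (w, t)"
            by (simp only: psi_def case_prod_conv sum_distrib_left)
          also have "\<dots> \<le> norm v * e"
            using s(3) w(1) t by (intro mult_left_mono) auto
          finally show "norm ((F' x - F' (?c y)) v) \<le> e * norm v"
            using w(2) by (simp add: mult.commute)
        qed
        have "norm (F (?c z) - F (?c y) - F' (?c y) (?c z - ?c y)) \<le> norm (?c z - ?c y) * e"
          by (rule differentiable_bound_linearization[OF seg F'T on]) (use s(1) in auto)
        moreover have "?c z - ?c y = t *\<^sub>R (z - y)" by (simp add: algebra_simps)
        moreover have "F' (?c y) (t *\<^sub>R (z - y)) = t * F' (?c y) (z - y)"
          using lin[OF ball_radial[OF y t]] by (simp add: linear_scale)
        ultimately have "\<bar>F (?c z) - F (?c y) - t * F' (?c y) (z - y)\<bar> \<le> t * (norm (z - y) * e)"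
          using t by simp
        also have "\<dots> \<le> 1 * (norm (z - y) * e)"
          using t \<open>e > 0\<close> by (intro mult_right_mono) auto
        finally have "\<bar>t ^ k\<bar> * \<bar>F (?c z) - F (?c y) - t * F' (?c y) (z - y)\<bar> \<le> 1 * (norm (z - y) * e)"
          using t by (intro mult_mono) (auto simp: power_le_one)
        then show ?thesis
          by (simp add: abs_mult[symmetric] algebra_simps)
      qed
      then have "norm (radial_mean k F q z - radial_mean k F q y -
          radial_mean (Suc k) (\<lambda>x. F' x (z - y)) q y) \<le> e * norm (z - y) * measure lborel {0..1::real}"
        using \<open>e > 0\<close> by (intro has_integral_bound_real[OF _ finite.emptyI int]) auto
      then show ?thesis by simp
    qed
    then show "\<exists>s>0. \<forall>z\<in>UNIV. norm (z - y) < s \<longrightarrow> norm (radial_mean k F q z - radial_mean k F q y -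
        radial_mean (Suc k) (\<lambda>x. F' x (z - y)) q y) \<le> e * norm (z - y)"
      using s(1) by blast
  qed
qed

lemma Ck_on_radial_mean:
  fixes F :: "'e::real_inner \<Rightarrow> real" and B :: "'e set"
  assumes B: "parseval B"
  shows "Ck_on n (ball q d) F \<Longrightarrow> Ck_on n (ball q d) (radial_mean k F q)"
proof (induction n arbitrary: k F)
  case 0
  then show ?case by (simp add: continuous_on_radial_mean)
next
  case (Suc n)
  have cont: "continuous_on (ball q d) (\<lambda>x. frechet_derivative F (at x) v)" for v
  proof -
    have "Ck_on m S f \<Longrightarrow> continuous_on S f" for m S and f :: "'e \<Rightarrow> real"
      by (induction m) (auto dest: Ck_on_Suc_imp simp del: Ck_on.simps(2))
    then show ?thesis using Suc.prems by (metis Ck_on.simps(2))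
  qed
  have "(radial_mean k F q has_derivative
      (\<lambda>v. radial_mean (Suc k) (\<lambda>x. frechet_derivative F (at x) v) q y)) (at y)"
    if "y \<in> ball q d" for y
    by (rule radial_mean_has_derivative[OF B Ck_on_Suc_has_derivative[OF Suc.prems] cont that])
  then show ?case
    by (rule Ck_on_SucI[OF open_ball]) (use Suc in auto)
qed

text \<open>
  Integrate the derivative of \<open>F\<close> along the segment from \<open>q\<close> to \<open>y\<close>.
\<close>

lemma hadamard_lemma:
  fixes F :: "'e::real_inner \<Rightarrow> real" and B :: "'e set"
  assumes B: "parseval B" and F: "smooth_on (ball q d) F"
  obtains G where "\<And>b. smooth_on (ball q d) (G b)"
    and "\<And>b. G b q = frechet_derivative F (at q) b"
    and "\<And>y. y \<in> ball q d \<Longrightarrow> F y = F q + (\<Sum>b\<in>B. ((y - q) \<bullet> b) * G b y)"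
proof
  define G where "G b = radial_mean 0 (\<lambda>x. frechet_derivative F (at x) b) q" for b
  have F': "smooth_on (ball q d) (\<lambda>x. frechet_derivative F (at x) b)" for b
    using F by (rule smooth_on_frechet_derivative)
  then show "smooth_on (ball q d) (G b)" for b
    unfolding smooth_on_def G_def using Ck_on_radial_mean[OF B] by blast
  show "G b q = frechet_derivative F (at q) b" for b
    by (simp add: G_def radial_mean_def)
  fix y assume y: "y \<in> ball q d"
  let ?F' = "\<lambda>t. frechet_derivative F (at (q + t *\<^sub>R (y - q)))"
  have der: "(F has_derivative ?F' t) (at (q + t *\<^sub>R (y - q)))" if "t \<in> {0..1}" for t
    using smooth_on_has_derivative[OF F ball_radial[OF y that]] .
  have "((\<lambda>t. ?F' t (y - q)) has_integral
      (F (q + 1 *\<^sub>R (y - q)) - F (q + 0 *\<^sub>R (y - q)))) {0..1}"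
  proof (rule fundamental_theorem_of_calculus)
    fix t :: real assume t: "t \<in> {0..1}"
    have "((\<lambda>t. q + t *\<^sub>R (y - q)) has_derivative (\<lambda>h. h *\<^sub>R (y - q))) (at t within {0..1})"
      by (auto intro!: derivative_eq_intros)
    from has_derivative_compose[OF this der[OF t]]
    show "((\<lambda>t. F (q + t *\<^sub>R (y - q))) has_vector_derivative ?F' t (y - q)) (at t within {0..1})"
      using has_derivative_linear[OF der[OF t]]
      by (simp add: has_vector_derivative_def linear_scale)
  qed simp
  then have "((\<lambda>t. ?F' t (y - q)) has_integral (F y - F q)) {0..1}" by simp
  moreover have "((\<lambda>t. \<Sum>b\<in>B. ((y - q) \<bullet> b) * (t ^ 0 * ?F' t b)) has_integral
      (\<Sum>b\<in>B. ((y - q) \<bullet> b) * G b y)) {0..1}"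
    unfolding G_def using B
    by (intro has_integral_sum has_integral_mult_right
        radial_mean_has_integral[OF smooth_on_continuous_on[OF F'] y]) (simp add: parseval_def)
  moreover have "(\<Sum>b\<in>B. ((y - q) \<bullet> b) * (t ^ 0 * ?F' t b)) = ?F' t (y - q)" if "t \<in> {0..1}" for t
    unfolding linear_parseval[OF B has_derivative_linear[OF der[OF that]], of "y - q"] by simp
  ultimately have "F y - F q = (\<Sum>b\<in>B. ((y - q) \<bullet> b) * G b y)"
    by (metis (no_types, lifting) has_integral_eq has_integral_unique)
  then show "F y = F q + (\<Sum>b\<in>B. ((y - q) \<bullet> b) * G b y)" by simp
qed

section \<open>Smooth functions and vector fields supported in a chart\<close>

lemma manifold_parseval:
  fixes \<A> :: "('m::{t2_space, second_countable_topology}, 'e::real_inner) atlas"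
  assumes "smooth_manifold \<A>"
  obtains B :: "'e set" where "parseval B"
proof -
  obtain B :: "'e set" where "finite B" "span B = UNIV"
    using assms unfolding smooth_manifold_def by metis
  then show thesis using parseval_exists that by metis
qed

lemma chart_open:
  assumes "smooth_manifold \<A>" "(U, \<phi>) \<in> \<A>"
  shows "open U" "open (\<phi> ` U)"
  using assms by (auto simp: smooth_manifold_def)

lemma chart_homeomorphism:
  assumes "smooth_manifold \<A>" "(U, \<phi>) \<in> \<A>"
  shows "homeomorphism U (\<phi> ` U) \<phi> (inv_into U \<phi>)"
  using assms by (auto simp: smooth_manifold_def)

lemma chart_inv:
  assumes "smooth_manifold \<A>" "(U, \<phi>) \<in> \<A>" "m \<in> U"
  shows "inv_into U \<phi> (\<phi> m) = m"
  using homeomorphism_apply1[OF chart_homeomorphism[OF assms(1,2)]] assms(3) .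

lemma chart_open_image:
  assumes "smooth_manifold \<A>" "(U, \<phi>) \<in> \<A>" "open T"
  shows "open (\<phi> ` (U \<inter> T))"
proof -
  have "openin (top_of_set (\<phi> ` U)) (\<phi> ` (U \<inter> T))"
    using homeomorphism_imp_open_map[OF chart_homeomorphism[OF assms(1,2)]] assms(3)
    by (simp add: openin_open_Int)
  then show ?thesis
    using openin_open_trans chart_open(2)[OF assms(1,2)] by blast
qed

lemma C_inf_chart: "f \<in> C_inf \<A> \<Longrightarrow> (U, \<phi>) \<in> \<A> \<Longrightarrow> smooth_on (\<phi> ` U) (\<lambda>y. f (inv_into U \<phi> y))"
  by (auto simp: C_inf_def o_def)

lemma C_inf_const: "(\<lambda>_. c) \<in> C_inf \<A>"
  by (auto simp: C_inf_def o_def intro: smooth_on_const)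

lemma C_inf_add:
  assumes "smooth_manifold \<A>" "f \<in> C_inf \<A>" "g \<in> C_inf \<A>"
  shows "f + g \<in> C_inf \<A>"
  unfolding C_inf_def
proof clarify
  fix U \<phi> assume "(U, \<phi>) \<in> \<A>"
  then show "smooth_on (\<phi> ` U) ((f + g) \<circ> inv_into U \<phi>)"
    using smooth_on_add[OF chart_open(2)[OF assms(1)] C_inf_chart[OF assms(2)] C_inf_chart[OF assms(3)]]
    by (simp add: o_def)
qed

lemma C_inf_mult:
  assumes "smooth_manifold \<A>" "f \<in> C_inf \<A>" "g \<in> C_inf \<A>"
  shows "f * g \<in> C_inf \<A>"
  unfolding C_inf_def
proof clarify
  fix U \<phi> assume "(U, \<phi>) \<in> \<A>"
  then show "smooth_on (\<phi> ` U) ((f * g) \<circ> inv_into U \<phi>)"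
    using smooth_on_mult[OF chart_open(2)[OF assms(1)] C_inf_chart[OF assms(2)] C_inf_chart[OF assms(3)]]
    by (simp add: o_def)
qed

definition chart_extension ::
  "'m set \<Rightarrow> ('m \<Rightarrow> 'e) \<Rightarrow> 'e set \<Rightarrow> ('e \<Rightarrow> real) \<Rightarrow> 'm \<Rightarrow> real" where
  "chart_extension U \<phi> W G m = (if m \<in> U \<and> \<phi> m \<in> W then G (\<phi> m) else 0)"

text \<open>
  Read in another chart, the extension is the composition of \<open>G\<close> with a coordinate change on the
  part of the chart that corresponds to \<open>W\<close>, and it is zero off the preimage \<open>L\<close> of \<open>K\<close>. These two
  open sets cover the chart: \<open>L\<close> is compact, hence closed because the manifold is Hausdorff.
\<close>

lemma chart_extension_smooth:
  fixes \<A> :: "('m::{t2_space, second_countable_topology}, 'e::real_inner) atlas"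
  assumes M: "smooth_manifold \<A>" and U: "(U, \<phi>) \<in> \<A>"
    and W: "open W" "W \<subseteq> \<phi> ` U" and K: "compact K" "K \<subseteq> W"
    and G: "smooth_on W G" "\<And>y. y \<in> W - K \<Longrightarrow> G y = 0"
  shows "chart_extension U \<phi> W G \<in> C_inf \<A>"
  unfolding C_inf_def
proof clarify
  fix V \<psi> assume V: "(V, \<psi>) \<in> \<A>"
  obtain B :: "'e set" where B: "parseval B"
    by (rule manifold_parseval[OF M])
  let ?i = "inv_into U \<phi>" and ?j = "inv_into V \<psi>"
  define U' where "U' = {m \<in> U. \<phi> m \<in> W}"
  define L where "L = ?i ` K"
  have hom: "homeomorphism U (\<phi> ` U) \<phi> ?i" using chart_homeomorphism[OF M U] .
  have "continuous_on U \<phi>" "continuous_on (\<phi> ` U) ?i"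
    using hom by (auto simp: homeomorphism_def)
  have "open U'"
  proof -
    have "U' = U \<inter> \<phi> -` W" by (auto simp: U'_def)
    then show ?thesis
      using continuous_open_preimage[OF \<open>continuous_on U \<phi>\<close> chart_open(1)[OF M U] W(1)]
      by simp
  qed
  have "closed L"
    unfolding L_def
    by (intro compact_imp_closed compact_continuous_image K(1)
        continuous_on_subset[OF \<open>continuous_on (\<phi> ` U) ?i\<close>]) (use K(2) W(2) in blast)
  have inv: "?i (\<phi> m) = m" if "m \<in> U" for m using chart_inv[OF M U that] .
  have invV: "?j (\<psi> m) = m" if "m \<in> V" for m using chart_inv[OF M V that] .
  show "smooth_on (\<psi> ` V) (chart_extension U \<phi> W G \<circ> ?j)"
  proof (rule smooth_on_local)
    fix x assume "x \<in> \<psi> ` V"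
    then obtain m where m: "m \<in> V" "x = \<psi> m" by blast
    show "\<exists>T. open T \<and> x \<in> T \<and> smooth_on T (chart_extension U \<phi> W G \<circ> ?j)"
    proof (cases "m \<in> U'")
      case True
      let ?T = "\<psi> ` (V \<inter> U')"
      have "open ?T" using chart_open_image[OF M V \<open>open U'\<close>] .
      have "smooth_on (\<psi> ` (V \<inter> U)) (\<phi> \<circ> ?j)"
        using M U V unfolding smooth_manifold_def by fast
      then have "smooth_on ?T (\<lambda>y. \<phi> (?j y))"
        unfolding o_def by (rule smooth_on_subset) (auto simp: U'_def)
      moreover have "(\<lambda>y. \<phi> (?j y)) ` ?T \<subseteq> W"
        using invV by (auto simp: U'_def)
      ultimately have "smooth_on ?T (\<lambda>y. G (\<phi> (?j y)))"
        by (intro smooth_on_compose[OF B \<open>open ?T\<close> W(1) _ G(1)])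
      then have "smooth_on ?T (chart_extension U \<phi> W G \<circ> ?j)"
        by (rule smooth_on_cong[OF \<open>open ?T\<close>, rotated])
          (use invV in \<open>auto simp: chart_extension_def U'_def\<close>)
      then show ?thesis using \<open>open ?T\<close> True m by blast
    next
      case False
      let ?T = "\<psi> ` (V \<inter> - L)"
      have "open ?T" using chart_open_image[OF M V] \<open>closed L\<close> by blast
      have "L \<subseteq> U'"
      proof
        fix z assume "z \<in> L"
        then obtain y where y: "y \<in> K" "z = ?i y" by (auto simp: L_def)
        then obtain u where "u \<in> U" "y = \<phi> u" using K(2) W(2) by blast
        then show "z \<in> U'" using y inv K(2) by (auto simp: U'_def)
      qed
      then have "x \<in> ?T" using False m by blast
      have "smooth_on ?T (chart_extension U \<phi> W G \<circ> ?j)"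
      proof (rule smooth_on_cong[OF \<open>open ?T\<close> _ smooth_on_const[of _ 0]])
        fix y assume "y \<in> ?T"
        then obtain z where z: "z \<in> V" "z \<notin> L" "y = \<psi> z" by blast
        have "\<phi> z \<notin> K" if "z \<in> U" using z(2) inv[OF that] unfolding L_def by force
        then show "0 = (chart_extension U \<phi> W G \<circ> ?j) y"
          using G(2) invV z by (auto simp: chart_extension_def)
      qed
      then show ?thesis using \<open>open ?T\<close> \<open>x \<in> ?T\<close> by blast
    qed
  qed
qed

lemma sum_fun_apply: "(\<Sum>i\<in>I. f i) x = (\<Sum>i\<in>I. f i x)"
  for f :: "'i \<Rightarrow> 'a \<Rightarrow> 'b::comm_monoid_add"
  by (induction I rule: infinite_finite_induct) auto

lemma additive_on_sum:
  fixes h :: "'a::comm_monoid_add \<Rightarrow> 'b::ab_group_add"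
  assumes "0 \<in> V" "\<And>x y. x \<in> V \<Longrightarrow> y \<in> V \<Longrightarrow> x + y \<in> V \<and> h (x + y) = h x + h y"
    and "\<And>i. i \<in> I \<Longrightarrow> f i \<in> V"
  shows "h (\<Sum>i\<in>I. f i) = (\<Sum>i\<in>I. h (f i)) \<and> (\<Sum>i\<in>I. f i) \<in> V"
proof -
  have "h 0 = 0" using assms(2)[OF assms(1) assms(1)] by simp
  then show ?thesis
    using assms(3) by (induction I rule: infinite_finite_induct) (simp_all add: assms(1,2))
qed

text \<open>
  A derivation at \<open>q\<close> is a directional derivative. By Hadamard's lemma, with \<open>\<beta>\<close> a bump function at
  \<open>q\<close>, the global function \<open>f \<beta>\<^sup>2\<close> is \<open>f(q) \<beta>\<^sup>2\<close> plus a sum of products of \<open>X\<^sub>b = \<beta> (y - q)\<^sub>b\<close> and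
  \<open>H\<^sub>b = \<beta> G\<^sub>b\<close>, both defined on the whole manifold. As \<open>X\<^sub>b\<close> vanishes at \<open>q\<close>, where \<open>\<beta> = 1\<close>, the Leibniz rule
  leaves \<open>v f = \<Sum>\<^sub>b v(X\<^sub>b) \<partial>\<^sub>b f(q)\<close>.
\<close>

lemma tangent_vector_in_chart:
  fixes \<A> :: "('m::{t2_space, second_countable_topology}, 'e::real_inner) atlas"
  assumes M: "smooth_manifold \<A>" and U: "(U, \<phi>) \<in> \<A>" "q \<in> U" and v: "v \<in> tangent_space \<A> q"
  obtains w where
    "\<And>f. f \<in> C_inf \<A> \<Longrightarrow> v f = frechet_derivative (\<lambda>y. f (inv_into U \<phi> y)) (at (\<phi> q)) w"
proof -
  obtain B :: "'e set" where B: "parseval B"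
    by (rule manifold_parseval[OF M])
  obtain d where d: "d > 0" "ball (\<phi> q) d \<subseteq> \<phi> ` U"
    using chart_open(2)[OF M U(1)] U(2) open_contains_ball by blast
  let ?W = "ball (\<phi> q) d" and ?\<beta> = "bump (\<phi> q) (d / 2)"
  have K: "compact (cball (\<phi> q) (d / 2))" "cball (\<phi> q) (d / 2) \<subseteq> ?W"
    using compact_cball_parseval[OF B] d(1) by auto
  have \<beta>: "smooth_on ?W ?\<beta>" using smooth_on_subset[OF smooth_bump[OF B]] by blast
  have \<beta>0: "?\<beta> y = 0" if "y \<in> ?W - cball (\<phi> q) (d / 2)" for y
    using that d(1) by (intro bump_eq_0) (auto simp: dist_commute)
  have smooth: "chart_extension U \<phi> ?W (\<lambda>y. ?\<beta> y * G y) \<in> C_inf \<A>" if "smooth_on ?W G" for G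
    by (rule chart_extension_smooth[OF M U(1) open_ball d(2) K])
      (use that \<beta> \<beta>0 in \<open>auto intro: smooth_on_mult\<close>)
  define X where "X b = chart_extension U \<phi> ?W (\<lambda>y. ?\<beta> y * ((y - \<phi> q) \<bullet> b))" for b
  define b0 where "b0 = chart_extension U \<phi> ?W ?\<beta>"
  have Xs: "X b \<in> C_inf \<A>" for b
  proof -
    have "smooth_on ?W (\<lambda>y. y \<bullet> b + - (\<phi> q \<bullet> b))"
      by (intro smooth_on_add smooth_on_linear bounded_linear_inner_left smooth_on_const open_ball)
    then show ?thesis unfolding X_def by (intro smooth) (simp add: inner_diff_left)
  qed
  have b0s: "b0 \<in> C_inf \<A>"
    using smooth[OF smooth_on_const[of _ 1]] by (simp add: b0_def)
  have at_q: "X b q = 0" "b0 q = 1" for b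
    using U(2) d(1) by (auto simp: X_def b0_def chart_extension_def bump_center)
  note lin = v[unfolded tangent_space_def, simplified, THEN conjunct1]
  have leib: "v (f * g) = f q * v g + g q * v f" if "f \<in> C_inf \<A>" "g \<in> C_inf \<A>" for f g
    using v that by (simp add: tangent_space_def)
  note mult = C_inf_mult[OF M] and add = C_inf_add[OF M]
  have zero: "0 \<in> C_inf \<A>" using C_inf_const[of 0] by (simp add: zero_fun_def)
  have "v f = frechet_derivative (\<lambda>y. f (inv_into U \<phi> y)) (at (\<phi> q)) (\<Sum>b\<in>B. v (X b) *\<^sub>R b)"
    if f: "f \<in> C_inf \<A>" for f
  proof -
    let ?F = "\<lambda>y. f (inv_into U \<phi> y)"
    have F: "smooth_on ?W ?F" using smooth_on_subset[OF C_inf_chart[OF f U(1)] d(2)] .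
    obtain G where G: "\<And>b. smooth_on ?W (G b)"
      "\<And>b. G b (\<phi> q) = frechet_derivative ?F (at (\<phi> q)) b"
      "\<And>y. y \<in> ?W \<Longrightarrow> ?F y = ?F (\<phi> q) + (\<Sum>b\<in>B. ((y - \<phi> q) \<bullet> b) * G b y)"
      by (rule hadamard_lemma[OF B F], rule that)
    define H where "H b = chart_extension U \<phi> ?W (\<lambda>y. ?\<beta> y * G b y)" for b
    have Hs: "H b \<in> C_inf \<A>" for b unfolding H_def using smooth[OF G(1)] .
    have Hq: "H b q = frechet_derivative ?F (at (\<phi> q)) b" for b
      using U(2) d(1) G(2) by (simp add: H_def chart_extension_def bump_center)
    have eq: "f * (b0 * b0) = f q *\<^sub>R (b0 * b0) + (\<Sum>b\<in>B. X b * H b)"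
    proof
      fix m
      have "f m = f q + (\<Sum>b\<in>B. ((\<phi> m - \<phi> q) \<bullet> b) * G b (\<phi> m))" if "m \<in> U" "\<phi> m \<in> ?W"
        using G(3)[OF that(2)] chart_inv[OF M U(1)] that(1) U(2) by simp
      then show "(f * (b0 * b0)) m = (f q *\<^sub>R (b0 * b0) + (\<Sum>b\<in>B. X b * H b)) m"
        by (auto simp: sum_fun_apply b0_def X_def H_def chart_extension_def distrib_right
            sum_distrib_right intro!: sum.cong)
    qed
    have sum: "v (\<Sum>b\<in>B. X b * H b) = (\<Sum>b\<in>B. v (X b * H b)) \<and> (\<Sum>b\<in>B. X b * H b) \<in> C_inf \<A>"
      using additive_on_sum[of "C_inf \<A>" v B "\<lambda>b. X b * H b"] zero lin add mult[OF Xs Hs]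
      by (simp add: linear_on_space_def)
    have bb: "b0 * b0 \<in> C_inf \<A>" using mult[OF b0s b0s] .
    have "f q *\<^sub>R (b0 * b0) \<in> C_inf \<A>"
      using mult[OF C_inf_const[of "f q"] bb] by (simp add: times_fun_def scaleR_fun_def)
    then have "v (f * (b0 * b0)) = f q * v (b0 * b0) + (\<Sum>b\<in>B. v (X b * H b))"
      unfolding eq using lin sum bb by (simp add: linear_on_space_def)
    then have "v f = (\<Sum>b\<in>B. v (X b * H b))"
      using leib[OF f bb] at_q by simp
    also have "\<dots> = (\<Sum>b\<in>B. v (X b) * frechet_derivative ?F (at (\<phi> q)) b)"
      using leib[OF Xs Hs] at_q Hq by (simp add: mult.commute)
    also have "\<dots> = frechet_derivative ?F (at (\<phi> q)) (\<Sum>b\<in>B. v (X b) *\<^sub>R b)"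
    proof -
      have "linear (frechet_derivative ?F (at (\<phi> q)))"
        using smooth_on_has_derivative[OF F] d(1) has_derivative_linear by force
      then show ?thesis by (simp add: linear_sum linear_scale)
    qed
    finally show ?thesis .
  qed
  then show thesis by (rule that)
qed

lemma directional_derivative_tangent:
  assumes M: "smooth_manifold \<A>" and U: "(U, \<phi>) \<in> \<A>" "m \<in> U"
  shows "(\<lambda>f. if f \<in> C_inf \<A> then frechet_derivative (\<lambda>y. f (inv_into U \<phi> y)) (at (\<phi> m)) w else 0)
    \<in> tangent_space \<A> m"
proof -
  let ?D = "\<lambda>f. frechet_derivative (\<lambda>y. f (inv_into U \<phi> y)) (at (\<phi> m))"
  have der: "((\<lambda>y. f (inv_into U \<phi> y)) has_derivative ?D f) (at (\<phi> m))" if "f \<in> C_inf \<A>" for f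
    using smooth_on_has_derivative[OF C_inf_chart[OF that U(1)]] U(2) by blast
  have at: "inv_into U \<phi> (\<phi> m) = m" using chart_inv[OF M U] .
  have cmult: "c *\<^sub>R f \<in> C_inf \<A>" if "f \<in> C_inf \<A>" for c f
    using C_inf_mult[OF M C_inf_const[of c] that] by (simp add: times_fun_def scaleR_fun_def)
  have "?D (f + g) w = ?D f w + ?D g w" if "f \<in> C_inf \<A>" "g \<in> C_inf \<A>" for f g
    using frechet_derivative_at[OF has_derivative_add[OF der[OF that(1)] der[OF that(2)]]]
    by (simp add: fun_eq_iff)
  moreover have "?D (c *\<^sub>R f) w = c * ?D f w" if "f \<in> C_inf \<A>" for c f
    using frechet_derivative_at[OF has_derivative_scaleR_right[OF der[OF that], of c]]
    by (simp add: fun_eq_iff)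
  moreover have "?D (f * g) w = f m * ?D g w + g m * ?D f w" if "f \<in> C_inf \<A>" "g \<in> C_inf \<A>" for f g
    using frechet_derivative_at[OF has_derivative_mult[OF der[OF that(1)] der[OF that(2)]]]
    by (simp add: fun_eq_iff at algebra_simps)
  ultimately show ?thesis
    using C_inf_add[OF M] C_inf_mult[OF M] cmult by (auto simp: tangent_space_def linear_on_space_def)
qed

text \<open>
  In the chart this is the vector field with components \<open>Z\<close>.
\<close>

definition chart_field ::
  "('m, 'e::real_inner) atlas \<Rightarrow> 'm set \<Rightarrow> ('m \<Rightarrow> 'e) \<Rightarrow> 'e set \<Rightarrow> ('e \<Rightarrow> 'e) \<Rightarrow> 'm \<Rightarrow> 'm tvec" where
  "chart_field \<A> U \<phi> W Z m f = (if f \<in> C_inf \<A> then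
     chart_extension U \<phi> W (\<lambda>y. frechet_derivative (\<lambda>y. f (inv_into U \<phi> y)) (at y) (Z y)) m else 0)"

lemma chart_field_smooth:
  fixes \<A> :: "('m::{t2_space, second_countable_topology}, 'e::real_inner) atlas"
  assumes M: "smooth_manifold \<A>" and U: "(U, \<phi>) \<in> \<A>"
    and W: "open W" "W \<subseteq> \<phi> ` U" and K: "compact K" "K \<subseteq> W"
    and Z: "\<And>F :: 'e \<Rightarrow> real. smooth_on W F \<Longrightarrow> smooth_on W (\<lambda>y. frechet_derivative F (at y) (Z y))"
    and Z0: "\<And>y. y \<in> W - K \<Longrightarrow> Z y = 0"
  shows "chart_field \<A> U \<phi> W Z \<in> vector_fields \<A>"
proof -
  have F: "smooth_on W (\<lambda>y. f (inv_into U \<phi> y))" if "f \<in> C_inf \<A>" for f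
    using smooth_on_subset[OF C_inf_chart[OF that U] W(2)] .
  have "chart_field \<A> U \<phi> W Z m \<in> tangent_space \<A> m" for m
  proof (cases "m \<in> U \<and> \<phi> m \<in> W")
    case True
    then have "chart_field \<A> U \<phi> W Z m = (\<lambda>f. if f \<in> C_inf \<A> then
        frechet_derivative (\<lambda>y. f (inv_into U \<phi> y)) (at (\<phi> m)) (Z (\<phi> m)) else 0)"
      by (auto simp: chart_field_def chart_extension_def fun_eq_iff)
    then show ?thesis using directional_derivative_tangent[OF M U] True by simp
  next
    case False
    then have "chart_field \<A> U \<phi> W Z m = (\<lambda>f. 0)"
      by (auto simp: chart_field_def chart_extension_def fun_eq_iff)
    then show ?thesis by (simp add: tangent_space_def linear_on_space_def)
  qed
  moreover have "lie_fun (chart_field \<A> U \<phi> W Z) f \<in> C_inf \<A>" if f: "f \<in> C_inf \<A>" for f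
  proof -
    have "frechet_derivative (\<lambda>y. f (inv_into U \<phi> y)) (at y) (Z y) = 0" if "y \<in> W - K" for y
      using smooth_on_has_derivative[OF F[OF f]] that Z0[OF that]
      by (metis DiffD1 has_derivative_linear linear_0)
    then have "chart_extension U \<phi> W
        (\<lambda>y. frechet_derivative (\<lambda>y. f (inv_into U \<phi> y)) (at y) (Z y)) \<in> C_inf \<A>"
      by (intro chart_extension_smooth[OF M U W K] Z F f)
    then show ?thesis using f by (simp add: lie_fun_def chart_field_def[abs_def])
  qed
  ultimately show ?thesis by (simp add: tangent_bundle_def)
qed

section \<open>Local frames\<close>

text \<open>
  Let \<open>\<beta>\<close> be a bump function in a chart at \<open>p\<close>. A tangent vector \<open>v\<close> at \<open>q\<close> is the directional
  derivative along some \<open>w\<close>, and the functions \<open>\<beta> y\<^sub>b\<close> are defined on the whole manifold. From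
  \<open>v(\<beta> y\<^sub>b) = \<beta>(q) w\<^sub>b + y\<^sub>b(q) v(\<beta>)\<close> one recovers \<open>\<beta>(q)\<^sup>2 w\<close> as
  \<open>\<Sum>\<^sub>b v(\<beta> y\<^sub>b) \<beta> \<partial>\<^sub>b - v(\<beta>) \<beta> \<Sum>\<^sub>b y\<^sub>b \<partial>\<^sub>b\<close>. So the frame has one member for every basis vector, and one more, with
  index \<open>None\<close>, made of the function \<open>\<beta>\<close> and of \<open>-\<beta>\<close> times the Euler field, and \<open>\<kappa> = \<beta>\<^sup>2\<close>.
\<close>

lemma local_frame:
  fixes \<A> :: "('m::{t2_space, second_countable_topology}, 'e::real_inner) atlas"
  assumes M: "smooth_manifold \<A>"
  obtains I :: "'e option set" and x :: "'e option \<Rightarrow> 'm \<Rightarrow> real" and E \<kappa>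
  where "finite I" "\<kappa> \<in> C_inf \<A>" "\<kappa> p = 1"
    "\<And>i. x i \<in> C_inf \<A>" "\<And>i. E i \<in> vector_fields \<A>"
    "\<And>q v. v \<in> tangent_space \<A> q \<Longrightarrow> \<kappa> q *\<^sub>R v = (\<Sum>i\<in>I. v (x i) *\<^sub>R E i q)"
proof -
  obtain B :: "'e set" where B: "parseval B"
    by (rule manifold_parseval[OF M])
  have "(\<Union>(U, \<phi>)\<in>\<A>. U) = UNIV" using M by (simp add: smooth_manifold_def)
  then have "p \<in> (\<Union>(U, \<phi>)\<in>\<A>. U)" by simp
  then obtain U \<phi> where U: "(U, \<phi>) \<in> \<A>" "p \<in> U" by blast
  obtain d where d: "d > 0" "ball (\<phi> p) d \<subseteq> \<phi> ` U"
    using chart_open(2)[OF M U(1)] U(2) open_contains_ball by blast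
  define W where "W = ball (\<phi> p) d"
  define \<beta> where "\<beta> = bump (\<phi> p) (d / 2)"
  define K where "K = cball (\<phi> p) (d / 2)"
  have W: "open W" "W \<subseteq> \<phi> ` U" and K: "compact K" "K \<subseteq> W"
    using compact_cball_parseval[OF B] d by (auto simp: W_def K_def)
  have \<beta>: "smooth_on W \<beta>"
    unfolding \<beta>_def using smooth_on_subset[OF smooth_bump[OF B]] by blast
  have \<beta>0: "\<beta> y = 0" if "y \<in> W - K" for y
    unfolding \<beta>_def using that d(1) by (intro bump_eq_0) (auto simp: K_def dist_commute)
  have coord: "smooth_on W (\<lambda>y. y \<bullet> b)" for b
    by (rule smooth_on_linear[OF bounded_linear_inner_left W(1)])
  define e where "e = chart_extension U \<phi> W \<beta>"
  define X where "X b = chart_extension U \<phi> W (\<lambda>y. \<beta> y * (y \<bullet> b))" for b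
  define x where "x = case_option e X"
  define E where "E = case_option (chart_field \<A> U \<phi> W (\<lambda>y. - \<beta> y *\<^sub>R y))
    (\<lambda>b. chart_field \<A> U \<phi> W (\<lambda>y. \<beta> y *\<^sub>R b))"
  have e: "e \<in> C_inf \<A>"
    unfolding e_def by (rule chart_extension_smooth[OF M U(1) W K \<beta>]) (rule \<beta>0)
  have X: "X b \<in> C_inf \<A>" for b
    unfolding X_def by (rule chart_extension_smooth[OF M U(1) W K])
      (use \<beta> \<beta>0 coord in \<open>auto intro: smooth_on_mult W(1)\<close>)
  have lin: "linear (frechet_derivative F (at y))" if "smooth_on W F" "y \<in> W" for F :: "'e \<Rightarrow> real" and y
    using smooth_on_has_derivative[OF that] by (rule has_derivative_linear)
  have "chart_field \<A> U \<phi> W (\<lambda>y. \<beta> y *\<^sub>R b) \<in> vector_fields \<A>" for b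
  proof (rule chart_field_smooth[OF M U(1) W K])
    fix F :: "'e \<Rightarrow> real" assume F: "smooth_on W F"
    have "smooth_on W (\<lambda>y. \<beta> y * frechet_derivative F (at y) b)"
      by (intro smooth_on_mult W(1) \<beta> smooth_on_frechet_derivative F)
    then show "smooth_on W (\<lambda>y. frechet_derivative F (at y) (\<beta> y *\<^sub>R b))"
      by (rule smooth_on_cong[OF W(1), rotated]) (simp add: linear_scale[OF lin[OF F]])
  qed (simp add: \<beta>0)
  moreover have "chart_field \<A> U \<phi> W (\<lambda>y. - \<beta> y *\<^sub>R y) \<in> vector_fields \<A>"
  proof (rule chart_field_smooth[OF M U(1) W K])
    fix F :: "'e \<Rightarrow> real" assume F: "smooth_on W F"
    have "Ck_on n W (\<lambda>y. ((-1) * \<beta> y) * (\<Sum>b\<in>B. (y \<bullet> b) * frechet_derivative F (at y) b))" for n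
      using \<beta> coord smooth_on_frechet_derivative[OF F]
      by (intro Ck_on_mult Ck_on_sum Ck_on_const W(1)) (auto simp: smooth_on_def)
    then have "smooth_on W (\<lambda>y. - \<beta> y * (\<Sum>b\<in>B. (y \<bullet> b) * frechet_derivative F (at y) b))"
      by (simp add: smooth_on_def)
    then show "smooth_on W (\<lambda>y. frechet_derivative F (at y) (- \<beta> y *\<^sub>R y))"
    proof (rule smooth_on_cong[OF W(1), rotated])
      fix y assume y: "y \<in> W"
      show "- \<beta> y * (\<Sum>b\<in>B. (y \<bullet> b) * frechet_derivative F (at y) b) =
          frechet_derivative F (at y) (- \<beta> y *\<^sub>R y)"
        using linear_parseval[OF B lin[OF F y], of y] linear_scale[OF lin[OF F y], of "- \<beta> y" y] by simp
    qed
  qed (simp add: \<beta>0)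
  ultimately have Es: "E i \<in> vector_fields \<A>" for i
    by (cases i) (simp_all add: E_def)
  have frame: "(e * e) q *\<^sub>R v = (\<Sum>i\<in>insert None (Some ` B). v (x i) *\<^sub>R E i q)"
    if v: "v \<in> tangent_space \<A> q" for q v
  proof
    fix f
    have fin: "finite B" using B by (simp add: parseval_def)
    have RHS: "(\<Sum>i\<in>insert None (Some ` B). v (x i) *\<^sub>R E i q) f =
        v e * E None q f + (\<Sum>b\<in>B. v (X b) * E (Some b) q f)"
      using fin by (simp add: sum_fun_apply x_def sum.reindex image_iff)
    show "((e * e) q *\<^sub>R v) f = (\<Sum>i\<in>insert None (Some ` B). v (x i) *\<^sub>R E i q) f"
    proof (cases "f \<in> C_inf \<A> \<and> q \<in> U \<and> \<phi> q \<in> W")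
      case False
      then have "E i q f = 0" for i
        by (cases i) (auto simp: E_def chart_field_def chart_extension_def)
      moreover have "(e * e) q * v f = 0"
        using False v by (auto simp: e_def chart_extension_def tangent_space_def)
      ultimately show ?thesis unfolding RHS by simp
    next
      case True
      then have f: "f \<in> C_inf \<A>" and q: "q \<in> U" and y: "\<phi> q \<in> W" by auto
      let ?y = "\<phi> q"
      let ?D = "\<lambda>f. frechet_derivative (\<lambda>y. f (inv_into U \<phi> y)) (at ?y)"
      obtain w where w: "\<And>f. f \<in> C_inf \<A> \<Longrightarrow> v f = ?D f w"
        by (rule tangent_vector_in_chart[OF M U(1) q v], rule that)
      have F: "smooth_on W (\<lambda>y. f (inv_into U \<phi> y))"
        using smooth_on_subset[OF C_inf_chart[OF f U(1)] W(2)] .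
      have ext: "chart_extension U \<phi> W G (inv_into U \<phi> y) = G y" if "y \<in> W" for G y
        using that W(2) chart_inv[OF M U(1)] by (auto simp: chart_extension_def)
      have D\<beta>: "(\<beta> has_derivative frechet_derivative \<beta> (at ?y)) (at ?y)"
        using smooth_on_has_derivative[OF \<beta> y] .
      have "?D e = frechet_derivative \<beta> (at ?y)"
        using has_derivative_transform_within_open[OF D\<beta> W(1) y] ext
        by (intro frechet_derivative_at[symmetric]) (simp add: e_def)
      then have ve: "v e = frechet_derivative \<beta> (at ?y) w" using w[OF e] by simp
      have vX: "v (X b) = \<beta> ?y * (w \<bullet> b) + v e * (?y \<bullet> b)" for b
      proof -
        have "((\<lambda>y. \<beta> y * (y \<bullet> b)) has_derivative
            (\<lambda>h. \<beta> ?y * (h \<bullet> b) + frechet_derivative \<beta> (at ?y) h * (?y \<bullet> b))) (at ?y)"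
          by (intro has_derivative_mult D\<beta> bounded_linear_imp_has_derivative bounded_linear_inner_left)
        from has_derivative_transform_within_open[OF this W(1) y]
        have "((\<lambda>y. X b (inv_into U \<phi> y)) has_derivative
            (\<lambda>h. \<beta> ?y * (h \<bullet> b) + frechet_derivative \<beta> (at ?y) h * (?y \<bullet> b))) (at ?y)"
          using ext by (simp add: X_def)
        from frechet_derivative_at[OF this, symmetric] show ?thesis
          unfolding w[OF X] ve by simp
      qed
      have "linear (?D f)" using lin[OF F y] .
      have EN: "E None q f = - \<beta> ?y * ?D f ?y" and ES: "E (Some b) q f = \<beta> ?y * ?D f b" for b
        using True linear_scale[OF \<open>linear (?D f)\<close>, of "- \<beta> ?y"] linear_scale[OF \<open>linear (?D f)\<close>, of "\<beta> ?y"]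
        by (simp_all add: E_def chart_field_def chart_extension_def)
      have "(\<Sum>b\<in>B. v (X b) * E (Some b) q f) =
          \<beta> ?y * (\<beta> ?y * (\<Sum>b\<in>B. (w \<bullet> b) * ?D f b) + v e * (\<Sum>b\<in>B. (?y \<bullet> b) * ?D f b))"
        by (simp add: vX ES sum_distrib_left sum.distrib algebra_simps)
      also have "(\<Sum>b\<in>B. (w \<bullet> b) * ?D f b) = v f"
        using linear_parseval[OF B \<open>linear (?D f)\<close>, of w] w[OF f] by simp
      also have "(\<Sum>b\<in>B. (?y \<bullet> b) * ?D f b) = ?D f ?y"
        using linear_parseval[OF B \<open>linear (?D f)\<close>, of ?y] by simp
      finally have sum: "(\<Sum>b\<in>B. v (X b) * E (Some b) q f) =
          \<beta> ?y * (\<beta> ?y * v f + v e * ?D f ?y)" .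
      have "e q = \<beta> ?y" using q y by (simp add: e_def chart_extension_def)
      then show ?thesis unfolding RHS EN sum by (simp add: algebra_simps)
    qed
  qed
  show thesis
  proof (rule that)
    show "finite (insert None (Some ` B))" using B by (simp add: parseval_def)
    show "e * e \<in> C_inf \<A>" using C_inf_mult[OF M e e] .
    show "(e * e) p = 1"
      using U(2) d(1) by (simp add: e_def chart_extension_def W_def \<beta>_def bump_center)
    show "x i \<in> C_inf \<A>" for i using e X by (cases i) (simp_all add: x_def)
  qed (use Es frame in auto)
qed

section \<open>Functions, vector fields and one-forms\<close>

locale manifold =
  fixes \<A> :: "('m::{t2_space, second_countable_topology}, 'e::real_inner) atlas"
  assumes smooth_manifold: "smooth_manifold \<A>"
begin

abbreviation "\<F> \<equiv> C_inf \<A>"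
abbreviation "TM \<equiv> tangent_bundle \<A>"
abbreviation "\<X> \<equiv> vector_fields \<A>"
abbreviation "TsM \<equiv> cotangent_bundle \<A>"
abbreviation "\<Omega> \<equiv> one_forms \<A>"

lemma F_const [simp]: "(\<lambda>_. c) \<in> \<F>"
  by (rule C_inf_const)

lemma F_0 [simp]: "0 \<in> \<F>"
  using F_const[of 0] by (simp add: zero_fun_def)

lemma F_add [simp]: "f \<in> \<F> \<Longrightarrow> g \<in> \<F> \<Longrightarrow> f + g \<in> \<F>"
  by (rule C_inf_add[OF smooth_manifold])

lemma F_mult [simp]: "f \<in> \<F> \<Longrightarrow> g \<in> \<F> \<Longrightarrow> f * g \<in> \<F>"
  by (rule C_inf_mult[OF smooth_manifold])

lemma F_uminus [simp]: "f \<in> \<F> \<Longrightarrow> - f \<in> \<F>"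
  using F_mult[OF F_const[of "-1"], of f] by (simp add: times_fun_def fun_Compl_def)

lemma F_diff [simp]: "f \<in> \<F> \<Longrightarrow> g \<in> \<F> \<Longrightarrow> f - g \<in> \<F>"
  using F_add[of f "- g"] by simp

lemma fibre_TM [simp]: "fibre TM p = tangent_space \<A> p"
  by (simp add: tangent_bundle_def)

lemma vector_field_iff:
  "X \<in> \<X> \<longleftrightarrow> (\<forall>p. X p \<in> tangent_space \<A> p) \<and> (\<forall>f\<in>\<F>. lie_fun X f \<in> \<F>)"
  unfolding tangent_bundle_def by simp

lemma vector_fieldI:
  "(\<And>p. X p \<in> tangent_space \<A> p) \<Longrightarrow> (\<And>f. f \<in> \<F> \<Longrightarrow> lie_fun X f \<in> \<F>) \<Longrightarrow> X \<in> \<X>"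
  unfolding vector_field_iff by blast

lemma vector_field_at [simp]: "X \<in> \<X> \<Longrightarrow> X p \<in> tangent_space \<A> p"
  unfolding vector_field_iff by blast

lemma lie_fun_F [simp]: "X \<in> \<X> \<Longrightarrow> f \<in> \<F> \<Longrightarrow> lie_fun X f \<in> \<F>"
  unfolding vector_field_iff by blast

lemma tangent_add: "v \<in> tangent_space \<A> p \<Longrightarrow> f \<in> \<F> \<Longrightarrow> g \<in> \<F> \<Longrightarrow> v (f + g) = v f + v g"
  by (simp add: tangent_space_def linear_on_space_def)

lemma tangent_scaleR: "v \<in> tangent_space \<A> p \<Longrightarrow> f \<in> \<F> \<Longrightarrow> v (c *\<^sub>R f) = c * v f"
  by (simp add: tangent_space_def linear_on_space_def)

lemma tangent_mult:
  "v \<in> tangent_space \<A> p \<Longrightarrow> f \<in> \<F> \<Longrightarrow> g \<in> \<F> \<Longrightarrow> v (f * g) = f p * v g + g p * v f"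
  by (simp add: tangent_space_def)

lemma tangent_outside: "v \<in> tangent_space \<A> p \<Longrightarrow> f \<notin> \<F> \<Longrightarrow> v f = 0"
  by (simp add: tangent_space_def)

lemma tangent_0: "v \<in> tangent_space \<A> p \<Longrightarrow> v 0 = 0"
  using tangent_add[of v p 0 0] by simp

lemma tangent_const: "v \<in> tangent_space \<A> p \<Longrightarrow> v (\<lambda>_. c) = 0"
proof -
  assume v: "v \<in> tangent_space \<A> p"
  have "(\<lambda>_::'m. 1::real) * (\<lambda>_. 1) = (\<lambda>_. 1)" "(\<lambda>_::'m. c) = c *\<^sub>R (\<lambda>_. 1)"
    by (simp_all add: fun_eq_iff)
  then show ?thesis
    using tangent_mult[OF v F_const[of 1] F_const[of 1]] tangent_scaleR[OF v F_const[of 1], of c] by simp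
qed

lemma tangent_uminus: "v \<in> tangent_space \<A> p \<Longrightarrow> f \<in> \<F> \<Longrightarrow> v (- f) = - v f"
  using tangent_add[of v p f "- f"] by (simp add: tangent_0)

lemma tangent_diff: "v \<in> tangent_space \<A> p \<Longrightarrow> f \<in> \<F> \<Longrightarrow> g \<in> \<F> \<Longrightarrow> v (f - g) = v f - v g"
  using tangent_add[of v p f "- g"] by (simp add: tangent_uminus)

lemma tangent_space_add [simp]:
  "v \<in> tangent_space \<A> p \<Longrightarrow> w \<in> tangent_space \<A> p \<Longrightarrow> v + w \<in> tangent_space \<A> p"
  by (simp add: tangent_space_def linear_on_space_def algebra_simps)

lemma tangent_space_scaleR [simp]: "v \<in> tangent_space \<A> p \<Longrightarrow> c *\<^sub>R v \<in> tangent_space \<A> p"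
  by (simp add: tangent_space_def linear_on_space_def algebra_simps)

lemma tangent_space_0 [simp]: "0 \<in> tangent_space \<A> p"
  by (simp add: tangent_space_def linear_on_space_def)

lemma tangent_space_diff [simp]:
  "v \<in> tangent_space \<A> p \<Longrightarrow> w \<in> tangent_space \<A> p \<Longrightarrow> v - w \<in> tangent_space \<A> p"
  using tangent_space_add[of v p "(-1) *\<^sub>R w"] tangent_space_scaleR[of w p "-1"] by simp

lemma lie_fun_add [simp]:
  "X \<in> \<X> \<Longrightarrow> f \<in> \<F> \<Longrightarrow> g \<in> \<F> \<Longrightarrow> lie_fun X (f + g) = lie_fun X f + lie_fun X g"
  by (auto simp: lie_fun_def fun_eq_iff intro: tangent_add[OF vector_field_at])

lemma lie_fun_uminus [simp]: "X \<in> \<X> \<Longrightarrow> f \<in> \<F> \<Longrightarrow> lie_fun X (- f) = - lie_fun X f"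
  by (auto simp: lie_fun_def fun_eq_iff intro: tangent_uminus[OF vector_field_at])

lemma lie_fun_diff [simp]:
  "X \<in> \<X> \<Longrightarrow> f \<in> \<F> \<Longrightarrow> g \<in> \<F> \<Longrightarrow> lie_fun X (f - g) = lie_fun X f - lie_fun X g"
  by (auto simp: lie_fun_def fun_eq_iff intro: tangent_diff[OF vector_field_at])

lemma lie_fun_mult [simp]:
  "X \<in> \<X> \<Longrightarrow> f \<in> \<F> \<Longrightarrow> g \<in> \<F> \<Longrightarrow> lie_fun X (f * g) = f * lie_fun X g + g * lie_fun X f"
  by (auto simp: lie_fun_def fun_eq_iff intro: tangent_mult[OF vector_field_at])

lemma lie_fun_add_field [simp]: "lie_fun (X + Y) f = lie_fun X f + lie_fun Y f"
  by (simp add: lie_fun_def fun_eq_iff)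

lemma lie_fun_diff_field [simp]: "lie_fun (X - Y) f = lie_fun X f - lie_fun Y f"
  by (simp add: lie_fun_def fun_eq_iff)

lemma lie_fun_fmult_field [simp]: "lie_fun (g \<odot> X) f = g * lie_fun X f"
  by (simp add: lie_fun_def fmult_def fun_eq_iff)

lemma lie_fun_bracket [simp]:
  "lie_fun (vf_bracket X Y) f = lie_fun X (lie_fun Y f) - lie_fun Y (lie_fun X f)"
  by (simp add: lie_fun_def vf_bracket_def fun_eq_iff)

lemma X_add [simp]: "X \<in> \<X> \<Longrightarrow> Y \<in> \<X> \<Longrightarrow> X + Y \<in> \<X>"
  by (rule vector_fieldI) auto

lemma X_diff [simp]: "X \<in> \<X> \<Longrightarrow> Y \<in> \<X> \<Longrightarrow> X - Y \<in> \<X>"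
  by (rule vector_fieldI) auto

lemma X_0 [simp]: "0 \<in> \<X>"
  by (rule vector_fieldI) (auto simp: lie_fun_def)

lemma X_uminus [simp]: "X \<in> \<X> \<Longrightarrow> - X \<in> \<X>"
  using X_diff[OF X_0] by fastforce

lemma X_fmult [simp]: "f \<in> \<F> \<Longrightarrow> X \<in> \<X> \<Longrightarrow> f \<odot> X \<in> \<X>"
  by (rule vector_fieldI) (auto, simp add: fmult_def)

lemma X_sum: "(\<And>i. i \<in> I \<Longrightarrow> X i \<in> \<X>) \<Longrightarrow> (\<Sum>i\<in>I. X i) \<in> \<X>"
  by (induction I rule: infinite_finite_induct) auto

lemma X_bracket [simp]:
  assumes "X \<in> \<X>" "Y \<in> \<X>"
  shows "vf_bracket X Y \<in> \<X>"
proof (rule vector_fieldI)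
  fix p :: 'm
  have at: "lie_fun Z f p = Z p f" for Z f by (simp add: lie_fun_def)
  show "vf_bracket X Y p \<in> tangent_space \<A> p"
    unfolding tangent_space_def
  proof (intro CollectI conjI ballI allI impI)
    show "linear_on_space \<F> (vf_bracket X Y p)"
    proof -
      have "lie_fun Z (c *\<^sub>R f) = c *\<^sub>R lie_fun Z f" if "Z \<in> \<X>" "f \<in> \<F>" for Z c f
        using that by (auto simp: lie_fun_def fun_eq_iff intro: tangent_scaleR[OF vector_field_at])
      then show ?thesis
        using assms by (auto simp: linear_on_space_def vf_bracket_def
            tangent_add[OF vector_field_at] tangent_scaleR[OF vector_field_at] algebra_simps)
    qed
    show "vf_bracket X Y p (f * g) = f p * vf_bracket X Y p g + g p * vf_bracket X Y p f"
      if "f \<in> \<F>" "g \<in> \<F>" for f g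
      using that assms by (simp add: vf_bracket_def tangent_add[OF vector_field_at]
          tangent_mult[OF vector_field_at] at algebra_simps)
    show "vf_bracket X Y p f = 0" if "f \<notin> \<F>" for f
    proof -
      have "lie_fun X f = 0" "lie_fun Y f = 0"
        using that assms by (auto simp: lie_fun_def fun_eq_iff intro: tangent_outside[OF vector_field_at])
      then show ?thesis using assms by (simp add: vf_bracket_def tangent_0[OF vector_field_at])
    qed
  qed
qed (use assms in auto)

lemma vector_field_eqI:
  assumes "X \<in> \<X>" "Y \<in> \<X>" "\<And>f. f \<in> \<F> \<Longrightarrow> lie_fun X f = lie_fun Y f"
  shows "X = Y"
proof (intro ext)
  fix p f
  show "X p f = Y p f"
  proof (cases "f \<in> \<F>")
    case True
    then show ?thesis using fun_cong[OF assms(3), of f p] by (simp add: lie_fun_def)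
  next
    case False
    then show ?thesis
      using tangent_outside[of "X p" p f] tangent_outside[of "Y p" p f] assms(1,2) by simp
  qed
qed

lemma bracket_antisym: "vf_bracket X Y = - vf_bracket Y X"
  by (simp add: vf_bracket_def fun_eq_iff)

lemma bracket_add_left: "X \<in> \<X> \<Longrightarrow> Y \<in> \<X> \<Longrightarrow> Z \<in> \<X> \<Longrightarrow> vf_bracket (X + Y) Z = vf_bracket X Z + vf_bracket Y Z"
  by (rule vector_field_eqI) (auto simp: algebra_simps)

lemma bracket_add_right: "X \<in> \<X> \<Longrightarrow> Y \<in> \<X> \<Longrightarrow> Z \<in> \<X> \<Longrightarrow> vf_bracket X (Y + Z) = vf_bracket X Y + vf_bracket X Z"
  by (rule vector_field_eqI) (auto simp: algebra_simps)

lemma bracket_diff_left: "X \<in> \<X> \<Longrightarrow> Y \<in> \<X> \<Longrightarrow> Z \<in> \<X> \<Longrightarrow> vf_bracket (X - Y) Z = vf_bracket X Z - vf_bracket Y Z"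
  by (rule vector_field_eqI) (auto simp: algebra_simps)

lemma bracket_diff_right: "X \<in> \<X> \<Longrightarrow> Y \<in> \<X> \<Longrightarrow> Z \<in> \<X> \<Longrightarrow> vf_bracket X (Y - Z) = vf_bracket X Y - vf_bracket X Z"
  by (rule vector_field_eqI) (auto simp: algebra_simps)

lemma bracket_fmult_right:
  "X \<in> \<X> \<Longrightarrow> Y \<in> \<X> \<Longrightarrow> f \<in> \<F> \<Longrightarrow> vf_bracket X (f \<odot> Y) = f \<odot> vf_bracket X Y + lie_fun X f \<odot> Y"
  by (rule vector_field_eqI) (auto simp: algebra_simps)

lemma bracket_fmult_left:
  "X \<in> \<X> \<Longrightarrow> Y \<in> \<X> \<Longrightarrow> f \<in> \<F> \<Longrightarrow> vf_bracket (f \<odot> X) Y = f \<odot> vf_bracket X Y - lie_fun Y f \<odot> X"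
  by (rule vector_field_eqI) (auto simp: algebra_simps)

lemma jacobi:
  "X \<in> \<X> \<Longrightarrow> Y \<in> \<X> \<Longrightarrow> Z \<in> \<X> \<Longrightarrow>
   vf_bracket X (vf_bracket Y Z) = vf_bracket (vf_bracket X Y) Z + vf_bracket Y (vf_bracket X Z)"
  by (rule vector_field_eqI) (auto simp: algebra_simps)

section \<open>Tensoriality\<close>

lemma frame_at:
  obtains I :: "'e option set" and x :: "'e option \<Rightarrow> 'm \<Rightarrow> real" and E \<kappa>
  where "finite I" "\<kappa> \<in> \<F>" "\<kappa> p = 1" "\<And>i. x i \<in> \<F>" "\<And>i. E i \<in> \<X>"
    "\<And>q v. v \<in> tangent_space \<A> q \<Longrightarrow> \<kappa> q *\<^sub>R v = (\<Sum>i\<in>I. v (x i) *\<^sub>R E i q)"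
  by (rule local_frame[OF smooth_manifold, of p], rule that)

lemma extend_tangent_vector:
  assumes "v \<in> tangent_space \<A> p"
  obtains X where "X \<in> \<X>" "X p = v"
proof -
  obtain I :: "'e option set" and x :: "'e option \<Rightarrow> 'm \<Rightarrow> real" and E \<kappa>
    where fr: "finite I" "\<kappa> \<in> \<F>" "\<kappa> p = 1" "\<And>i. x i \<in> \<F>" "\<And>i. E i \<in> \<X>"
    "\<And>q v. v \<in> tangent_space \<A> q \<Longrightarrow> \<kappa> q *\<^sub>R v = (\<Sum>i\<in>I. v (x i) *\<^sub>R E i q)"
    by (rule frame_at[of p], rule that)
  show thesis
  proof (rule that)
    show "(\<Sum>i\<in>I. (\<lambda>_. v (x i)) \<odot> E i) \<in> \<X>" using fr by (intro X_sum) simp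
    show "(\<Sum>i\<in>I. (\<lambda>_. v (x i)) \<odot> E i) p = v"
      using fr(3) fr(6)[OF assms] by (simp add: sum_fun_apply fmult_def)
  qed
qed

text \<open>
  Apply \<open>\<Phi>\<close> to \<open>\<kappa> X = \<Sum>\<^sub>i X(x\<^sub>i) E\<^sub>i\<close>: if \<open>X\<close> vanishes at \<open>p\<close>, then so do all its coefficients, whereas
  \<open>\<kappa>\<close> is 1 at \<open>p\<close>.
\<close>

lemma tensorial_vanishes:
  fixes \<Phi> :: "('m \<Rightarrow> 'm tvec) \<Rightarrow> 'm \<Rightarrow> 'w::real_vector"
  assumes add: "\<And>X Y. X \<in> \<X> \<Longrightarrow> Y \<in> \<X> \<Longrightarrow> \<Phi> (X + Y) = \<Phi> X + \<Phi> Y"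
    and fmult: "\<And>f X. f \<in> \<F> \<Longrightarrow> X \<in> \<X> \<Longrightarrow> \<Phi> (f \<odot> X) = f \<odot> \<Phi> X"
    and X: "X \<in> \<X>" "X p = 0"
  shows "\<Phi> X p = 0"
proof -
  obtain I :: "'e option set" and x :: "'e option \<Rightarrow> 'm \<Rightarrow> real" and E \<kappa>
    where fr: "finite I" "\<kappa> \<in> \<F>" "\<kappa> p = 1" "\<And>i. x i \<in> \<F>" "\<And>i. E i \<in> \<X>"
    "\<And>q v. v \<in> tangent_space \<A> q \<Longrightarrow> \<kappa> q *\<^sub>R v = (\<Sum>i\<in>I. v (x i) *\<^sub>R E i q)"
    by (rule frame_at[of p], rule that)
  have sum: "\<Phi> (\<Sum>i\<in>I. Y i) = (\<Sum>i\<in>I. \<Phi> (Y i))" if "\<And>i. Y i \<in> \<X>" for Y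
    using additive_on_sum[of \<X> \<Phi> I Y] add that by simp
  have "\<kappa> \<odot> X = (\<Sum>i\<in>I. lie_fun X (x i) \<odot> E i)"
    using fr(6) X(1) by (auto simp: fmult_def sum_fun_apply lie_fun_def)
  then have "\<kappa> \<odot> \<Phi> X = (\<Sum>i\<in>I. lie_fun X (x i) \<odot> \<Phi> (E i))"
    using fmult[OF fr(2) X(1)] fr(4,5) X(1) by (simp add: sum fmult)
  then have "(\<kappa> \<odot> \<Phi> X) p = 0"
    using X(2) by (simp add: sum_fun_apply fmult_def lie_fun_def)
  then show ?thesis using fr(3) by (simp add: fmult_def)
qed

lemma fibre_map_eqI:
  assumes "\<And>p v. v \<notin> tangent_space \<A> p \<Longrightarrow> \<eta> p v = \<theta> p v" "\<And>X. X \<in> \<X> \<Longrightarrow> \<eta> \<star> X = \<theta> \<star> X"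
  shows "\<eta> = \<theta>"
proof (intro ext)
  fix p v
  show "\<eta> p v = \<theta> p v"
  proof (cases "v \<in> tangent_space \<A> p")
    case True
    then obtain X where "X \<in> \<X>" "X p = v" by (rule extend_tangent_vector)
    then show ?thesis using fun_cong[OF assms(2), of X p] by (simp add: app_def)
  qed (rule assms(1))
qed

lemma bundle_map_outside: "\<eta> \<in> bundle_maps TM E \<Longrightarrow> v \<notin> tangent_space \<A> p \<Longrightarrow> \<eta> p v = 0"
  unfolding bundle_maps_def fibre_TM by blast

lemma bundle_map_eqI:
  assumes "\<eta> \<in> bundle_maps TM E" "\<theta> \<in> bundle_maps TM E" "\<And>X. X \<in> \<X> \<Longrightarrow> \<eta> \<star> X = \<theta> \<star> X"
  shows "\<eta> = \<theta>"
  by (rule fibre_map_eqI) (use assms in \<open>simp_all add: bundle_map_outside\<close>)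

text \<open>
  A map on vector fields that is linear over the smooth functions depends at every point only on the
  value of the vector field there. So it comes from a fibrewise map, whose value on a tangent vector is
  found by extending that vector to a vector field.
\<close>

lemma tensorial_bundle_map:
  fixes \<Phi> :: "('m \<Rightarrow> 'm tvec) \<Rightarrow> 'm \<Rightarrow> 'w::real_vector"
  assumes add: "\<And>X Y. X \<in> \<X> \<Longrightarrow> Y \<in> \<X> \<Longrightarrow> \<Phi> (X + Y) = \<Phi> X + \<Phi> Y"
    and fmult: "\<And>f X. f \<in> \<F> \<Longrightarrow> X \<in> \<X> \<Longrightarrow> \<Phi> (f \<odot> X) = f \<odot> \<Phi> X"
    and sec: "\<And>X. X \<in> \<X> \<Longrightarrow> \<Phi> X \<in> sections E"
    and fib: "\<And>u p. u \<in> sections E \<Longrightarrow> u p \<in> fibre E p"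
  obtains \<eta> where "\<eta> \<in> bundle_maps TM E" "\<And>X. X \<in> \<X> \<Longrightarrow> \<eta> \<star> X = \<Phi> X"
proof
  define ext where "ext p v = (SOME X. X \<in> \<X> \<and> X p = v)" for p v
  have ext: "ext p v \<in> \<X>" "ext p v p = v" if "v \<in> tangent_space \<A> p" for p v
    using someI_ex[of "\<lambda>X. X \<in> \<X> \<and> X p = v"] extend_tangent_vector[OF that]
    unfolding ext_def by metis+
  define \<eta> where "\<eta> p v = (if v \<in> tangent_space \<A> p then \<Phi> (ext p v) p else 0)" for p v
  have local: "\<Phi> X p = \<Phi> Y p" if "X \<in> \<X>" "Y \<in> \<X>" "X p = Y p" for X Y p
  proof -
    have "\<Phi> (X - Y) p = 0" using tensorial_vanishes[of \<Phi> "X - Y" p] add fmult that by simp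
    moreover have "\<Phi> X = \<Phi> (X - Y) + \<Phi> Y" using add[of "X - Y" Y] that by simp
    ultimately show ?thesis by simp
  qed
  have \<eta>: "\<eta> p (X p) = \<Phi> X p" if "X \<in> \<X>" for X p
    using that ext[of "X p" p] by (auto simp: \<eta>_def intro: local)
  then show star: "\<eta> \<star> X = \<Phi> X" if "X \<in> \<X>" for X
    using that by (simp add: app_def)
  show "\<eta> \<in> bundle_maps TM E"
    unfolding bundle_maps_def
  proof (intro CollectI conjI allI ballI impI)
    fix p
    show "\<eta> p v \<in> fibre E p" if "v \<in> fibre TM p" for v
      using that sec ext fib by (simp add: \<eta>_def)
    show "linear_on_space (fibre TM p) (\<eta> p)"
      unfolding linear_on_space_def
    proof (intro conjI ballI allI)
      fix v w assume vw: "v \<in> fibre TM p" "w \<in> fibre TM p"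
      show "\<eta> p (v + w) = \<eta> p v + \<eta> p w"
        using \<eta>[of "ext p v + ext p w" p] \<eta>[of "ext p v" p] \<eta>[of "ext p w" p] ext vw
        by (simp add: add)
    next
      fix c v assume v: "v \<in> fibre TM p"
      show "\<eta> p (c *\<^sub>R v) = c *\<^sub>R \<eta> p v"
        using \<eta>[OF X_fmult[OF F_const[of c] ext(1)[OF v[unfolded fibre_TM]]], of p] \<eta>[of "ext p v" p] ext v
          fmult[of "\<lambda>_. c" "ext p v"] by (simp add: fmult_def)
    qed
    show "\<eta> p v = 0" if "v \<notin> fibre TM p" for v using that by (simp add: \<eta>_def)
    show "\<eta> \<star> X \<in> sections E" if "X \<in> \<X>" for X using star[OF that] sec[OF that] by simp
  qed
qed

lemma bundle_map_section: "l \<in> bundle_maps E F \<Longrightarrow> u \<in> sections E \<Longrightarrow> l \<star> u \<in> sections F"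
  by (simp add: bundle_maps_def)

lemma bundle_map_star_add:
  "l \<in> bundle_maps TM F \<Longrightarrow> X \<in> \<X> \<Longrightarrow> Y \<in> \<X> \<Longrightarrow> l \<star> (X + Y) = l \<star> X + l \<star> Y"
  by (simp add: bundle_maps_def linear_on_space_def app_def fun_eq_iff)

lemma bundle_map_star_fmult:
  "l \<in> bundle_maps TM F \<Longrightarrow> X \<in> \<X> \<Longrightarrow> l \<star> (f \<odot> X) = f \<odot> (l \<star> X)"
  by (simp add: bundle_maps_def linear_on_space_def app_def fmult_def fun_eq_iff)

lemma bundle_map_star_uminus:
  "l \<in> bundle_maps TM F \<Longrightarrow> X \<in> \<X> \<Longrightarrow> l \<star> (- X) = - (l \<star> X)"
  using bundle_map_star_fmult[of l F X "\<lambda>_. - 1"] by (simp add: fmult_def fun_Compl_def)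

lemma bundle_map_star_diff:
  "l \<in> bundle_maps TM F \<Longrightarrow> X \<in> \<X> \<Longrightarrow> Y \<in> \<X> \<Longrightarrow> l \<star> (X - Y) = l \<star> X - l \<star> Y"
  using bundle_map_star_add[of l F X "- Y"] bundle_map_star_uminus[of l F Y] by simp

text \<open>
  One-forms are the bundle maps to the trivial line bundle, so that the results on bundle maps cover
  them.
\<close>

lemma one_forms_bundle_maps:
  "\<Omega> = bundle_maps TM \<lparr>fibre = (\<lambda>_. UNIV :: real set), sections = \<F>\<rparr>"
  by (auto simp: bundle_maps_def dual_bundle_def dual_space_def)

lemma fibre_TsM: "fibre TsM p = dual_space (tangent_space \<A> p)"
  by (simp add: dual_bundle_def)

lemma one_form_iff:
  "\<alpha> \<in> \<Omega> \<longleftrightarrow> (\<forall>p. \<alpha> p \<in> dual_space (tangent_space \<A> p)) \<and> (\<forall>X\<in>\<X>. \<alpha> \<star> X \<in> \<F>)"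
  unfolding dual_bundle_def by simp

lemma one_form_at [simp]: "\<alpha> \<in> \<Omega> \<Longrightarrow> \<alpha> p \<in> dual_space (tangent_space \<A> p)"
  unfolding one_form_iff by blast

lemma one_formI:
  "(\<And>p. \<alpha> p \<in> dual_space (tangent_space \<A> p)) \<Longrightarrow> (\<And>X. X \<in> \<X> \<Longrightarrow> \<alpha> \<star> X \<in> \<F>) \<Longrightarrow> \<alpha> \<in> \<Omega>"
  unfolding one_form_iff by blast

lemma pairing_F [simp]: "\<alpha> \<in> \<Omega> \<Longrightarrow> X \<in> \<X> \<Longrightarrow> \<alpha> \<star> X \<in> \<F>"
  unfolding one_form_iff by blast

lemma pairing_add [simp]: "\<alpha> \<in> \<Omega> \<Longrightarrow> X \<in> \<X> \<Longrightarrow> Y \<in> \<X> \<Longrightarrow> \<alpha> \<star> (X + Y) = \<alpha> \<star> X + \<alpha> \<star> Y"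
  unfolding one_forms_bundle_maps by (rule bundle_map_star_add)

lemma pairing_diff [simp]: "\<alpha> \<in> \<Omega> \<Longrightarrow> X \<in> \<X> \<Longrightarrow> Y \<in> \<X> \<Longrightarrow> \<alpha> \<star> (X - Y) = \<alpha> \<star> X - \<alpha> \<star> Y"
  unfolding one_forms_bundle_maps by (rule bundle_map_star_diff)

lemma pairing_uminus [simp]: "\<alpha> \<in> \<Omega> \<Longrightarrow> X \<in> \<X> \<Longrightarrow> \<alpha> \<star> (- X) = - (\<alpha> \<star> X)"
  unfolding one_forms_bundle_maps by (rule bundle_map_star_uminus)

lemma fmult_real [simp]: "f \<odot> g = f * g" for f g :: "'m \<Rightarrow> real"
  by (simp add: fmult_def times_fun_def)

lemma pairing_fmult [simp]: "\<alpha> \<in> \<Omega> \<Longrightarrow> X \<in> \<X> \<Longrightarrow> \<alpha> \<star> (f \<odot> X) = f * (\<alpha> \<star> X)"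
  using bundle_map_star_fmult[of \<alpha> _ X f] unfolding one_forms_bundle_maps fmult_real by blast

lemma star_add_left [simp]: "(\<alpha> + \<beta>) \<star> X = \<alpha> \<star> X + \<beta> \<star> X"
  by (simp add: app_def fun_eq_iff)

lemma star_diff_left [simp]: "(\<alpha> - \<beta>) \<star> X = \<alpha> \<star> X - \<beta> \<star> X"
  by (simp add: app_def fun_eq_iff)

lemma star_uminus_left [simp]: "(- \<alpha>) \<star> X = - (\<alpha> \<star> X)"
  by (simp add: app_def fun_eq_iff)

lemma pairing_fmult_left [simp]: "(f \<odot> \<alpha>) \<star> X = f * (\<alpha> \<star> X)" for \<alpha> :: "'m \<Rightarrow> 'm covec"
  by (simp add: app_def fmult_def fun_eq_iff)

lemma one_form_eqI: "\<alpha> \<in> \<Omega> \<Longrightarrow> \<beta> \<in> \<Omega> \<Longrightarrow> (\<And>X. X \<in> \<X> \<Longrightarrow> \<alpha> \<star> X = \<beta> \<star> X) \<Longrightarrow> \<alpha> = \<beta>"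
  unfolding one_forms_bundle_maps by (rule bundle_map_eqI)

lemma one_form_of_tensorial:
  assumes "\<And>X Y. X \<in> \<X> \<Longrightarrow> Y \<in> \<X> \<Longrightarrow> \<omega> (X + Y) = \<omega> X + \<omega> Y"
    and "\<And>f X. f \<in> \<F> \<Longrightarrow> X \<in> \<X> \<Longrightarrow> \<omega> (f \<odot> X) = f * \<omega> X"
    and "\<And>X. X \<in> \<X> \<Longrightarrow> \<omega> X \<in> \<F>"
  shows "one_form_of \<A> \<omega> \<in> \<Omega>" "Y \<in> \<X> \<Longrightarrow> one_form_of \<A> \<omega> \<star> Y = \<omega> Y"
proof -
  obtain \<eta> where \<eta>: "\<eta> \<in> \<Omega>" "\<And>X. X \<in> \<X> \<Longrightarrow> \<eta> \<star> X = \<omega> X"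
    using tensorial_bundle_map[of \<omega> "\<lparr>fibre = (\<lambda>_. UNIV), sections = \<F>\<rparr>"] assms
    unfolding one_forms_bundle_maps fmult_real by auto
  have "one_form_of \<A> \<omega> = \<eta>"
    unfolding one_form_of_def using \<eta> by (auto intro!: the_equality one_form_eqI)
  then show "one_form_of \<A> \<omega> \<in> \<Omega>" "Y \<in> \<X> \<Longrightarrow> one_form_of \<A> \<omega> \<star> Y = \<omega> Y" using \<eta> by auto
qed

section \<open>Lie derivative and exterior derivative of one-forms\<close>

lemma covector_add [simp]:
  "\<alpha> \<in> dual_space V \<Longrightarrow> \<beta> \<in> dual_space V \<Longrightarrow> \<alpha> + \<beta> \<in> dual_space V"
  by (simp add: dual_space_def linear_on_space_def algebra_simps)

lemma covector_scaleR [simp]: "\<alpha> \<in> dual_space V \<Longrightarrow> c *\<^sub>R \<alpha> \<in> dual_space V"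
  by (simp add: dual_space_def linear_on_space_def algebra_simps)

lemma Omega_add [simp]: "\<alpha> \<in> \<Omega> \<Longrightarrow> \<beta> \<in> \<Omega> \<Longrightarrow> \<alpha> + \<beta> \<in> \<Omega>"
  by (rule one_formI) auto

lemma Omega_fmult [simp]: "f \<in> \<F> \<Longrightarrow> \<alpha> \<in> \<Omega> \<Longrightarrow> f \<odot> \<alpha> \<in> \<Omega>"
  by (rule one_formI) (auto, simp add: fmult_def)

lemma Omega_uminus [simp]: "\<alpha> \<in> \<Omega> \<Longrightarrow> - \<alpha> \<in> \<Omega>"
  using Omega_fmult[of "\<lambda>_. - 1" \<alpha>] by (simp add: fmult_def fun_Compl_def)

lemma Omega_diff [simp]: "\<alpha> \<in> \<Omega> \<Longrightarrow> \<beta> \<in> \<Omega> \<Longrightarrow> \<alpha> - \<beta> \<in> \<Omega>"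
  using Omega_add[of \<alpha> "- \<beta>"] by simp

lemma differential_star [simp]: "X \<in> \<X> \<Longrightarrow> differential \<A> f \<star> X = lie_fun X f"
  by (simp add: differential_def app_def lie_fun_def fun_eq_iff)

lemma differential_covector [simp]: "differential \<A> f p \<in> dual_space (tangent_space \<A> p)"
  by (auto simp: differential_def dual_space_def linear_on_space_def)

lemma Omega_differential [simp]: "f \<in> \<F> \<Longrightarrow> differential \<A> f \<in> \<Omega>"
  by (rule one_formI) auto

lemma lie_form:
  assumes "X \<in> \<X>" "\<beta> \<in> \<Omega>"
  shows Omega_lie_form [simp]: "lie_form \<A> X \<beta> \<in> \<Omega>"
    and lie_form_star [simp]: "Y \<in> \<X> \<Longrightarrow> lie_form \<A> X \<beta> \<star> Y = lie_fun X (\<beta> \<star> Y) - \<beta> \<star> vf_bracket X Y"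
  unfolding lie_form_def
  by (rule one_form_of_tensorial;
      use assms in \<open>simp add: bracket_add_right bracket_fmult_right algebra_simps\<close>)+

lemma contract_ext_deriv:
  assumes "X \<in> \<X>" "\<beta> \<in> \<Omega>"
  shows Omega_contract_ext_deriv [simp]: "contract_ext_deriv \<A> X \<beta> \<in> \<Omega>"
    and contract_ext_deriv_star [simp]: "Y \<in> \<X> \<Longrightarrow> contract_ext_deriv \<A> X \<beta> \<star> Y = ext_deriv \<beta> X Y"
  unfolding contract_ext_deriv_def ext_deriv_def
  by (rule one_form_of_tensorial;
      use assms in \<open>simp add: bracket_add_right bracket_fmult_right algebra_simps\<close>)+

section \<open>Bundle maps on the tangent and the cotangent bundle\<close>

text \<open>
  In the general rules the target bundle occurs only in the premises, which rewriting cannot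
  instantiate. These are the instances for bundle maps between \<open>TM\<close> and its dual.
\<close>

lemmas tangent_map_simps [simp] =
  bundle_map_star_add[where F = TM] bundle_map_star_diff[where F = TM]
  bundle_map_star_uminus[where F = TM] bundle_map_star_fmult[where F = TM]
  bundle_map_section[where E = TM and F = TM]
  bundle_map_star_add[where F = TsM] bundle_map_star_diff[where F = TsM]
  bundle_map_star_uminus[where F = TsM] bundle_map_star_fmult[where F = TsM]
  bundle_map_section[where E = TM and F = TsM]

text \<open>
  Evaluate \<open>\<alpha>\<close> on the expansion of \<open>c v\<close>. So the frame dual to that of \<open>local_frame\<close> consists of
  differentials.
\<close>

lemma covector_frame:
  assumes I: "finite I" and x: "\<And>i. x i \<in> \<F>" and E: "\<And>i. E i \<in> \<X>"
    and frame: "\<And>v. v \<in> tangent_space \<A> q \<Longrightarrow> c *\<^sub>R v = (\<Sum>i\<in>I. v (x i) *\<^sub>R E i q)"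
    and \<alpha>: "\<alpha> \<in> dual_space (tangent_space \<A> q)"
  shows "c *\<^sub>R \<alpha> = (\<Sum>i\<in>I. \<alpha> (E i q) *\<^sub>R differential \<A> (x i) q)"
proof
  fix v
  show "(c *\<^sub>R \<alpha>) v = (\<Sum>i\<in>I. \<alpha> (E i q) *\<^sub>R differential \<A> (x i) q) v"
  proof (cases "v \<in> tangent_space \<A> q")
    case True
    have lin: "linear_on_space (tangent_space \<A> q) \<alpha>" using \<alpha> by (simp add: dual_space_def)
    have "c * \<alpha> v = \<alpha> (c *\<^sub>R v)" using lin True by (simp add: linear_on_space_def)
    also have "\<dots> = (\<Sum>i\<in>I. \<alpha> (v (x i) *\<^sub>R E i q))"
      unfolding frame[OF True]
      using additive_on_sum[of "tangent_space \<A> q" \<alpha> I "\<lambda>i. v (x i) *\<^sub>R E i q"] lin E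
      by (simp add: linear_on_space_def)
    also have "\<dots> = (\<Sum>i\<in>I. v (x i) * \<alpha> (E i q))"
      using lin E by (simp add: linear_on_space_def)
    finally show ?thesis
      using True by (simp add: sum_fun_apply differential_def mult.commute)
  next
    case False
    then show ?thesis using \<alpha> by (simp add: sum_fun_apply differential_def dual_space_def)
  qed
qed

text \<open>
  Apply \<open>\<Phi>\<close> to \<open>\<kappa> \<alpha> = \<Sum>\<^sub>i \<alpha>(E\<^sub>i) dx\<^sub>i\<close>.
\<close>

lemma tensorial_on_forms_vanishes:
  fixes \<Phi> :: "('m \<Rightarrow> 'm covec) \<Rightarrow> 'm \<Rightarrow> 'w::real_vector"
  assumes add: "\<And>\<alpha> \<beta>. \<alpha> \<in> \<Omega> \<Longrightarrow> \<beta> \<in> \<Omega> \<Longrightarrow> \<Phi> (\<alpha> + \<beta>) = \<Phi> \<alpha> + \<Phi> \<beta>"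
    and fmult: "\<And>f \<alpha>. f \<in> \<F> \<Longrightarrow> \<alpha> \<in> \<Omega> \<Longrightarrow> \<Phi> (f \<odot> \<alpha>) = f \<odot> \<Phi> \<alpha>"
    and exact: "\<And>f. f \<in> \<F> \<Longrightarrow> \<Phi> (differential \<A> f) = 0"
    and \<alpha>: "\<alpha> \<in> \<Omega>"
  shows "\<Phi> \<alpha> = 0"
proof
  fix p
  obtain I :: "'e option set" and x :: "'e option \<Rightarrow> 'm \<Rightarrow> real" and E \<kappa>
    where fr: "finite I" "\<kappa> \<in> \<F>" "\<kappa> p = 1" "\<And>i. x i \<in> \<F>" "\<And>i. E i \<in> \<X>"
    "\<And>q v. v \<in> tangent_space \<A> q \<Longrightarrow> \<kappa> q *\<^sub>R v = (\<Sum>i\<in>I. v (x i) *\<^sub>R E i q)"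
    by (rule frame_at[of p], rule that)
  have Omega0: "0 \<in> \<Omega>" using Omega_diff[OF \<alpha> \<alpha>] by simp
  have form: "(\<alpha> \<star> E i) \<odot> differential \<A> (x i) \<in> \<Omega>" for i
    using \<alpha> fr by (intro Omega_fmult pairing_F Omega_differential)
  have "\<kappa> \<odot> \<alpha> = (\<Sum>i\<in>I. (\<alpha> \<star> E i) \<odot> differential \<A> (x i))"
  proof
    fix q
    show "(\<kappa> \<odot> \<alpha>) q = (\<Sum>i\<in>I. (\<alpha> \<star> E i) \<odot> differential \<A> (x i)) q"
      using covector_frame[OF fr(1,4,5,6) one_form_at[OF \<alpha>, of q]]
      by (simp add: sum_fun_apply fmult_def app_def)
  qed
  then have "\<kappa> \<odot> \<Phi> \<alpha> = (\<Sum>i\<in>I. \<Phi> ((\<alpha> \<star> E i) \<odot> differential \<A> (x i)))"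
    using additive_on_sum[of \<Omega> \<Phi> I "\<lambda>i. (\<alpha> \<star> E i) \<odot> differential \<A> (x i)"] add form Omega0
      fmult[OF fr(2) \<alpha>] by simp
  also have "\<dots> = (\<Sum>i\<in>I. (\<alpha> \<star> E i) \<odot> \<Phi> (differential \<A> (x i)))"
    using fmult \<alpha> fr by simp
  finally have "(\<kappa> \<odot> \<Phi> \<alpha>) p = 0"
    using exact fr by (simp add: sum_fun_apply fmult_def)
  then show "\<Phi> \<alpha> p = 0 p" using fr(3) by (simp add: fmult_def)
qed

lemma dual_map_star: "\<alpha> \<in> \<Omega> \<Longrightarrow> (dual_map TM l \<star> \<alpha>) \<star> X = \<alpha> \<star> (l \<star> X)"
  by (simp add: dual_map_def app_def)

lemma dual_map_bundle_map:
  assumes "l \<in> bundle_maps TM TM"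
  shows "dual_map TM l \<in> bundle_maps TsM TsM"
proof -
  have dual: "\<mu> \<circ> l p \<in> dual_space (tangent_space \<A> p)" if "\<mu> \<in> dual_space (tangent_space \<A> p)" for \<mu> p
  proof -
    have l: "l p x \<in> tangent_space \<A> p" "l p (x + y) = l p x + l p y" "l p (c *\<^sub>R x) = c *\<^sub>R l p x"
      if "x \<in> tangent_space \<A> p" "y \<in> tangent_space \<A> p" for x y c
      using assms that unfolding bundle_maps_def linear_on_space_def fibre_TM by blast+
    have l0: "l p x = 0" if "x \<notin> tangent_space \<A> p" for x
      using assms that unfolding bundle_maps_def fibre_TM by blast
    have \<mu>: "\<mu> (x + y) = \<mu> x + \<mu> y" "\<mu> (c *\<^sub>R x) = c *\<^sub>R \<mu> x"
      if "x \<in> tangent_space \<A> p" "y \<in> tangent_space \<A> p" for x y c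
      using \<open>\<mu> \<in> _\<close> that unfolding dual_space_def linear_on_space_def by blast+
    have "\<mu> 0 = 0" using \<mu>(2)[of 0 0 0] by simp
    then show ?thesis
      unfolding dual_space_def linear_on_space_def using l l0 \<mu> by auto
  qed
  have "dual_map TM l \<star> \<alpha> \<in> \<Omega>" if "\<alpha> \<in> \<Omega>" for \<alpha>
  proof (rule one_formI)
    show "(dual_map TM l \<star> \<alpha>) p \<in> dual_space (tangent_space \<A> p)" for p
      using dual[OF one_form_at[OF that]] that by (simp add: dual_map_def app_def)
    show "(dual_map TM l \<star> \<alpha>) \<star> X \<in> \<F>" if "X \<in> \<X>" for X
      using \<open>\<alpha> \<in> \<Omega>\<close> that assms by (simp add: dual_map_star)
  qed
  then show ?thesis
    unfolding bundle_maps_def fibre_TsM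
    using dual by (auto simp: dual_map_def linear_on_space_def fun_eq_iff)
qed

lemma form_map_add:
  assumes "l \<in> bundle_maps TsM F" "\<alpha> \<in> \<Omega>" "\<beta> \<in> \<Omega>"
  shows "l \<star> (\<alpha> + \<beta>) = l \<star> \<alpha> + l \<star> \<beta>"
  using assms by (simp add: bundle_maps_def linear_on_space_def app_def fibre_TsM fun_eq_iff)

lemma form_map_fmult:
  assumes "l \<in> bundle_maps TsM F" "\<alpha> \<in> \<Omega>"
  shows "l \<star> (f \<odot> \<alpha>) = f \<odot> (l \<star> \<alpha>)"
  using assms by (simp add: bundle_maps_def linear_on_space_def app_def fmult_def fibre_TsM fun_eq_iff)

lemmas form_map_simps [simp] =
  form_map_add[where F = TM] form_map_fmult[where F = TM]
  form_map_add[where F = TsM] form_map_fmult[where F = TsM]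
  bundle_map_section[where E = TsM and F = TM]
  bundle_map_section[where E = TsM and F = TsM]

lemma form_bracket_Omega:
  assumes "\<alpha> \<in> \<Omega>" "\<beta> \<in> \<Omega>" "B \<star> \<alpha> \<in> \<X>" "B \<star> \<beta> \<in> \<X>"
  shows "form_bracket \<A> B \<alpha> \<beta> \<in> \<Omega>"
  using assms by (simp add: form_bracket_def)

lemma form_bracket_star:
  assumes "\<alpha> \<in> \<Omega>" "\<beta> \<in> \<Omega>" "B \<star> \<alpha> \<in> \<X>" "B \<star> \<beta> \<in> \<X>" "Y \<in> \<X>"
  shows "form_bracket \<A> B \<alpha> \<beta> \<star> Y =
    lie_fun (B \<star> \<alpha>) (\<beta> \<star> Y) - \<beta> \<star> vf_bracket (B \<star> \<alpha>) Y
    - (lie_fun (B \<star> \<beta>) (\<alpha> \<star> Y) - lie_fun Y (\<alpha> \<star> (B \<star> \<beta>)) - \<alpha> \<star> vf_bracket (B \<star> \<beta>) Y)"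
  using assms by (simp add: form_bracket_def ext_deriv_def)

text \<open>
  By the Jacobi identity for \<open>Z, X, Y\<close>. The right-hand side is the Lie derivative of \<open>d\<theta>\<close> along \<open>Z\<close>, which
  therefore commutes with \<open>d\<close>.
\<close>

lemma ext_deriv_lie_form:
  assumes "\<theta> \<in> \<Omega>" "Z \<in> \<X>" "X \<in> \<X>" "Y \<in> \<X>"
  shows "ext_deriv (lie_form \<A> Z \<theta>) X Y =
    lie_fun Z (ext_deriv \<theta> X Y) - ext_deriv \<theta> (vf_bracket Z X) Y - ext_deriv \<theta> X (vf_bracket Z Y)"
  using assms by (simp add: ext_deriv_def jacobi[of Z X Y] algebra_simps)

lemma ext_deriv_differential:
  "f \<in> \<F> \<Longrightarrow> X \<in> \<X> \<Longrightarrow> Y \<in> \<X> \<Longrightarrow> ext_deriv (differential \<A> f) X Y = 0"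
  by (simp add: ext_deriv_def)

end

section \<open>Generalized derivations of the tangent bundle and their duals\<close>

locale gder = manifold \<A> for \<A> :: "('m::{t2_space, second_countable_topology}, 'e::real_inner) atlas" +
  fixes D :: "('m \<Rightarrow> 'm tvec) \<Rightarrow> 'm \<Rightarrow> 'm tvec \<Rightarrow> 'm tvec" and l r :: "'m \<Rightarrow> 'm tvec \<Rightarrow> 'm tvec"
  assumes gder: "(D, l, r) \<in> GDer1 \<A> (tangent_bundle \<A>)"
begin

lemma l_bundle_map [simp]: "l \<in> bundle_maps TM TM"
  and r_bundle_map [simp]: "r \<in> bundle_maps TM TM"
  and D_bundle_map [simp]: "u \<in> \<X> \<Longrightarrow> D u \<in> bundle_maps TM TM"
  and D_add: "u \<in> \<X> \<Longrightarrow> v \<in> \<X> \<Longrightarrow> D (u + v) = D u + D v"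
  and D_outside: "u \<notin> \<X> \<Longrightarrow> D u = 0"
  and D_fmult: "u \<in> \<X> \<Longrightarrow> f \<in> \<F> \<Longrightarrow> X \<in> \<X> \<Longrightarrow>
    D (f \<odot> u) \<star> X = f \<odot> (D u \<star> X) + lie_fun X f \<odot> (l \<star> u) - lie_fun (r \<star> X) f \<odot> u"
  using gder unfolding GDer1_def linear_on_space_def by auto

definition Dt :: "('m \<Rightarrow> 'm covec) \<Rightarrow> 'm \<Rightarrow> 'm tvec \<Rightarrow> 'm covec" where
  "Dt = fst (gder_dual \<A> TM (D, l, r))"

lemma gder_dual_eq: "gder_dual \<A> TM (D, l, r) = (Dt, dual_map TM l, r)"
  by (simp add: Dt_def gder_dual_def)

lemma Dt_outside: "\<mu> \<notin> \<Omega> \<Longrightarrow> Dt \<mu> = 0"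
  by (simp add: Dt_def gder_dual_def)

text \<open>
  The defining formula of \<open>D\<^sup>\<top>\<close> is linear over the smooth functions in \<open>u\<close>, where the terms
  \<open>(\<L>\<^sub>X f) \<langle>\<mu>, l(u)\<rangle>\<close> and \<open>(\<L>\<^bsub>r(X)\<^esub> f) \<langle>\<mu>, u\<rangle>\<close> from the Leibniz rules cancel, and in \<open>X\<close>. So it defines a one-form for every
  vector field \<open>X\<close>, and these one-forms come from a bundle map.
\<close>

lemma Dt:
  assumes \<mu>: "\<mu> \<in> \<Omega>"
  shows Dt_bundle_map [simp]: "Dt \<mu> \<in> bundle_maps TM TsM"
    and Dt_star: "X \<in> \<X> \<Longrightarrow> u \<in> \<X> \<Longrightarrow> (Dt \<mu> \<star> X) \<star> u =
      lie_fun X (\<mu> \<star> (l \<star> u)) - lie_fun (r \<star> X) (\<mu> \<star> u) - \<mu> \<star> (D u \<star> X)"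
proof -
  define \<omega> where "\<omega> X u = lie_fun X (\<mu> \<star> (l \<star> u)) - lie_fun (r \<star> X) (\<mu> \<star> u) - \<mu> \<star> (D u \<star> X)" for X u
  have \<omega>: "one_form_of \<A> (\<omega> X) \<in> \<Omega>" "u \<in> \<X> \<Longrightarrow> one_form_of \<A> (\<omega> X) \<star> u = \<omega> X u"
    if X: "X \<in> \<X>" for X u
  proof -
    have add: "\<omega> X (u + v) = \<omega> X u + \<omega> X v" if "u \<in> \<X>" "v \<in> \<X>" for u v
    proof -
      have "D (u + v) \<star> X = D u \<star> X + D v \<star> X" unfolding D_add[OF that] by simp
      then show ?thesis using that X \<mu> by (simp add: \<omega>_def)
    qed
    have fm: "\<omega> X (f \<odot> u) = f * \<omega> X u" if "f \<in> \<F>" "u \<in> \<X>" for f u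
      using that X \<mu> by (simp add: \<omega>_def D_fmult algebra_simps)
    have F: "\<omega> X u \<in> \<F>" if "u \<in> \<X>" for u using that X \<mu> by (simp add: \<omega>_def)
    show "one_form_of \<A> (\<omega> X) \<in> \<Omega>" "u \<in> \<X> \<Longrightarrow> one_form_of \<A> (\<omega> X) \<star> u = \<omega> X u"
      using one_form_of_tensorial[of "\<omega> X"] add fm F by blast+
  qed
  have add: "one_form_of \<A> (\<omega> (X + Y)) = one_form_of \<A> (\<omega> X) + one_form_of \<A> (\<omega> Y)"
    if "X \<in> \<X>" "Y \<in> \<X>" for X Y
    by (rule one_form_eqI) (use that \<omega> \<mu> in \<open>auto simp: \<omega>_def\<close>)
  have fm: "one_form_of \<A> (\<omega> (f \<odot> X)) = f \<odot> one_form_of \<A> (\<omega> X)" if "f \<in> \<F>" "X \<in> \<X>" for f X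
  proof (rule one_form_eqI)
    fix u assume u: "u \<in> \<X>"
    have "\<omega> (f \<odot> X) u = f * \<omega> X u" using that u \<mu> by (simp add: \<omega>_def algebra_simps)
    then show "one_form_of \<A> (\<omega> (f \<odot> X)) \<star> u = (f \<odot> one_form_of \<A> (\<omega> X)) \<star> u"
      using that u \<omega> by simp
  qed (use that \<omega> in auto)
  obtain \<eta> where \<eta>: "\<eta> \<in> bundle_maps TM TsM" "\<And>X. X \<in> \<X> \<Longrightarrow> \<eta> \<star> X = one_form_of \<A> (\<omega> X)"
    using tensorial_bundle_map[of "\<lambda>X. one_form_of \<A> (\<omega> X)" TsM] add fm \<omega>
    by (auto simp: fibre_TsM)
  have "Dt \<mu> = (THE \<eta>. \<eta> \<in> bundle_maps TM TsM \<and> (\<forall>X\<in>\<X>. \<forall>u\<in>\<X>. (\<eta> \<star> X) \<star> u = \<omega> X u))"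
    using \<mu> by (simp add: Dt_def gder_dual_def \<omega>_def)
  also have "\<dots> = \<eta>"
  proof (rule the_equality)
    show "\<eta> \<in> bundle_maps TM TsM \<and> (\<forall>X\<in>\<X>. \<forall>u\<in>\<X>. (\<eta> \<star> X) \<star> u = \<omega> X u)"
      using \<eta> \<omega> by simp
    fix \<theta> assume \<theta>: "\<theta> \<in> bundle_maps TM TsM \<and> (\<forall>X\<in>\<X>. \<forall>u\<in>\<X>. (\<theta> \<star> X) \<star> u = \<omega> X u)"
    have "\<theta> \<star> X = \<eta> \<star> X" if "X \<in> \<X>" for X
      by (rule one_form_eqI) (use \<theta> \<eta> \<omega> that in auto)
    then show "\<theta> = \<eta>" using \<theta> \<eta>(1) bundle_map_eqI by blast
  qed
  finally have "Dt \<mu> = \<eta>" .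
  then show "Dt \<mu> \<in> bundle_maps TM TsM"
    "X \<in> \<X> \<Longrightarrow> u \<in> \<X> \<Longrightarrow> (Dt \<mu> \<star> X) \<star> u =
      lie_fun X (\<mu> \<star> (l \<star> u)) - lie_fun (r \<star> X) (\<mu> \<star> u) - \<mu> \<star> (D u \<star> X)"
    using \<eta> \<omega> by (auto simp: \<omega>_def)
qed

lemma dual_l [simp]: "dual_map TM l \<in> bundle_maps TsM TsM"
  by (rule dual_map_bundle_map) simp

lemma dual_r [simp]: "dual_map TM r \<in> bundle_maps TsM TsM"
  by (rule dual_map_bundle_map) simp

lemma Dt_add: "\<mu> \<in> \<Omega> \<Longrightarrow> \<nu> \<in> \<Omega> \<Longrightarrow> Dt (\<mu> + \<nu>) = Dt \<mu> + Dt \<nu>"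
proof -
  assume *: "\<mu> \<in> \<Omega>" "\<nu> \<in> \<Omega>"
  have "Dt (\<mu> + \<nu>) \<star> X = (Dt \<mu> + Dt \<nu>) \<star> X" if "X \<in> \<X>" for X
    by (rule one_form_eqI) (use that * in \<open>auto simp: Dt_star\<close>)
  then show ?thesis
    by (intro fibre_map_eqI) (simp_all add: bundle_map_outside[OF Dt_bundle_map] *)
qed

lemma Dt_scaleR: "\<mu> \<in> \<Omega> \<Longrightarrow> Dt (c *\<^sub>R \<mu>) = c *\<^sub>R Dt \<mu>"
proof -
  assume *: "\<mu> \<in> \<Omega>"
  have sc: "c *\<^sub>R \<nu> = (\<lambda>_. c) \<odot> \<nu>" for \<nu> :: "'m \<Rightarrow> 'm covec"
    by (simp add: fmult_def fun_eq_iff)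
  have star: "(c *\<^sub>R Dt \<mu>) \<star> X = (\<lambda>_. c) \<odot> (Dt \<mu> \<star> X)" for X
    by (simp add: app_def fmult_def fun_eq_iff)
  have lie0: "lie_fun X (\<lambda>_. c) = 0" if "X \<in> \<X>" for X
    using tangent_const[OF vector_field_at[OF that]] by (simp add: lie_fun_def fun_eq_iff)
  have mem: "(\<lambda>_. c) \<odot> \<nu> \<in> \<Omega>" if "\<nu> \<in> \<Omega>" for \<nu> using that by simp
  have "Dt (c *\<^sub>R \<mu>) \<star> X = (c *\<^sub>R Dt \<mu>) \<star> X" if "X \<in> \<X>" for X
    unfolding star sc
    by (rule one_form_eqI) (use that * mem lie0 in \<open>auto simp: Dt_star algebra_simps\<close>)
  moreover have "c *\<^sub>R \<mu> \<in> \<Omega>" unfolding sc using * by (rule mem)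
  ultimately show ?thesis
    by (intro fibre_map_eqI) (simp_all add: bundle_map_outside[OF Dt_bundle_map] *)
qed

lemma Dt_fmult:
  "\<mu> \<in> \<Omega> \<Longrightarrow> f \<in> \<F> \<Longrightarrow> X \<in> \<X> \<Longrightarrow> Dt (f \<odot> \<mu>) \<star> X =
    f \<odot> (Dt \<mu> \<star> X) + lie_fun X f \<odot> (dual_map TM l \<star> \<mu>) - lie_fun (r \<star> X) f \<odot> \<mu>"
  by (rule one_form_eqI) (auto simp: Dt_star dual_map_star algebra_simps)

lemma gder_dual_GDer1: "(Dt, dual_map TM l, r) \<in> GDer1 \<A> TsM"
  unfolding GDer1_def
  using Dt_add Dt_scaleR Dt_outside Dt_fmult by (simp add: linear_on_space_def)

lemma eq_gder_T_iff:
  "(D, l, r) = gder_T \<A> r \<longleftrightarrow>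
    l = r \<and> (\<forall>u\<in>\<X>. \<forall>X\<in>\<X>. D u \<star> X = vf_bracket u (r \<star> X) - r \<star> vf_bracket u X)"
proof -
  have "(D, l, r) = gder_T \<A> r" if l: "l = r"
    and D: "\<And>u X. u \<in> \<X> \<Longrightarrow> X \<in> \<X> \<Longrightarrow> D u \<star> X = vf_bracket u (r \<star> X) - r \<star> vf_bracket u X"
  proof -
    have "D u = (THE \<eta>. \<eta> \<in> bundle_maps TM TM \<and>
        (\<forall>X\<in>\<X>. \<eta> \<star> X = vf_bracket u (r \<star> X) - r \<star> vf_bracket u X))" if u: "u \<in> \<X>" for u
      by (rule the_equality[symmetric]) (use u D in \<open>auto intro: bundle_map_eqI\<close>)
    then show ?thesis
      using l D_outside by (auto simp: gder_T_def fun_eq_iff)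
  qed
  moreover have "D u \<star> X = vf_bracket u (r \<star> X) - r \<star> vf_bracket u X"
    if eq: "(D, l, r) = gder_T \<A> r" and u: "u \<in> \<X>" and X: "X \<in> \<X>" for u X
  proof -
    define \<Phi> where "\<Phi> X = vf_bracket u (r \<star> X) - r \<star> vf_bracket u X" for X
    have add: "\<Phi> (X + Y) = \<Phi> X + \<Phi> Y" if "X \<in> \<X>" "Y \<in> \<X>" for X Y
      using u that by (simp add: \<Phi>_def bracket_add_right)
    have fm: "\<Phi> (f \<odot> X) = f \<odot> \<Phi> X" if "f \<in> \<F>" "X \<in> \<X>" for f X
    proof -
      have "f \<odot> (V - W) = f \<odot> V - f \<odot> W" for V W :: "'m \<Rightarrow> 'm tvec"
        by (simp add: fmult_def fun_eq_iff algebra_simps)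
      then show ?thesis
        using u that by (simp add: \<Phi>_def bracket_fmult_right)
    qed
    have sec: "\<Phi> X \<in> \<X>" if "X \<in> \<X>" for X using u that by (simp add: \<Phi>_def)
    obtain \<eta> where \<eta>: "\<eta> \<in> bundle_maps TM TM" "\<And>X. X \<in> \<X> \<Longrightarrow> \<eta> \<star> X = \<Phi> X"
      using tensorial_bundle_map[of \<Phi> TM] add fm sec by auto
    have "D u = (THE \<eta>. \<eta> \<in> bundle_maps TM TM \<and> (\<forall>X\<in>\<X>. \<eta> \<star> X = \<Phi> X))"
      using eq u by (simp add: gder_T_def \<Phi>_def)
    also have "\<dots> = \<eta>"
      by (rule the_equality) (use \<eta> in \<open>auto intro: bundle_map_eqI\<close>)
    finally show ?thesis using \<eta>(2)[OF X] by (simp add: \<Phi>_def)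
  qed
  moreover have "l = r" if "(D, l, r) = gder_T \<A> r" using that by (simp add: gder_T_def)
  ultimately show ?thesis by blast
qed

end

section \<open>Bivector fields and the bracket of one-forms\<close>

locale bivector = manifold \<A> for \<A> :: "('m::{t2_space, second_countable_topology}, 'e::real_inner) atlas" +
  fixes \<pi> :: "'m bivector"
  assumes bivector: "\<pi> \<in> bivector_fields \<A>"
begin

abbreviation "S \<equiv> sharp \<A> \<pi>"

lemma bivector_linear: "\<alpha> \<in> dual_space (tangent_space \<A> p) \<Longrightarrow>
    linear_on_space (dual_space (tangent_space \<A> p)) (\<pi> p \<alpha>)"
  and bivector_antisym: "\<alpha> \<in> dual_space (tangent_space \<A> p) \<Longrightarrow> \<beta> \<in> dual_space (tangent_space \<A> p) \<Longrightarrow>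
    \<pi> p \<alpha> \<beta> = - \<pi> p \<beta> \<alpha>"
  and bivector_smooth: "\<mu> \<in> \<Omega> \<Longrightarrow> \<nu> \<in> \<Omega> \<Longrightarrow> (\<lambda>p. \<pi> p (\<mu> p) (\<nu> p)) \<in> \<F>"
  using bivector unfolding bivector_fields_def fibre_TsM by blast+

lemma sharp_star_lie: "\<alpha> \<in> \<Omega> \<Longrightarrow> lie_fun (S \<star> \<alpha>) f = (\<lambda>p. \<pi> p (\<alpha> p) (differential \<A> f p))"
  by (simp add: lie_fun_def app_def sharp_def fibre_TsM)

lemma sharp_tangent:
  assumes "\<alpha> \<in> dual_space (tangent_space \<A> p)"
  shows "S p \<alpha> \<in> tangent_space \<A> p"
proof -
  have eq: "S p \<alpha> = (\<lambda>f. \<pi> p \<alpha> (differential \<A> f p))"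
    using assms by (simp add: sharp_def fibre_TsM)
  have add: "\<pi> p \<alpha> (\<beta> + \<gamma>) = \<pi> p \<alpha> \<beta> + \<pi> p \<alpha> \<gamma>"
    if "\<beta> \<in> dual_space (tangent_space \<A> p)" "\<gamma> \<in> dual_space (tangent_space \<A> p)" for \<beta> \<gamma>
    using bivector_linear[OF assms] that by (simp add: linear_on_space_def)
  have scaleR: "\<pi> p \<alpha> (c *\<^sub>R \<beta>) = c * \<pi> p \<alpha> \<beta>"
    if "\<beta> \<in> dual_space (tangent_space \<A> p)" for \<beta> c
    using bivector_linear[OF assms] that by (simp add: linear_on_space_def)
  have d: "differential \<A> (f + g) p = differential \<A> f p + differential \<A> g p"
    "differential \<A> (c *\<^sub>R f) p = c *\<^sub>R differential \<A> f p"
    "differential \<A> (f * g) p = f p *\<^sub>R differential \<A> g p + g p *\<^sub>R differential \<A> f p"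
    if "f \<in> \<F>" "g \<in> \<F>" for f g c
    using that by (auto simp: differential_def fun_eq_iff tangent_add tangent_scaleR tangent_mult)
  have out: "differential \<A> f p = 0" if "f \<notin> \<F>" for f
    using that by (auto simp: differential_def fun_eq_iff tangent_outside)
  have "\<pi> p \<alpha> (differential \<A> f p) = 0" if "f \<notin> \<F>" for f
    using scaleR[OF differential_covector, of 0] out[OF that] by simp
  then show ?thesis
    unfolding tangent_space_def eq linear_on_space_def
    by (simp add: d add scaleR)
qed

lemma sharp_field [simp]: "\<alpha> \<in> \<Omega> \<Longrightarrow> S \<star> \<alpha> \<in> \<X>"
proof (rule vector_fieldI)
  assume \<alpha>: "\<alpha> \<in> \<Omega>"
  show "(S \<star> \<alpha>) p \<in> tangent_space \<A> p" for p
    using sharp_tangent[OF one_form_at[OF \<alpha>]] by (simp add: app_def)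
  show "lie_fun (S \<star> \<alpha>) f \<in> \<F>" if "f \<in> \<F>" for f
    unfolding sharp_star_lie[OF \<alpha>] by (rule bivector_smooth) (use \<alpha> that in auto)
qed

text \<open>
  A covector at \<open>p\<close> is a combination of differentials, on which \<open>\<pi>\<^sup>\<sharp>(\<alpha>)\<close> is given by its definition.
\<close>

lemma sharp_pairing:
  assumes \<alpha>: "\<alpha> \<in> \<Omega>" and \<beta>: "\<beta> \<in> \<Omega>"
  shows "\<beta> \<star> (S \<star> \<alpha>) = (\<lambda>p. \<pi> p (\<alpha> p) (\<beta> p))"
proof
  fix p
  obtain I :: "'e option set" and x :: "'e option \<Rightarrow> 'm \<Rightarrow> real" and E \<kappa>
    where fr: "finite I" "\<kappa> \<in> \<F>" "\<kappa> p = 1" "\<And>i. x i \<in> \<F>" "\<And>i. E i \<in> \<X>"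
    "\<And>q v. v \<in> tangent_space \<A> q \<Longrightarrow> \<kappa> q *\<^sub>R v = (\<Sum>i\<in>I. v (x i) *\<^sub>R E i q)"
    by (rule frame_at[of p], rule that)
  let ?V = "dual_space (tangent_space \<A> p)"
  let ?v = "S p (\<alpha> p)"
  have v: "?v \<in> tangent_space \<A> p" using sharp_tangent[OF one_form_at[OF \<alpha>]] .
  have lin: "linear_on_space ?V (\<pi> p (\<alpha> p))" using bivector_linear[OF one_form_at[OF \<alpha>]] .
  have "0 \<in> ?V" by (simp add: dual_space_def linear_on_space_def)
  have \<beta>p: "\<beta> p = (\<Sum>i\<in>I. \<beta> p (E i p) *\<^sub>R differential \<A> (x i) p)"
    using covector_frame[OF fr(1,4,5,6) one_form_at[OF \<beta>, of p]] fr(3) by simp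
  have "\<beta> p ?v = (\<Sum>i\<in>I. \<beta> p (E i p) * ?v (x i))"
    using fun_cong[OF \<beta>p, of ?v] v by (simp add: sum_fun_apply differential_def)
  also have "\<dots> = (\<Sum>i\<in>I. \<pi> p (\<alpha> p) (\<beta> p (E i p) *\<^sub>R differential \<A> (x i) p))"
    using lin \<alpha> by (simp add: linear_on_space_def sharp_def fibre_TsM)
  also have "\<dots> = \<pi> p (\<alpha> p) (\<Sum>i\<in>I. \<beta> p (E i p) *\<^sub>R differential \<A> (x i) p)"
    using additive_on_sum[of ?V "\<pi> p (\<alpha> p)" I "\<lambda>i. \<beta> p (E i p) *\<^sub>R differential \<A> (x i) p"] lin
      \<open>0 \<in> ?V\<close> by (simp add: linear_on_space_def)
  also have "\<dots> = \<pi> p (\<alpha> p) (\<beta> p)" using \<beta>p by simp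
  finally show "(\<beta> \<star> S \<star> \<alpha>) p = \<pi> p (\<alpha> p) (\<beta> p)" by (simp add: app_def)
qed

lemma sharp_antisym:
  assumes \<alpha>: "\<alpha> \<in> \<Omega>" and \<beta>: "\<beta> \<in> \<Omega>"
  shows "\<beta> \<star> (S \<star> \<alpha>) = - (\<alpha> \<star> (S \<star> \<beta>))"
  unfolding sharp_pairing[OF \<alpha> \<beta>] sharp_pairing[OF \<beta> \<alpha>]
  using bivector_antisym[OF one_form_at[OF \<alpha>] one_form_at[OF \<beta>]] by (simp add: fun_eq_iff)

lemma sharp_lie_antisym: "\<alpha> \<in> \<Omega> \<Longrightarrow> f \<in> \<F> \<Longrightarrow> lie_fun (S \<star> \<alpha>) f = - (\<alpha> \<star> (S \<star> differential \<A> f))"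
  using sharp_antisym[of \<alpha> "differential \<A> f"] by simp

lemma sharp_add [simp]: "\<alpha> \<in> \<Omega> \<Longrightarrow> \<beta> \<in> \<Omega> \<Longrightarrow> S \<star> (\<alpha> + \<beta>) = S \<star> \<alpha> + S \<star> \<beta>"
  by (rule vector_field_eqI) (simp_all add: sharp_lie_antisym)

lemma sharp_fmult [simp]: "\<alpha> \<in> \<Omega> \<Longrightarrow> f \<in> \<F> \<Longrightarrow> S \<star> (f \<odot> \<alpha>) = f \<odot> (S \<star> \<alpha>)"
  by (rule vector_field_eqI) (simp_all add: sharp_lie_antisym)

lemma cotangent_bracket_Omega [simp]: "\<alpha> \<in> \<Omega> \<Longrightarrow> \<beta> \<in> \<Omega> \<Longrightarrow> form_bracket \<A> S \<alpha> \<beta> \<in> \<Omega>"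
  by (simp add: form_bracket_Omega)

lemma cotangent_bracket_star:
  "\<alpha> \<in> \<Omega> \<Longrightarrow> \<beta> \<in> \<Omega> \<Longrightarrow> Y \<in> \<X> \<Longrightarrow> form_bracket \<A> S \<alpha> \<beta> \<star> Y =
    lie_fun (S \<star> \<alpha>) (\<beta> \<star> Y) - \<beta> \<star> vf_bracket (S \<star> \<alpha>) Y
    - (lie_fun (S \<star> \<beta>) (\<alpha> \<star> Y) - lie_fun Y (\<alpha> \<star> (S \<star> \<beta>)) - \<alpha> \<star> vf_bracket (S \<star> \<beta>) Y)"
  by (simp add: form_bracket_star)

lemma cotangent_bracket_antisym:
  assumes "\<alpha> \<in> \<Omega>" "\<beta> \<in> \<Omega>"
  shows "form_bracket \<A> S \<beta> \<alpha> = - form_bracket \<A> S \<alpha> \<beta>"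
  by (rule one_form_eqI)
    (use assms in \<open>simp_all add: cotangent_bracket_star sharp_antisym[OF assms] algebra_simps\<close>)

lemma cotangent_bracket_add:
  "\<alpha> \<in> \<Omega> \<Longrightarrow> \<beta> \<in> \<Omega> \<Longrightarrow> \<gamma> \<in> \<Omega> \<Longrightarrow>
    form_bracket \<A> S \<alpha> (\<beta> + \<gamma>) = form_bracket \<A> S \<alpha> \<beta> + form_bracket \<A> S \<alpha> \<gamma>"
  by (rule one_form_eqI) (simp_all add: cotangent_bracket_star bracket_add_left algebra_simps)

lemma cotangent_bracket_fmult:
  "\<alpha> \<in> \<Omega> \<Longrightarrow> \<beta> \<in> \<Omega> \<Longrightarrow> f \<in> \<F> \<Longrightarrow>
    form_bracket \<A> S \<alpha> (f \<odot> \<beta>) = f \<odot> form_bracket \<A> S \<alpha> \<beta> + lie_fun (S \<star> \<alpha>) f \<odot> \<beta>"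
  by (rule one_form_eqI) (simp_all add: cotangent_bracket_star bracket_fmult_left algebra_simps)

text \<open>
  Equivalently, \<open>[df, \<beta>]\<^sub>\<pi>\<close> is the Lie derivative of \<open>\<beta>\<close> along \<open>\<pi>\<^sup>\<sharp>(df)\<close>, since \<open>d(df) = 0\<close>.
\<close>

lemma cotangent_bracket_exact_star:
  "f \<in> \<F> \<Longrightarrow> \<beta> \<in> \<Omega> \<Longrightarrow> Y \<in> \<X> \<Longrightarrow> form_bracket \<A> S (differential \<A> f) \<beta> \<star> Y =
    lie_fun (S \<star> differential \<A> f) (\<beta> \<star> Y) - \<beta> \<star> vf_bracket (S \<star> differential \<A> f) Y"
  by (simp add: cotangent_bracket_star algebra_simps)

lemma cotangent_bracket_exact:
  "f \<in> \<F> \<Longrightarrow> g \<in> \<F> \<Longrightarrow> form_bracket \<A> S (differential \<A> f) (differential \<A> g) =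
    differential \<A> (lie_fun (S \<star> differential \<A> f) g)"
  by (rule one_form_eqI) (simp_all add: cotangent_bracket_exact_star algebra_simps)

end

section \<open>IM tensors on the tangent algebroid\<close>

lemma tangent_algebroid_simps [simp]:
  "sections (tangent_algebroid \<A>) = vector_fields \<A>"
  "fibre (tangent_algebroid \<A>) = fibre (tangent_bundle \<A>)"
  "bracket (tangent_algebroid \<A>) = vf_bracket"
  "anchor (tangent_algebroid \<A>) = (\<lambda>p v. v)"
  by (simp_all add: tangent_algebroid_def)

lemma cotangent_algebroid_simps [simp]:
  "sections (cotangent_algebroid \<A> \<pi>) = one_forms \<A>"
  "fibre (cotangent_algebroid \<A> \<pi>) = fibre (cotangent_bundle \<A>)"
  "bracket (cotangent_algebroid \<A> \<pi>) = form_bracket \<A> (sharp \<A> \<pi>)"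
  "anchor (cotangent_algebroid \<A> \<pi>) = sharp \<A> \<pi>"
  by (simp_all add: cotangent_algebroid_def)

lemma star_identity [simp]: "(\<lambda>p v. v) \<star> u = u"
  by (simp add: app_def)

lemma GDer1_tangent_algebroid: "GDer1 \<A> (tangent_algebroid \<A>) = GDer1 \<A> (tangent_bundle \<A>)"
  unfolding GDer1_def bundle_maps_def tangent_algebroid_simps ..

lemma GDer1_cotangent_algebroid: "GDer1 \<A> (cotangent_algebroid \<A> \<pi>) = GDer1 \<A> (cotangent_bundle \<A>)"
  unfolding GDer1_def bundle_maps_def cotangent_algebroid_simps ..

lemma gder_dual_tangent_algebroid: "gder_dual \<A> (tangent_algebroid \<A>) = gder_dual \<A> (tangent_bundle \<A>)"
  unfolding gder_dual_def dual_bundle_def dual_map_def tangent_algebroid_simps ..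

context gder
begin

lemma IM_tangent_imp_canonical:
  assumes "IM_tensor \<A> (tangent_algebroid \<A>) (D, l, r)"
  shows "l = r" "u \<in> \<X> \<Longrightarrow> X \<in> \<X> \<Longrightarrow> D u \<star> X = vf_bracket u (r \<star> X) - r \<star> vf_bracket u X"
proof -
  have IM3: "r \<star> vf_bracket u X = vf_bracket u (r \<star> X) - D u \<star> X" if "u \<in> \<X>" "X \<in> \<X>" for u X
    using assms that by (simp add: IM_tensor_def)
  then show "u \<in> \<X> \<Longrightarrow> X \<in> \<X> \<Longrightarrow> D u \<star> X = vf_bracket u (r \<star> X) - r \<star> vf_bracket u X"
    by (simp add: algebra_simps)
  have "r p v = l p v" if "v \<in> tangent_space \<A> p" for p v
    using assms that by (simp add: IM_tensor_def)
  then have "l \<star> X = r \<star> X" if "X \<in> \<X>" for X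
    using that by (simp add: app_def)
  then show "l = r" by (rule bundle_map_eqI[OF l_bundle_map r_bundle_map])
qed

end

text \<open>
  The situation in which \<open>(D, r, r)\<close> is \<open>\<D>\<^bsup>r,T\<^esup>\<close>, with \<open>D\<close> given by its values on sections.
\<close>

locale canonical_gder = gder \<A> D r r
  for \<A> :: "('m::{t2_space, second_countable_topology}, 'e::real_inner) atlas" and D r +
  assumes D_star: "u \<in> \<X> \<Longrightarrow> X \<in> \<X> \<Longrightarrow> D u \<star> X = vf_bracket u (r \<star> X) - r \<star> vf_bracket u X"
begin

text \<open>
  Conditions (IM2) and (IM3) are both the formula for \<open>D\<close>. In (IM1) the terms \<open>[a, r([b, X])]\<close> and
  \<open>[b, r([a, X])]\<close> cancel, and the others match by the Jacobi identity for \<open>a, b, r(X)\<close> and for \<open>a, b, X\<close>.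
\<close>

lemma IM_tangent: "IM_tensor \<A> (tangent_algebroid \<A>) (D, r, r)"
proof -
  have "D (vf_bracket a b) \<star> X = vf_bracket a (D b \<star> X) - vf_bracket b (D a \<star> X)
      + D a \<star> vf_bracket b X - D b \<star> vf_bracket a X" if "a \<in> \<X>" "b \<in> \<X>" "X \<in> \<X>" for a b X
  proof -
    have J: "vf_bracket (vf_bracket a b) Z = vf_bracket a (vf_bracket b Z) - vf_bracket b (vf_bracket a Z)"
      if "Z \<in> \<X>" for Z
      using jacobi[of a b Z] \<open>a \<in> \<X>\<close> \<open>b \<in> \<X>\<close> that by simp
    show ?thesis using that by (simp add: D_star bracket_diff_right J algebra_simps)
  qed
  moreover have "r \<star> vf_bracket a b = vf_bracket a (r \<star> b) - D a \<star> b" if "a \<in> \<X>" "b \<in> \<X>" for a b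
    using that by (simp add: D_star)
  moreover have "r \<star> vf_bracket a X = vf_bracket a (r \<star> X) - D a \<star> X" if "a \<in> \<X>" "X \<in> \<X>" for a X
    using that by (simp add: D_star)
  ultimately show ?thesis
    using gder by (simp add: IM_tensor_def GDer1_tangent_algebroid)
qed

text \<open>
  The defect of \<open>D\<^sub>X \<circ> r = r \<circ> D\<^sub>X\<close> at \<open>u\<close> is the torsion of \<open>r\<close> at \<open>(u, X)\<close>. In the last condition the
  torsion at \<open>([u, Y], X)\<close> brings \<open>D\<^sub>X D\<^sub>Y(u)\<close> to the form \<open>second\<close> below. Its antisymmetrization in \<open>X\<close> and \<open>Y\<close> consists of
  brackets of \<open>u\<close> with \<open>[r(Y), r(X)]\<close>, \<open>[r(Y), X]\<close>, \<open>[Y, r(X)]\<close> and \<open>[Y, X]\<close>, by the Jacobi identity. The torsion at \<open>(Y, X)\<close>,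
  that is \<open>r(Z) = [r(Y), r(X)]\<close> for the vector field \<open>Z\<close> of that condition, gives the same terms for \<open>D\<^sub>Z(u)\<close>.
\<close>

lemma square_zero:
  assumes "nijenhuis_torsion_zero \<A> r"
  shows "gder_square_zero \<A> (tangent_algebroid \<A>) (D, r, r)"
proof -
  have T: "vf_bracket (r \<star> X) (r \<star> Y) =
      r \<star> vf_bracket (r \<star> X) Y + r \<star> vf_bracket X (r \<star> Y) - r \<star> (r \<star> vf_bracket X Y)"
    if "X \<in> \<X>" "Y \<in> \<X>" for X Y
    using assms that by (simp add: nijenhuis_torsion_zero_def algebra_simps)
  have commute: "D (r \<star> u) \<star> X = r \<star> (D u \<star> X)" if "X \<in> \<X>" "u \<in> \<X>" for X u
    using that by (simp add: D_star T)
  have flat: "D (D u \<star> Y) \<star> X - D (D u \<star> X) \<star> Y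
      - D u \<star> (vf_bracket (r \<star> Y) X + vf_bracket Y (r \<star> X) - r \<star> vf_bracket Y X)
      + r \<star> (D u \<star> vf_bracket Y X) = 0" if "X \<in> \<X>" "Y \<in> \<X>" "u \<in> \<X>" for X Y u
  proof -
    have second: "D (D u \<star> Y) \<star> X = vf_bracket (vf_bracket u (r \<star> Y)) (r \<star> X)
        - r \<star> vf_bracket (vf_bracket u Y) (r \<star> X) - r \<star> vf_bracket (vf_bracket u (r \<star> Y)) X
        + r \<star> (r \<star> vf_bracket (vf_bracket u Y) X)" if "X \<in> \<X>" "Y \<in> \<X>" for X Y
      using that \<open>u \<in> \<X>\<close> by (simp add: D_star bracket_diff_left T algebra_simps)
    have J: "vf_bracket u (vf_bracket A B) = vf_bracket (vf_bracket u A) B - vf_bracket (vf_bracket u B) A"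
      if "A \<in> \<X>" "B \<in> \<X>" for A B
      using jacobi[of u A B] bracket_antisym[of A "vf_bracket u B"] that \<open>u \<in> \<X>\<close> by simp
    let ?Z = "vf_bracket (r \<star> Y) X + vf_bracket Y (r \<star> X) - r \<star> vf_bracket Y X"
    have Z: "?Z \<in> \<X>" using that by simp
    have rZ: "r \<star> ?Z = vf_bracket (r \<star> Y) (r \<star> X)" using that T[of Y X] by simp
    have "D u \<star> ?Z = vf_bracket u (vf_bracket (r \<star> Y) (r \<star> X)) - r \<star> vf_bracket u ?Z"
      unfolding D_star[OF that(3) Z] rZ ..
    also have "\<dots> = vf_bracket u (vf_bracket (r \<star> Y) (r \<star> X))
        - r \<star> vf_bracket u (vf_bracket (r \<star> Y) X) - r \<star> vf_bracket u (vf_bracket Y (r \<star> X))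
        + r \<star> vf_bracket u (r \<star> vf_bracket Y X)"
      using that by (simp add: bracket_add_right bracket_diff_right)
    finally have Z: "D u \<star> ?Z = vf_bracket u (vf_bracket (r \<star> Y) (r \<star> X))
        - r \<star> vf_bracket u (vf_bracket (r \<star> Y) X) - r \<star> vf_bracket u (vf_bracket Y (r \<star> X))
        + r \<star> vf_bracket u (r \<star> vf_bracket Y X)" .
    have "r \<star> (D u \<star> vf_bracket Y X) =
        r \<star> vf_bracket u (r \<star> vf_bracket Y X) - r \<star> (r \<star> vf_bracket u (vf_bracket Y X))"
      using that by (simp add: D_star)
    then show ?thesis
      unfolding Z second[OF that(1,2)] second[OF that(2,1)]
      using that by (simp add: J)
  qed
  show ?thesis
    using assms commute flat by (simp add: gder_square_zero_def)
qed

end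

section \<open>IM tensors on the cotangent algebroid\<close>

locale canonical_gder_bivector = canonical_gder \<A> D r + bivector \<A> \<pi>
  for \<A> :: "('m::{t2_space, second_countable_topology}, 'e::real_inner) atlas" and D r \<pi>
begin

abbreviation "rd \<equiv> dual_map TM r"
abbreviation "brk \<equiv> form_bracket \<A> S"

lemma Dt_canonical:
  "\<mu> \<in> \<Omega> \<Longrightarrow> X \<in> \<X> \<Longrightarrow> u \<in> \<X> \<Longrightarrow> (Dt \<mu> \<star> X) \<star> u =
    lie_fun X (\<mu> \<star> (r \<star> u)) - lie_fun (r \<star> X) (\<mu> \<star> u) - \<mu> \<star> vf_bracket u (r \<star> X) + \<mu> \<star> (r \<star> vf_bracket u X)"
  by (simp add: Dt_star D_star)

text \<open>
  \<open>D\<^sup>\<top>\<^sub>X(df) = i\<^sub>X d(r\<^sup>*df)\<close>: the terms with \<open>\<L>\<^bsub>r(X)\<^esub>\<close> cancel against those of the bracket with \<open>r(X)\<close>.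
\<close>

lemma Dt_exact:
  "f \<in> \<F> \<Longrightarrow> X \<in> \<X> \<Longrightarrow> Y \<in> \<X> \<Longrightarrow>
    (Dt (differential \<A> f) \<star> X) \<star> Y = ext_deriv (rd \<star> differential \<A> f) X Y"
  using bracket_antisym[of Y X]
  by (simp add: Dt_canonical ext_deriv_def dual_map_star algebra_simps)

text \<open>
  Both brackets contain the Lie derivative of \<open>\<beta>\<close> along \<open>r(\<pi>\<^sup>\<sharp>(\<alpha>)) = \<pi>\<^sup>\<sharp>(r\<^sup>*\<alpha>)\<close>. The difference of the rest is
  \<open>i\<^sub>Z d(r\<^sup>*\<alpha>) - i\<^bsub>r(Z)\<^esub> d\<alpha>\<close> with \<open>Z = \<pi>\<^sup>\<sharp>(\<beta>)\<close>, which is another expression for \<open>D\<^sup>\<top>\<^sub>Z(\<alpha>)\<close>.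
\<close>

lemma form_bracket_difference:
  assumes anchor: "\<And>\<alpha>. \<alpha> \<in> \<Omega> \<Longrightarrow> S \<star> (rd \<star> \<alpha>) = r \<star> (S \<star> \<alpha>)"
    and "\<alpha> \<in> \<Omega>" "\<beta> \<in> \<Omega>"
  shows "form_bracket \<A> (\<lambda>p. r p \<circ> S p) \<alpha> \<beta> = brk (rd \<star> \<alpha>) \<beta> + Dt \<alpha> \<star> (S \<star> \<beta>)"
proof -
  have star: "(\<lambda>p. r p \<circ> S p) \<star> \<gamma> = r \<star> (S \<star> \<gamma>)" for \<gamma>
    by (simp add: app_def)
  show ?thesis
  proof (rule one_form_eqI)
    show "form_bracket \<A> (\<lambda>p. r p \<circ> S p) \<alpha> \<beta> \<in> \<Omega>"
      using assms(2,3) by (intro form_bracket_Omega) (simp_all add: star)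
    show "brk (rd \<star> \<alpha>) \<beta> + Dt \<alpha> \<star> (S \<star> \<beta>) \<in> \<Omega>" using assms(2,3) by simp
    fix Y assume "Y \<in> \<X>"
    then show "form_bracket \<A> (\<lambda>p. r p \<circ> S p) \<alpha> \<beta> \<star> Y = (brk (rd \<star> \<alpha>) \<beta> + Dt \<alpha> \<star> (S \<star> \<beta>)) \<star> Y"
      using assms(2,3) bracket_antisym[of Y "r \<star> (S \<star> \<beta>)"] bracket_antisym[of Y "S \<star> \<beta>"]
      by (simp add: form_bracket_star star cotangent_bracket_star anchor dual_map_star Dt_canonical algebra_simps)
  qed
qed

text \<open>
  By the antisymmetry of \<open>\<pi>\<close>, pairing the claim with \<open>\<beta>\<close> involves only the value of \<open>D\<^sup>\<top>\<^sub>X(\<alpha>)\<close> on \<open>\<pi>\<^sup>\<sharp>(\<beta>)\<close>.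
  The result is (IM2) for \<open>\<alpha>\<close> and \<open>\<beta>\<close>, evaluated on \<open>X\<close>. Differentials \<open>\<beta>\<close> separate vector fields.
\<close>

lemma IM3_dual:
  assumes anchor: "\<And>\<alpha>. \<alpha> \<in> \<Omega> \<Longrightarrow> S \<star> (rd \<star> \<alpha>) = r \<star> (S \<star> \<alpha>)"
    and IM2: "\<And>\<alpha> \<beta>. \<alpha> \<in> \<Omega> \<Longrightarrow> \<beta> \<in> \<Omega> \<Longrightarrow> rd \<star> brk \<alpha> \<beta> = brk \<alpha> (rd \<star> \<beta>) - Dt \<alpha> \<star> (S \<star> \<beta>)"
    and \<alpha>: "\<alpha> \<in> \<Omega>" and X: "X \<in> \<X>"
  shows "r \<star> vf_bracket (S \<star> \<alpha>) X = vf_bracket (S \<star> \<alpha>) (r \<star> X) - S \<star> (Dt \<alpha> \<star> X)"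
proof -
  have test: "\<beta> \<star> (r \<star> vf_bracket (S \<star> \<alpha>) X) =
      \<beta> \<star> (vf_bracket (S \<star> \<alpha>) (r \<star> X) - S \<star> (Dt \<alpha> \<star> X))" if \<beta>: "\<beta> \<in> \<Omega>" for \<beta>
  proof -
    have sh: "\<beta> \<star> (S \<star> (Dt \<alpha> \<star> X)) = - ((Dt \<alpha> \<star> X) \<star> (S \<star> \<beta>))"
      using \<alpha> \<beta> X by (intro sharp_antisym) auto
    have "(rd \<star> brk \<alpha> \<beta>) \<star> X = (brk \<alpha> (rd \<star> \<beta>) - Dt \<alpha> \<star> (S \<star> \<beta>)) \<star> X"
      using IM2[OF \<alpha> \<beta>] by simp
    then show ?thesis
      using \<alpha> \<beta> X bracket_antisym[of X "r \<star> (S \<star> \<beta>)"] bracket_antisym[of X "S \<star> \<beta>"]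
        bracket_antisym[of "S \<star> \<beta>" "r \<star> X"]
      by (simp add: sh dual_map_star cotangent_bracket_star anchor Dt_canonical algebra_simps)
  qed
  have fields: "r \<star> vf_bracket (S \<star> \<alpha>) X \<in> \<X>" "vf_bracket (S \<star> \<alpha>) (r \<star> X) - S \<star> (Dt \<alpha> \<star> X) \<in> \<X>"
    using \<alpha> X by auto
  then show ?thesis
  proof (rule vector_field_eqI)
    fix f assume "f \<in> \<F>"
    from test[OF Omega_differential[OF this]]
    show "lie_fun (r \<star> vf_bracket (S \<star> \<alpha>) X) f =
        lie_fun (vf_bracket (S \<star> \<alpha>) (r \<star> X) - S \<star> (Dt \<alpha> \<star> X)) f"
      unfolding differential_star[OF fields(1)] differential_star[OF fields(2)] .
  qed
qed

definition IM1_defect :: "('m \<Rightarrow> 'm tvec) \<Rightarrow> ('m \<Rightarrow> 'm covec) \<Rightarrow> ('m \<Rightarrow> 'm covec) \<Rightarrow> 'm \<Rightarrow> 'm covec" where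
  "IM1_defect X \<alpha> \<beta> = Dt (brk \<alpha> \<beta>) \<star> X - brk \<alpha> (Dt \<beta> \<star> X) + brk \<beta> (Dt \<alpha> \<star> X)
     - Dt \<alpha> \<star> vf_bracket (S \<star> \<beta>) X + Dt \<beta> \<star> vf_bracket (S \<star> \<alpha>) X"

lemma IM1_defect_Omega: "X \<in> \<X> \<Longrightarrow> \<alpha> \<in> \<Omega> \<Longrightarrow> \<beta> \<in> \<Omega> \<Longrightarrow> IM1_defect X \<alpha> \<beta> \<in> \<Omega>"
  by (simp add: IM1_defect_def)

lemma IM1_defect_antisym:
  assumes "X \<in> \<X>" "\<alpha> \<in> \<Omega>" "\<beta> \<in> \<Omega>"
  shows "IM1_defect X \<beta> \<alpha> = - IM1_defect X \<alpha> \<beta>"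
proof -
  have "Dt (- \<mu>) = - Dt \<mu>" if "\<mu> \<in> \<Omega>" for \<mu>
    using Dt_scaleR[OF that, of "-1"] by simp
  then show ?thesis
    using assms by (simp add: IM1_defect_def cotangent_bracket_antisym[of \<alpha> \<beta>])
qed

lemma IM1_defect_add:
  assumes "X \<in> \<X>" "\<alpha> \<in> \<Omega>" "\<beta> \<in> \<Omega>" "\<gamma> \<in> \<Omega>"
  shows "IM1_defect X \<alpha> (\<beta> + \<gamma>) = IM1_defect X \<alpha> \<beta> + IM1_defect X \<alpha> \<gamma>"
proof -
  have left: "brk (\<beta> + \<gamma>) \<delta> = brk \<beta> \<delta> + brk \<gamma> \<delta>" if "\<delta> \<in> \<Omega>" for \<delta>
    using assms that cotangent_bracket_antisym[of \<delta> "\<beta> + \<gamma>"] cotangent_bracket_antisym[of \<delta> \<beta>]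
      cotangent_bracket_antisym[of \<delta> \<gamma>] by (simp add: cotangent_bracket_add)
  show ?thesis
    using assms
    by (simp add: IM1_defect_def cotangent_bracket_add left Dt_add bracket_add_left algebra_simps)
qed

text \<open>
  Expanding by the Leibniz rules leaves, besides \<open>f\<close> times the defect, three terms: \<open>\<L>\<^sub>X f\<close> times the
  defect of (IM2), the commutator identity for \<open>X\<close> and \<open>\<pi>\<^sup>\<sharp>(\<alpha>)\<close> applied to \<open>f\<close>, times \<open>r\<^sup>*\<beta>\<close>, and the defect of
  (IM3) applied to \<open>f\<close>, times \<open>\<beta>\<close>. All of them vanish.
\<close>

lemma IM1_defect_fmult:
  assumes IM2: "\<And>\<alpha> \<beta>. \<alpha> \<in> \<Omega> \<Longrightarrow> \<beta> \<in> \<Omega> \<Longrightarrow> rd \<star> brk \<alpha> \<beta> = brk \<alpha> (rd \<star> \<beta>) - Dt \<alpha> \<star> (S \<star> \<beta>)"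
    and IM3: "\<And>\<alpha> X. \<alpha> \<in> \<Omega> \<Longrightarrow> X \<in> \<X> \<Longrightarrow>
      r \<star> vf_bracket (S \<star> \<alpha>) X = vf_bracket (S \<star> \<alpha>) (r \<star> X) - S \<star> (Dt \<alpha> \<star> X)"
    and X: "X \<in> \<X>" and \<alpha>: "\<alpha> \<in> \<Omega>" and \<beta>: "\<beta> \<in> \<Omega>" and f: "f \<in> \<F>"
  shows "IM1_defect X \<alpha> (f \<odot> \<beta>) = f \<odot> IM1_defect X \<alpha> \<beta>"
proof (rule one_form_eqI)
  fix Y assume Y: "Y \<in> \<X>"
  have [simp]: "Dt \<mu> \<star> Z \<in> \<Omega>" if "\<mu> \<in> \<Omega>" "Z \<in> \<X>" for \<mu> Z using that by simp
  have left: "brk (f \<odot> \<beta>) \<gamma> = f \<odot> brk \<beta> \<gamma> - lie_fun (S \<star> \<gamma>) f \<odot> \<beta>" if "\<gamma> \<in> \<Omega>" for \<gamma>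
  proof -
    have "f \<odot> (- \<mu>) = - (f \<odot> \<mu>)" for \<mu> :: "'m \<Rightarrow> 'm covec" by (simp add: fmult_def fun_eq_iff)
    then show ?thesis
      using cotangent_bracket_antisym[of \<gamma> "f \<odot> \<beta>"] cotangent_bracket_antisym[of \<gamma> \<beta>] that f \<beta>
      by (simp add: cotangent_bracket_fmult)
  qed
  have diff: "brk \<alpha> (\<gamma> - \<delta>) = brk \<alpha> \<gamma> - brk \<alpha> \<delta>" if "\<gamma> \<in> \<Omega>" "\<delta> \<in> \<Omega>" for \<gamma> \<delta>
    using cotangent_bracket_add[OF \<alpha>, of "\<gamma> - \<delta>" \<delta>] that by simp
  have IM2': "(rd \<star> brk \<alpha> \<beta>) \<star> Y = brk \<alpha> (rd \<star> \<beta>) \<star> Y - (Dt \<alpha> \<star> (S \<star> \<beta>)) \<star> Y"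
    using IM2[OF \<alpha> \<beta>] by simp
  have IM3': "lie_fun (r \<star> vf_bracket (S \<star> \<alpha>) X) f =
      lie_fun (S \<star> \<alpha>) (lie_fun (r \<star> X) f) - lie_fun (r \<star> X) (lie_fun (S \<star> \<alpha>) f) - lie_fun (S \<star> (Dt \<alpha> \<star> X)) f"
    using IM3[OF \<alpha> X] by simp
  have e1: "Dt (brk \<alpha> (f \<odot> \<beta>)) \<star> X = f \<odot> (Dt (brk \<alpha> \<beta>) \<star> X) + lie_fun X f \<odot> (rd \<star> brk \<alpha> \<beta>)
      - lie_fun (r \<star> X) f \<odot> brk \<alpha> \<beta> + lie_fun (S \<star> \<alpha>) f \<odot> (Dt \<beta> \<star> X)
      + lie_fun X (lie_fun (S \<star> \<alpha>) f) \<odot> (rd \<star> \<beta>) - lie_fun (r \<star> X) (lie_fun (S \<star> \<alpha>) f) \<odot> \<beta>"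
    using X \<alpha> \<beta> f by (simp add: cotangent_bracket_fmult Dt_add Dt_fmult)
  have e2: "brk \<alpha> (Dt (f \<odot> \<beta>) \<star> X) = f \<odot> brk \<alpha> (Dt \<beta> \<star> X) + lie_fun (S \<star> \<alpha>) f \<odot> (Dt \<beta> \<star> X)
      + lie_fun X f \<odot> brk \<alpha> (rd \<star> \<beta>) + lie_fun (S \<star> \<alpha>) (lie_fun X f) \<odot> (rd \<star> \<beta>)
      - lie_fun (r \<star> X) f \<odot> brk \<alpha> \<beta> - lie_fun (S \<star> \<alpha>) (lie_fun (r \<star> X) f) \<odot> \<beta>"
    using X \<alpha> \<beta> f by (simp add: cotangent_bracket_fmult cotangent_bracket_add diff Dt_fmult)
  have e3: "Dt \<alpha> \<star> vf_bracket (S \<star> (f \<odot> \<beta>)) X = f \<odot> (Dt \<alpha> \<star> vf_bracket (S \<star> \<beta>) X) - lie_fun X f \<odot> (Dt \<alpha> \<star> (S \<star> \<beta>))"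
    using X \<alpha> \<beta> f by (simp add: bracket_fmult_left)
  have e4: "Dt (f \<odot> \<beta>) \<star> vf_bracket (S \<star> \<alpha>) X = f \<odot> (Dt \<beta> \<star> vf_bracket (S \<star> \<alpha>) X)
      + lie_fun (vf_bracket (S \<star> \<alpha>) X) f \<odot> (rd \<star> \<beta>) - lie_fun (r \<star> vf_bracket (S \<star> \<alpha>) X) f \<odot> \<beta>"
    using X \<alpha> \<beta> f by (simp add: Dt_fmult)
  show "IM1_defect X \<alpha> (f \<odot> \<beta>) \<star> Y = (f \<odot> IM1_defect X \<alpha> \<beta>) \<star> Y"
    unfolding IM1_defect_def e1 e2 e3 e4 IM3'
    using X \<alpha> \<beta> f by (simp add: left IM2' algebra_simps)
qed (use X \<alpha> \<beta> f in \<open>simp_all add: IM1_defect_Omega\<close>)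

text \<open>
  For \<open>h = \<pi>(df, dg)\<close> one has \<open>[df, dg]\<^sub>\<pi> = dh\<close>, and (IM2) expresses \<open>r\<^sup>*dh\<close> by the Lie derivatives of \<open>r\<^sup>*dg\<close> and
  \<open>r\<^sup>*df\<close> along \<open>\<pi>\<^sup>\<sharp>(df)\<close> and \<open>\<pi>\<^sup>\<sharp>(dg)\<close>, up to an exact form. The exterior derivative of this identity is (IM1).
\<close>

lemma IM1_defect_exact:
  assumes IM2: "\<And>\<alpha> \<beta>. \<alpha> \<in> \<Omega> \<Longrightarrow> \<beta> \<in> \<Omega> \<Longrightarrow> rd \<star> brk \<alpha> \<beta> = brk \<alpha> (rd \<star> \<beta>) - Dt \<alpha> \<star> (S \<star> \<beta>)"
    and X: "X \<in> \<X>" and f: "f \<in> \<F>" and g: "g \<in> \<F>"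
  shows "IM1_defect X (differential \<A> f) (differential \<A> g) = 0"
proof -
  let ?f = "differential \<A> f" and ?g = "differential \<A> g"
  let ?\<theta> = "rd \<star> ?f" and ?\<eta> = "rd \<star> ?g" and ?V = "S \<star> ?f" and ?W = "S \<star> ?g"
  let ?h = "lie_fun ?V g"
  have \<Omega>: "?f \<in> \<Omega>" "?g \<in> \<Omega>" "?\<theta> \<in> \<Omega>" "?\<eta> \<in> \<Omega>" using f g by auto
  then have \<X>: "?V \<in> \<X>" "?W \<in> \<X>" by auto
  have bracket: "rd \<star> differential \<A> ?h = lie_form \<A> ?V ?\<eta> - lie_form \<A> ?W ?\<theta> + differential \<A> (?\<theta> \<star> ?W)"
  proof (rule one_form_eqI)
    fix Z assume Z: "Z \<in> \<X>"
    have "rd \<star> differential \<A> ?h = brk ?f ?\<eta> - Dt ?f \<star> ?W"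
      using IM2[OF \<Omega>(1,2)] cotangent_bracket_exact[OF f g] by simp
    then show "(rd \<star> differential \<A> ?h) \<star> Z =
        (lie_form \<A> ?V ?\<eta> - lie_form \<A> ?W ?\<theta> + differential \<A> (?\<theta> \<star> ?W)) \<star> Z"
      using f \<Omega> \<X> Z by (simp add: cotangent_bracket_exact_star Dt_exact ext_deriv_def)
  qed (use f g \<Omega> \<X> in auto)
  have ext: "ext_deriv (\<alpha> - \<beta> + \<gamma>) A B = ext_deriv \<alpha> A B - ext_deriv \<beta> A B + ext_deriv \<gamma> A B"
    if "\<alpha> \<in> \<Omega>" "\<beta> \<in> \<Omega>" "\<gamma> \<in> \<Omega>" "A \<in> \<X>" "B \<in> \<X>" for \<alpha> \<beta> \<gamma> A B
    using that by (simp add: ext_deriv_def)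
  have "IM1_defect X ?f ?g \<star> Y = 0 \<star> Y" if Y: "Y \<in> \<X>" for Y
  proof -
    have Dtf: "Dt ?f \<star> X \<in> \<Omega>" "Dt ?g \<star> X \<in> \<Omega>" using \<Omega> X by auto
    have "(Dt (brk ?f ?g) \<star> X) \<star> Y = ext_deriv (rd \<star> differential \<A> ?h) X Y"
      using f g \<X> X Y by (simp add: cotangent_bracket_exact Dt_exact)
    also have "\<dots> = ext_deriv (lie_form \<A> ?V ?\<eta>) X Y - ext_deriv (lie_form \<A> ?W ?\<theta>) X Y"
      unfolding bracket using \<Omega> \<X> X Y by (simp add: ext ext_deriv_differential)
    finally have "(Dt (brk ?f ?g) \<star> X) \<star> Y = ext_deriv (lie_form \<A> ?V ?\<eta>) X Y - ext_deriv (lie_form \<A> ?W ?\<theta>) X Y" .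
    then show ?thesis
      unfolding IM1_defect_def
      using f g \<Omega> \<X> X Y Dtf
      by (simp add: ext_deriv_lie_form cotangent_bracket_exact_star Dt_exact app_def[of 0] zero_fun_def[symmetric])
  qed
  moreover have "0 \<in> \<Omega>" using Omega_diff[OF \<Omega>(1,1)] by simp
  ultimately show ?thesis
    using \<Omega> X by (intro one_form_eqI) (simp_all add: IM1_defect_Omega)
qed

lemma compatible_iff_IM_dual:
  "poisson_compatible \<A> \<pi> r \<longleftrightarrow> IM_tensor \<A> (cotangent_algebroid \<A> \<pi>) (Dt, rd, r)"
proof -
  define anchor_compatible where
    "anchor_compatible \<longleftrightarrow> (\<forall>p. \<forall>\<alpha>\<in>fibre TsM p. r p (S p \<alpha>) = S p (rd p \<alpha>))"
  define bracket_compatible where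
    "bracket_compatible \<longleftrightarrow> (\<forall>\<alpha>\<in>\<Omega>. \<forall>\<beta>\<in>\<Omega>. form_bracket \<A> (\<lambda>p. r p \<circ> S p) \<alpha> \<beta> =
       brk (rd \<star> \<alpha>) \<beta> + brk \<alpha> (rd \<star> \<beta>) - rd \<star> brk \<alpha> \<beta>)"
  define IM2 where
    "IM2 \<longleftrightarrow> (\<forall>\<alpha>\<in>\<Omega>. \<forall>\<beta>\<in>\<Omega>. rd \<star> brk \<alpha> \<beta> = brk \<alpha> (rd \<star> \<beta>) - Dt \<alpha> \<star> (S \<star> \<beta>))"
  have compatible: "poisson_compatible \<A> \<pi> r \<longleftrightarrow> anchor_compatible \<and> bracket_compatible"
    by (simp only: poisson_compatible_def Let_def anchor_compatible_def bracket_compatible_def)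
  have anchor: "S \<star> (rd \<star> \<alpha>) = r \<star> (S \<star> \<alpha>)" if anchor_compatible "\<alpha> \<in> \<Omega>" for \<alpha>
    using that by (simp add: anchor_compatible_def app_def fibre_TsM)
  have iff: "bracket_compatible \<longleftrightarrow> IM2" if anchor_compatible
  proof -
    have "form_bracket \<A> (\<lambda>p. r p \<circ> S p) \<alpha> \<beta> = brk (rd \<star> \<alpha>) \<beta> + brk \<alpha> (rd \<star> \<beta>) - rd \<star> brk \<alpha> \<beta> \<longleftrightarrow>
        rd \<star> brk \<alpha> \<beta> = brk \<alpha> (rd \<star> \<beta>) - Dt \<alpha> \<star> (S \<star> \<beta>)" if "\<alpha> \<in> \<Omega>" "\<beta> \<in> \<Omega>" for \<alpha> \<beta>
    proof -
      have "form_bracket \<A> (\<lambda>p. r p \<circ> S p) \<alpha> \<beta> = brk (rd \<star> \<alpha>) \<beta> + Dt \<alpha> \<star> (S \<star> \<beta>)"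
        using anchor[OF \<open>anchor_compatible\<close>] that by (rule form_bracket_difference)
      then show ?thesis by (auto simp: algebra_simps)
    qed
    then show ?thesis by (simp add: bracket_compatible_def IM2_def)
  qed
  have IM: "IM_tensor \<A> (cotangent_algebroid \<A> \<pi>) (Dt, rd, r)" if anchor_compatible IM2
  proof -
    have im2: "rd \<star> brk \<alpha> \<beta> = brk \<alpha> (rd \<star> \<beta>) - Dt \<alpha> \<star> (S \<star> \<beta>)" if "\<alpha> \<in> \<Omega>" "\<beta> \<in> \<Omega>" for \<alpha> \<beta>
      using \<open>IM2\<close> that by (simp add: IM2_def)
    have im3: "r \<star> vf_bracket (S \<star> \<alpha>) X = vf_bracket (S \<star> \<alpha>) (r \<star> X) - S \<star> (Dt \<alpha> \<star> X)"
      if "\<alpha> \<in> \<Omega>" "X \<in> \<X>" for \<alpha> X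
      using anchor[OF \<open>anchor_compatible\<close>] im2 that by (rule IM3_dual)
    have fmult: "IM1_defect X \<alpha> (f \<odot> \<beta>) = f \<odot> IM1_defect X \<alpha> \<beta>"
      if "X \<in> \<X>" "\<alpha> \<in> \<Omega>" "\<beta> \<in> \<Omega>" "f \<in> \<F>" for X \<alpha> \<beta> f
      using im2 im3 that by (rule IM1_defect_fmult)
    have both_exact: "IM1_defect X (differential \<A> f) (differential \<A> g) = 0"
      if "X \<in> \<X>" "f \<in> \<F>" "g \<in> \<F>" for X f g
      using im2 that by (rule IM1_defect_exact)
    \<comment> \<open>By antisymmetry the defect is a tensor in either argument, so exact forms are replaced by general ones one argument at a time.\<close>
    have exact: "IM1_defect X (differential \<A> f) \<beta> = 0" if "X \<in> \<X>" "f \<in> \<F>" "\<beta> \<in> \<Omega>" for X f \<beta>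
      using tensorial_on_forms_vanishes[of "IM1_defect X (differential \<A> f)" \<beta>]
        IM1_defect_add fmult both_exact that by simp
    have zero: "IM1_defect X \<alpha> \<beta> = 0" if "X \<in> \<X>" "\<alpha> \<in> \<Omega>" "\<beta> \<in> \<Omega>" for X \<alpha> \<beta>
    proof -
      have "IM1_defect X \<alpha> (differential \<A> f) = 0" if "f \<in> \<F>" for f
        using IM1_defect_antisym[of X "differential \<A> f" \<alpha>] exact \<open>X \<in> \<X>\<close> \<open>\<alpha> \<in> \<Omega>\<close> that by simp
      then show ?thesis
        using tensorial_on_forms_vanishes[of "IM1_defect X \<alpha>" \<beta>] IM1_defect_add fmult that by simp
    qed
    have im1: "Dt (brk \<alpha> \<beta>) \<star> X = brk \<alpha> (Dt \<beta> \<star> X) - brk \<beta> (Dt \<alpha> \<star> X)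
        + Dt \<alpha> \<star> vf_bracket (S \<star> \<beta>) X - Dt \<beta> \<star> vf_bracket (S \<star> \<alpha>) X"
      if "\<alpha> \<in> \<Omega>" "\<beta> \<in> \<Omega>" "X \<in> \<X>" for \<alpha> \<beta> X
      using zero[OF that(3,1,2)] by (simp add: IM1_defect_def algebra_simps)
    show ?thesis
      using im1 im2 im3 that(1) gder_dual_GDer1
      by (simp add: IM_tensor_def GDer1_cotangent_algebroid anchor_compatible_def)
  qed
  show ?thesis
  proof
    assume "poisson_compatible \<A> \<pi> r"
    then show "IM_tensor \<A> (cotangent_algebroid \<A> \<pi>) (Dt, rd, r)"
      using compatible iff IM by blast
  next
    assume "IM_tensor \<A> (cotangent_algebroid \<A> \<pi>) (Dt, rd, r)"
    then have anchor_compatible IM2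
      by (simp_all add: IM_tensor_def anchor_compatible_def IM2_def)
    then show "poisson_compatible \<A> \<pi> r" using compatible iff by blast
  qed
qed

lemma bialgebroid_iff_poisson_nijenhuis:
  assumes "poisson_structure \<A> \<pi>"
  shows "lie_nijenhuis_bialgebroid \<A> (tangent_algebroid \<A>) (cotangent_algebroid \<A> \<pi>) (D, r, r)
    \<longleftrightarrow> poisson_nijenhuis \<A> \<pi> r"
proof -
  have "gder_square_zero \<A> (tangent_algebroid \<A>) (D, r, r) \<longleftrightarrow> nijenhuis_torsion_zero \<A> r"
    using square_zero by (auto simp: gder_square_zero_def)
  then show ?thesis
    using assms gder IM_tangent compatible_iff_IM_dual gder_dual_eq
    by (simp add: lie_nijenhuis_bialgebroid_def poisson_nijenhuis_def GDer1_tangent_algebroid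
        gder_dual_tangent_algebroid)
qed

end

section \<open>Lie-Nijenhuis bialgebroid structures on the tangent bundle\<close>

theorem proposition4p5:
  fixes \<A> :: "('m::{t2_space, second_countable_topology}, 'e::real_inner) atlas"
    and \<pi> :: "'m bivector"
    and D :: "('m \<Rightarrow> 'm tvec) \<Rightarrow> 'm \<Rightarrow> 'm tvec \<Rightarrow> 'm tvec"
    and l r :: "'m \<Rightarrow> 'm tvec \<Rightarrow> 'm tvec"
  assumes "smooth_manifold \<A>"
    and "poisson_structure \<A> \<pi>"
    and "(D, l, r) \<in> GDer1 \<A> (tangent_bundle \<A>)"
  shows "lie_nijenhuis_bialgebroid \<A> (tangent_algebroid \<A>) (cotangent_algebroid \<A> \<pi>) (D, l, r)
     \<longleftrightarrow> poisson_nijenhuis \<A> \<pi> r \<and> (D, l, r) = gder_T \<A> r"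
proof -
  interpret gder \<A> D l r
    by unfold_locales (use assms in auto)
  have bivector: "\<pi> \<in> bivector_fields \<A>"
    using assms(2) by (simp add: poisson_structure_def)
  have main: "lie_nijenhuis_bialgebroid \<A> (tangent_algebroid \<A>) (cotangent_algebroid \<A> \<pi>) (D, l, r)
      \<longleftrightarrow> poisson_nijenhuis \<A> \<pi> r"
    if l: "l = r" and D: "\<forall>u\<in>\<X>. \<forall>X\<in>\<X>. D u \<star> X = vf_bracket u (r \<star> X) - r \<star> vf_bracket u X"
  proof -
    have "canonical_gder_bivector \<A> D r \<pi>"
      by unfold_locales (use assms l D bivector in auto)
    then show ?thesis
      unfolding l using assms(2) by (rule canonical_gder_bivector.bialgebroid_iff_poisson_nijenhuis)
  qed
  show ?thesis
  proof
    assume L: "lie_nijenhuis_bialgebroid \<A> (tangent_algebroid \<A>) (cotangent_algebroid \<A> \<pi>) (D, l, r)"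
    then have "IM_tensor \<A> (tangent_algebroid \<A>) (D, l, r)"
      by (simp add: lie_nijenhuis_bialgebroid_def)
    from IM_tangent_imp_canonical[OF this]
    show "poisson_nijenhuis \<A> \<pi> r \<and> (D, l, r) = gder_T \<A> r"
      using main L eq_gder_T_iff by blast
  next
    assume "poisson_nijenhuis \<A> \<pi> r \<and> (D, l, r) = gder_T \<A> r"
    then show "lie_nijenhuis_bialgebroid \<A> (tangent_algebroid \<A>) (cotangent_algebroid \<A> \<pi>) (D, l, r)"
      using main eq_gder_T_iff by blast
  qed
qed

end
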